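(* Let $G$ be a finite group and $p$ a fixed prime divisor of $|G|$. Then every self-centralizing non-abelian subgroup of $G$ is a TI-subgroup of $G$ or subnormal in $G$ or has $p'$-order if and only if every non-abelian subgroup of $G$ is a TI-subgroup of $G$ or subnormal in $G$ or has $p'$-order.
   Context: All groups are finite. A subgroup $H$ of a group $G$ is a TI-subgroup of $G$ if for every $g\in G$, $H^g\cap H=1$ or $H^g\cap H=H$. A subgroup $H$ of $G$ is self-centralizing in $G$ if $C_G(H)\leq H$. A subgroup has $p'$-order if its order is not divisible by $p$. *)

theory Defs
  imports "HOL-Algebra.Algebra"
begin

definition conj_sub :: "('a, 'b) monoid_scheme \<Rightarrow> 'a set \<Rightarrow> 'a \<Rightarrow> 'a set" where
  "conj_sub G H g = {inv\<^bsub>G\<^esub> g \<otimes>\<^bsub>G\<^esub> h \<otimes>\<^bsub>G\<^esub> g | h. h \<in> H}"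

definition TI_subgroup :: "'a set \<Rightarrow> ('a, 'b) monoid_scheme \<Rightarrow> bool" where
  "TI_subgroup H G \<longleftrightarrow> subgroup H G \<and>
     (\<forall>g \<in> carrier G. conj_sub G H g \<inter> H = {\<one>\<^bsub>G\<^esub>} \<or> conj_sub G H g \<inter> H = H)"

definition centralizer :: "('a, 'b) monoid_scheme \<Rightarrow> 'a set \<Rightarrow> 'a set" where
  "centralizer G H = {x \<in> carrier G. \<forall>h \<in> H. x \<otimes>\<^bsub>G\<^esub> h = h \<otimes>\<^bsub>G\<^esub> x}"

definition self_centralizing :: "'a set \<Rightarrow> ('a, 'b) monoid_scheme \<Rightarrow> bool" where
  "self_centralizing H G \<longleftrightarrow> subgroup H G \<and> centralizer G H \<subseteq> H"

definition non_abelian :: "'a set \<Rightarrow> ('a, 'b) monoid_scheme \<Rightarrow> bool" where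
  "non_abelian H G \<longleftrightarrow> (\<exists>x \<in> H. \<exists>y \<in> H. x \<otimes>\<^bsub>G\<^esub> y \<noteq> y \<otimes>\<^bsub>G\<^esub> x)"

inductive subnormal :: "('a, 'b) monoid_scheme \<Rightarrow> 'a set \<Rightarrow> bool" for G where
  top: "subnormal G (carrier G)"
| step: "subnormal G K \<Longrightarrow> subgroup K G \<Longrightarrow> H \<lhd> (G\<lparr>carrier := K\<rparr>) \<Longrightarrow> subnormal G H"

definition p'_order :: "nat \<Rightarrow> 'a set \<Rightarrow> bool" where
  "p'_order p H \<longleftrightarrow> \<not> p dvd card H"

end

theory Submission
  imports Defs
begin

text \<open>
  Let \<open>H\<close> be non-abelian of order divisible by \<open>p\<close> and put $K = H C_G(H)$, which is self-centralizing.
  If \<open>K\<close> is subnormal, so is \<open>H\<close>. Otherwise \<open>K\<close> is TI, and so is its normalizer \<open>M\<close>, which is moreover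
  self-normalizing; thus \<open>M\<close> is malnormal in \<open>G\<close>, like a Frobenius complement. The key point is that
  \<open>G\<close> then has a nontrivial abelian normal subgroup \<open>A\<close>; this replaces Frobenius's theorem. If there
  were none, the perfect residual \<open>D\<close> of \<open>G\<close> would be nontrivial. The transfer homomorphism shows that
  malnormal subgroups of perfect groups are perfect, while the hypothesis on \<open>G\<close>, applied to subgroups
  containing a Sylow \<open>p\<close>-subgroup \<open>P\<close>, yields a malnormal subgroup containing \<open>P\<close> that meets \<open>D\<close>
  trivially. Then \<open>P\<close> acts fixed-point-freely on \<open>D\<close> and normalizes a Sylow subgroup \<open>Q\<close> of \<open>D\<close>. The
  group $PQ$ is self-centralizing: if it is TI, then \<open>Q\<close> is malnormal in \<open>D\<close>, hence perfect, which is
  absurd; if it is subnormal, then \<open>Q\<close> is normal in \<open>G\<close> and its centre is abelian normal.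

  Now \<open>K\<close> acts fixed-point-freely on \<open>A\<close>, so it has no subgroup $C_r \times C_r$. This forces the central
  factor \<open>H\<close> of \<open>K\<close> to be invariant under the normalizer of \<open>K\<close>, and therefore \<open>H\<close> is TI.
\<close>

section \<open>Conjugation, normalizers and products of subgroups\<close>

locale fin_group = group G for G (structure) +
  assumes fin [simp]: "finite (carrier G)"

text \<open>\<open>conj_by G g x\<close> is $g x g^{-1}$, so \<open>conj_sub G H g\<close> is the image of \<open>H\<close> under
  \<open>conj_by G (inv g)\<close>. Since all groups are finite, the one-sided condition in
  \<open>normalizer_of\<close> already defines the normalizer.\<close>

definition conj_by :: "('a, 'b) monoid_scheme \<Rightarrow> 'a \<Rightarrow> 'a \<Rightarrow> 'a" where
  "conj_by G g x = g \<otimes>\<^bsub>G\<^esub> x \<otimes>\<^bsub>G\<^esub> inv\<^bsub>G\<^esub> g"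

definition normalizer_of :: "('a, 'b) monoid_scheme \<Rightarrow> 'a set \<Rightarrow> 'a set" where
  "normalizer_of G S = {g \<in> carrier G. \<forall>s \<in> S. conj_by G g s \<in> S}"

context group
begin

lemma mult_inv_cancel [simp]:
  assumes "x \<in> carrier G" "y \<in> carrier G"
  shows "x \<otimes> (inv x \<otimes> y) = y" "inv x \<otimes> (x \<otimes> y) = y"
  using assms by (simp_all add: m_assoc[symmetric])

lemma conj_by_closed [simp, intro]: "g \<in> carrier G \<Longrightarrow> x \<in> carrier G \<Longrightarrow> conj_by G g x \<in> carrier G"
  by (simp add: conj_by_def)

lemma conj_by_mult: "g \<in> carrier G \<Longrightarrow> x \<in> carrier G \<Longrightarrow> y \<in> carrier G \<Longrightarrow>
  conj_by G g (x \<otimes> y) = conj_by G g x \<otimes> conj_by G g y"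
  by (simp add: conj_by_def m_assoc)

lemma conj_by_conj_by: "g \<in> carrier G \<Longrightarrow> h \<in> carrier G \<Longrightarrow> x \<in> carrier G \<Longrightarrow>
  conj_by G g (conj_by G h x) = conj_by G (g \<otimes> h) x"
  by (simp add: conj_by_def m_assoc inv_mult_group)

lemma conj_by_one [simp]: "x \<in> carrier G \<Longrightarrow> conj_by G \<one> x = x"
  by (simp add: conj_by_def)

lemma conj_by_of_one [simp]: "g \<in> carrier G \<Longrightarrow> conj_by G g \<one> = \<one>"
  by (simp add: conj_by_def)

lemma conj_by_inv: "g \<in> carrier G \<Longrightarrow> x \<in> carrier G \<Longrightarrow> conj_by G g (inv x) = inv (conj_by G g x)"
  by (simp add: conj_by_def m_assoc inv_mult_group)

lemma conj_by_inv_cancel [simp]: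
  assumes "g \<in> carrier G" "x \<in> carrier G"
  shows "conj_by G g (conj_by G (inv g) x) = x" "conj_by G (inv g) (conj_by G g x) = x"
  using assms by (simp_all add: conj_by_conj_by)

lemma conj_by_pow: "g \<in> carrier G \<Longrightarrow> x \<in> carrier G \<Longrightarrow> conj_by G g (x [^] (n::nat)) = conj_by G g x [^] n"
  by (induction n) (simp_all add: conj_by_mult)

lemma conj_by_eq_iff: "g \<in> carrier G \<Longrightarrow> x \<in> carrier G \<Longrightarrow> conj_by G g x = x \<longleftrightarrow> g \<otimes> x = x \<otimes> g"
  by (simp add: conj_by_def) (metis inv_solve_right' m_closed)

lemma conj_by_inj: "g \<in> carrier G \<Longrightarrow> x \<in> carrier G \<Longrightarrow> y \<in> carrier G \<Longrightarrow> conj_by G g x = conj_by G g y \<Longrightarrow> x = y"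
  by (metis conj_by_inv_cancel(2))

lemma conj_by_eq_one [simp]: "g \<in> carrier G \<Longrightarrow> x \<in> carrier G \<Longrightarrow> conj_by G g x = \<one> \<longleftrightarrow> x = \<one>"
  by (metis conj_by_inj conj_by_of_one one_closed)

lemma subgroup_mem: "subgroup H G \<Longrightarrow> x \<in> H \<Longrightarrow> x \<in> carrier G"
  by (simp add: subgroup.mem_carrier)

lemma sub_conj_by: "subgroup H G \<Longrightarrow> g \<in> H \<Longrightarrow> x \<in> H \<Longrightarrow> conj_by G g x \<in> H"
  by (simp add: conj_by_def subgroup.m_closed subgroup.m_inv_closed)

lemma conj_by_img_subgroup:
  assumes "subgroup H G" "g \<in> carrier G"
  shows "subgroup (conj_by G g ` H) G"
proof
  show "conj_by G g ` H \<subseteq> carrier G" using assms by (auto dest: subgroup_mem)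
  show "\<one> \<in> conj_by G g ` H" using assms subgroup.one_closed by (metis conj_by_of_one imageI)
next
  fix x y assume "x \<in> conj_by G g ` H" "y \<in> conj_by G g ` H"
  then show "x \<otimes> y \<in> conj_by G g ` H"
    using assms by (auto simp: conj_by_mult[symmetric] subgroup_mem subgroup.m_closed)
next
  fix x assume "x \<in> conj_by G g ` H"
  then show "inv x \<in> conj_by G g ` H"
    using assms by (auto simp: conj_by_inv[symmetric] subgroup_mem subgroup.m_inv_closed)
qed

lemma conj_by_inj_on: "H \<subseteq> carrier G \<Longrightarrow> g \<in> carrier G \<Longrightarrow> inj_on (conj_by G g) H"
  by (meson conj_by_inj inj_onI subsetD)

lemma card_conj_by_img: "H \<subseteq> carrier G \<Longrightarrow> g \<in> carrier G \<Longrightarrow> card (conj_by G g ` H) = card H"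
  by (simp add: card_image conj_by_inj_on)

lemma subgroup_transfer: "subgroup H G \<Longrightarrow> subgroup K G \<Longrightarrow> H \<subseteq> K \<Longrightarrow> subgroup H (G\<lparr>carrier := K\<rparr>)"
  by (simp add: subgroup_incl)

end

section \<open>Normalizers, centralizers and products in a finite group\<close>

context fin_group
begin

lemma finite_subgroup: "subgroup H G \<Longrightarrow> finite H"
  using finite_subset subgroup.subset fin by blast

lemma card_sub_pos: "subgroup H G \<Longrightarrow> card H > 0"
  using finite_subgroup subgroup.one_closed by (metis card_gt_0_iff empty_iff)

lemma card_dvd:
  assumes "subgroup H G" "subgroup K G" "H \<subseteq> K"
  shows "card H dvd card K"
proof -
  interpret K: group "G\<lparr>carrier := K\<rparr>" using assms subgroup_imp_group by blast
  have "card (rcosets\<^bsub>G\<lparr>carrier := K\<rparr>\<^esub> H) * card H = order (G\<lparr>carrier := K\<rparr>)"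
    using K.lagrange subgroup_transfer[OF assms] by blast
  then show ?thesis by (simp add: order_def) (metis dvd_triv_right)
qed

lemma subgroup_eqI: "subgroup H G \<Longrightarrow> subgroup K G \<Longrightarrow> H \<subseteq> K \<Longrightarrow> card K dvd card H \<Longrightarrow> H = K"
  by (metis card_dvd card_subset_eq dvd_antisym finite_subgroup)

text \<open>In a finite group the inverse of \<open>a\<close> is the power of \<open>a\<close> with
  exponent \<open>ord a - 1\<close>, so closure under products already yields inverses.\<close>

lemma finite_subgroupI:
  assumes "S \<subseteq> carrier G" "\<one> \<in> S" "\<And>x y. x \<in> S \<Longrightarrow> y \<in> S \<Longrightarrow> x \<otimes> y \<in> S"
  shows "subgroup S G"
proof (rule subgroupI)
  fix a assume a: "a \<in> S"
  have p: "a [^] (n::nat) \<in> S" for n using a assms by (induction n) auto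
  have ac: "a \<in> carrier G" using a assms by blast
  have "ord a \<ge> 1" using ac ord_ge_1 fin by blast
  then have "a \<otimes> a [^] (ord a - 1) = \<one>"
    using ac pow_ord_eq_1[of a] nat_pow_Suc2[of a "ord a - 1"] by simp
  then have "inv a = a [^] (ord a - 1)" using ac inv_equality nat_pow_closed inv_comm by metis
  then show "inv a \<in> S" using p by simp
qed (use assms in auto)

lemma normalizer_subgroup: "S \<subseteq> carrier G \<Longrightarrow> subgroup (normalizer_of G S) G"
  by (rule finite_subgroupI) (auto simp: normalizer_of_def conj_by_conj_by[symmetric] subset_iff)

lemma normalizerI: "g \<in> carrier G \<Longrightarrow> (\<And>s. s \<in> S \<Longrightarrow> conj_by G g s \<in> S) \<Longrightarrow> g \<in> normalizer_of G S"
  by (simp add: normalizer_of_def)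

lemma normalizer_carrier: "g \<in> normalizer_of G S \<Longrightarrow> g \<in> carrier G"
  by (simp add: normalizer_of_def)

lemma normalizerD: "g \<in> normalizer_of G S \<Longrightarrow> s \<in> S \<Longrightarrow> conj_by G g s \<in> S"
  by (simp add: normalizer_of_def)

lemma normalizerD': "S \<subseteq> carrier G \<Longrightarrow> g \<in> normalizer_of G S \<Longrightarrow> s \<in> S \<Longrightarrow> conj_by G (inv g) s \<in> S"
  by (meson normalizerD normalizer_subgroup subgroup.m_inv_closed)

lemma normalizer_img: "S \<subseteq> carrier G \<Longrightarrow> g \<in> normalizer_of G S \<Longrightarrow> conj_by G g ` S = S"
  by (metis card_conj_by_img card_subset_eq fin finite_subset image_subsetI normalizerD normalizer_carrier)

lemma sub_in_normalizer: "subgroup H G \<Longrightarrow> H \<subseteq> normalizer_of G H"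
  by (auto intro!: normalizerI simp: subgroup_mem sub_conj_by)

lemma centralizer_subgroup: "S \<subseteq> carrier G \<Longrightarrow> subgroup (centralizer G S) G"
proof (rule finite_subgroupI)
  fix x y assume S: "S \<subseteq> carrier G" and "x \<in> centralizer G S" "y \<in> centralizer G S"
  then have x: "x \<in> carrier G" "\<And>h. h \<in> S \<Longrightarrow> x \<otimes> h = h \<otimes> x"
    and y: "y \<in> carrier G" "\<And>h. h \<in> S \<Longrightarrow> y \<otimes> h = h \<otimes> y"
    by (auto simp: centralizer_def)
  have "x \<otimes> y \<otimes> h = h \<otimes> (x \<otimes> y)" if h: "h \<in> S" for h
  proof -
    have hc: "h \<in> carrier G" using h S by blast
    have "x \<otimes> y \<otimes> h = x \<otimes> h \<otimes> y"
      using y(2)[OF h] x(1) y(1) hc by (simp add: m_assoc)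
    then show ?thesis using x(2)[OF h] x(1) y(1) hc by (simp add: m_assoc)
  qed
  then show "x \<otimes> y \<in> centralizer G S" using x(1) y(1) by (simp add: centralizer_def)
qed (auto simp: centralizer_def)

lemma set_mult_subgroup:
  assumes "subgroup H G" "subgroup K G" "H \<subseteq> normalizer_of G K"
  shows "subgroup (H <#> K) G"
proof (rule finite_subgroupI)
  note c = subgroup_mem[OF assms(1)] subgroup_mem[OF assms(2)]
  show "H <#> K \<subseteq> carrier G" using c by (auto simp: set_mult_def)
  show "\<one> \<in> H <#> K" using assms subgroup.one_closed by (force simp: set_mult_def)
  fix x y assume "x \<in> H <#> K" "y \<in> H <#> K"
  then obtain h k h' k' where e: "h \<in> H" "k \<in> K" "h' \<in> H" "k' \<in> K" "x = h \<otimes> k" "y = h' \<otimes> k'"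
    by (auto simp: set_mult_def)
  have "x \<otimes> y = (h \<otimes> h') \<otimes> (conj_by G (inv h') k \<otimes> k')"
    using e c by (simp add: conj_by_def m_assoc)
  moreover have "conj_by G (inv h') k \<in> K" using e assms by (meson normalizerD' subgroup.subset subsetD)
  ultimately show "x \<otimes> y \<in> H <#> K" unfolding set_mult_def
    using e assms by (auto intro!: exI subgroup.m_closed)
qed

lemma set_multI: "h \<in> H \<Longrightarrow> k \<in> K \<Longrightarrow> h \<otimes> k \<in> H <#> K"
  by (auto simp: set_mult_def)

lemma set_multE: "x \<in> H <#> K \<Longrightarrow> (\<And>h k. h \<in> H \<Longrightarrow> k \<in> K \<Longrightarrow> x = h \<otimes> k \<Longrightarrow> thesis) \<Longrightarrow> thesis"
  by (auto simp: set_mult_def)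

lemma set_mult_upper1: "subgroup H G \<Longrightarrow> subgroup K G \<Longrightarrow> H \<subseteq> H <#> K"
  using subgroup.one_closed set_multI subgroup_mem r_one by (metis subsetI)

lemma set_mult_upper2: "subgroup H G \<Longrightarrow> subgroup K G \<Longrightarrow> K \<subseteq> H <#> K"
  using subgroup.one_closed set_multI subgroup_mem l_one by (metis subsetI)

lemma set_mult_least: "subgroup L G \<Longrightarrow> H \<subseteq> L \<Longrightarrow> K \<subseteq> L \<Longrightarrow> H <#> K \<subseteq> L"
  by (auto simp: set_mult_def subgroup.m_closed subset_iff)

end

text \<open>Orbits of a p-group have p-power length, so modulo p only the orbits of length one
  count. The action is a plain function \<open>f\<close>; it is restricted to \<open>E\<close>
  because the elements of \<open>Bij E\<close> are extensional, which makes the orbit-stabilizer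
  theorem available.\<close>

lemma (in fin_group) card_fixed_cong:
  assumes P: "subgroup P G" "card P = p ^ k" "Factorial_Ring.prime p"
    and E: "finite E"
    and f: "\<And>g x. g \<in> P \<Longrightarrow> x \<in> E \<Longrightarrow> f g x \<in> E"
      "\<And>x. x \<in> E \<Longrightarrow> f \<one> x = x"
      "\<And>g h x. g \<in> P \<Longrightarrow> h \<in> P \<Longrightarrow> x \<in> E \<Longrightarrow> f (g \<otimes> h) x = f g (f h x)"
  shows "card E mod p = card {x \<in> E. \<forall>g \<in> P. f g x = x} mod p"
proof -
  let ?P = "G\<lparr>carrier := P\<rparr>"
  let ?\<phi> = "\<lambda>g. restrict (f g) E"
  interpret P: group ?P using P subgroup_imp_group by blast
  have bij: "?\<phi> g \<in> Bij E" if g: "g \<in> P" for g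
  proof -
    have i: "inv g \<in> P" "g \<in> carrier G"
      using g P(1) by (auto simp: subgroup.m_inv_closed subgroup_mem)
    have "bij_betw (f g) E E"
      by (rule bij_betw_byWitness[where f' = "f (inv g)"])
         (use i g f f(3)[OF i(1) g] f(3)[OF g i(1)] in auto)
    then show ?thesis by (simp add: Bij_def)
  qed
  have "group_hom ?P (BijGroup E) ?\<phi>"
  proof (intro group_hom.intro group_hom_axioms.intro homI)
    show "group (BijGroup E)" by (rule group_BijGroup)
    show "\<And>x. x \<in> carrier ?P \<Longrightarrow> ?\<phi> x \<in> carrier (BijGroup E)"
      using bij by (simp add: BijGroup_def)
    fix x y assume "x \<in> carrier ?P" "y \<in> carrier ?P"
    then show "?\<phi> (x \<otimes>\<^bsub>?P\<^esub> y) = ?\<phi> x \<otimes>\<^bsub>BijGroup E\<^esub> ?\<phi> y"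
      using bij f by (auto simp: BijGroup_def compose_def fun_eq_iff)
  qed (rule P.is_group)
  then interpret A: group_action ?P E ?\<phi> by (rule group_action.intro)
  let ?O = "orbits ?P E ?\<phi>"
  have finO: "finite ?O" using A.orbits_coverture E by (metis finite_UnionD)
  have orb: "orbit ?P ?\<phi> x = {f g x | g. g \<in> P}" if "x \<in> E" for x
    using that by (auto simp: orbit_def)
  have dvd: "card R dvd p ^ k" if R: "R \<in> ?O" for R
  proof -
    obtain x where x: "x \<in> E" "R = orbit ?P ?\<phi> x" using R by (auto simp: orbits_def)
    have "card R * card (stabilizer ?P ?\<phi> x) = p ^ k"
      using A.orbit_stabilizer_theorem[OF x(1)] x P(2) by (simp add: order_def)
    then show ?thesis by (metis dvd_triv_left)
  qed
  have R1: "card R mod p = (if card R = 1 then 1 else 0)" if R: "R \<in> ?O" for R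
  proof -
    obtain i where i: "card R = p ^ i" using dvd[OF R] divides_primepow_nat[OF P(3)] by auto
    show ?thesis using i P(3) prime_gt_1_nat by (cases i) auto
  qed
  let ?F = "{x \<in> E. \<forall>g \<in> P. f g x = x}"
  have fix1: "{x} \<in> ?O" if "x \<in> ?F" for x
  proof -
    have "orbit ?P ?\<phi> x = {x}" using that orb subgroup.one_closed[OF P(1)] by force
    then show ?thesis using that unfolding orbits_def by blast
  qed
  have fix2: "\<exists>x \<in> ?F. R = {x}" if R: "R \<in> ?O" "card R = 1" for R
  proof -
    obtain x where x: "x \<in> E" "R = orbit ?P ?\<phi> x" using R by (auto simp: orbits_def)
    have "x \<in> R" using x orb f(2) subgroup.one_closed[OF P(1)] by force
    then have Rx: "R = {x}" using R(2) by (metis card_1_singletonE singletonD)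
    have "f g x \<in> R" if "g \<in> P" for g using that x orb by auto
    then show ?thesis using Rx x(1) by auto
  qed
  have "card E = (\<Sum>R \<in> ?O. card R)"
    using A.disjoint_sum[OF E, of "\<lambda>_. 1::nat"] by simp
  then have "card E mod p = (\<Sum>R \<in> ?O. card R mod p) mod p" by (simp add: mod_sum_eq)
  also have "(\<Sum>R \<in> ?O. card R mod p) = (\<Sum>R \<in> ?O. if card R = 1 then 1 else 0)"
    using R1 by (rule sum.cong[OF refl])
  also have "\<dots> = card {R \<in> ?O. card R = 1}"
    using finO by (simp add: sum.If_cases Int_def)
  also have "{R \<in> ?O. card R = 1} = (\<lambda>x. {x}) ` ?F"
    using fix1 fix2 by auto
  also have "card \<dots> = card ?F" by (simp add: card_image)
  finally show ?thesis .
qed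

section \<open>Sylow subgroups\<close>

definition p_group_on :: "('a, 'b) monoid_scheme \<Rightarrow> nat \<Rightarrow> 'a set \<Rightarrow> bool" where
  "p_group_on G p P \<longleftrightarrow> subgroup P G \<and> (\<exists>k. card P = p ^ k)"

text \<open>The group whose Sylow subgroup is meant is the argument \<open>S\<close>. All subgroups
  stay inside the one ambient \<open>G\<close>, so Sylow subgroups of different subgroups can be
  compared without changing the carrier.\<close>

definition sylow_of :: "('a, 'b) monoid_scheme \<Rightarrow> nat \<Rightarrow> 'a set \<Rightarrow> 'a set \<Rightarrow> bool" where
  "sylow_of G p P S \<longleftrightarrow> p_group_on G p P \<and> P \<subseteq> S \<and> \<not> p dvd card S div card P"

text \<open>Two functions with the same fibres have images of the same size. This identifies the
  number of conjugates of a subgroup with the index of its normalizer.\<close>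

lemma card_image_cong:
  assumes "\<And>x y. x \<in> W \<Longrightarrow> y \<in> W \<Longrightarrow> f x = f y \<longleftrightarrow> g x = g y"
  shows "card (f ` W) = card (g ` W)"
proof (rule bij_betw_same_card[of "\<lambda>z. g (inv_into W f z)"], rule bij_betw_imageI)
  show "inj_on (\<lambda>z. g (inv_into W f z)) (f ` W)"
    by (rule inj_onI) (metis assms f_inv_into_f inv_into_into)
  show "(\<lambda>z. g (inv_into W f z)) ` f ` W = g ` W"
  proof -
    have "g (inv_into W f (f x)) = g x" if "x \<in> W" for x
      by (metis assms f_inv_into_f imageI inv_into_into that)
    then show ?thesis by (auto simp: image_image)
  qed
qed

context fin_group
begin

lemma l_coset_eq_iff:
  assumes "subgroup H G" "x \<in> carrier G" "y \<in> carrier G"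
  shows "x <# H = y <# H \<longleftrightarrow> inv x \<otimes> y \<in> H"
proof
  assume "x <# H = y <# H"
  then have "y \<in> x <# H" using assms by (simp add: lcos_self)
  then show "inv x \<otimes> y \<in> H" using assms by (auto simp: l_coset_def subgroup_mem)
next
  assume a: "inv x \<otimes> y \<in> H"
  have "y = x \<otimes> (inv x \<otimes> y)" using assms by simp
  then have "y \<in> x <# H" using a by (auto simp: l_coset_def)
  then show "x <# H = y <# H" using assms l_repr_independence by blast
qed

lemma card_l_cosets:
  assumes "subgroup H G" "subgroup S G" "H \<subseteq> S"
  shows "card ((\<lambda>s. s <# H) ` S) * card H = card S"
proof -
  interpret S: group "G\<lparr>carrier := S\<rparr>" using assms subgroup_imp_group by blast
  have "card (lcosets\<^bsub>G\<lparr>carrier := S\<rparr>\<^esub> H) * card H = order (G\<lparr>carrier := S\<rparr>)"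
    using S.l_lagrange subgroup_transfer[OF assms] finite_subgroup[OF assms(2)] by simp
  moreover have "lcosets\<^bsub>G\<lparr>carrier := S\<rparr>\<^esub> H = (\<lambda>s. s <# H) ` S"
    by (auto simp: LCOSETS_def l_coset_def)
  ultimately show ?thesis by (simp add: order_def)
qed

lemma sylow_exists:
  assumes S: "subgroup S G" and p: "Factorial_Ring.prime p"
  shows "\<exists>P. sylow_of G p P S"
proof -
  have pos: "card S \<noteq> 0" using card_sub_pos[OF S] by simp
  have np: "\<not> is_unit p" using p by auto
  obtain m where m: "card S = p ^ multiplicity p (card S) * m" "\<not> p dvd m"
    using multiplicity_decompose'[OF pos np] by blast
  interpret S: group "G\<lparr>carrier := S\<rparr>" using S subgroup_imp_group by blast
  obtain P where P: "subgroup P (G\<lparr>carrier := S\<rparr>)" "card P = p ^ multiplicity p (card S)"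
    using sylow_thm[OF p S.is_group, of "multiplicity p (card S)" m] m finite_subgroup[OF S]
    by (auto simp: order_def)
  have "subgroup P G" using incl_subgroup[OF S P(1)] .
  moreover have "P \<subseteq> S" using P(1) subgroup.subset by force
  moreover have "card S div card P = m" using m P(2) card_sub_pos[OF \<open>subgroup P G\<close>]
    by (metis nonzero_mult_div_cancel_left less_numeral_extra(3))
  ultimately show ?thesis using P(2) m(2) unfolding sylow_of_def p_group_on_def by auto
qed

text \<open>The number of fixed points of \<open>P\<close> on \<open>N\<close> is divisible by p,
  and \<one> is one of them, so there is another. With \<open>N = P\<close> this says that a
  nontrivial p-group has a nontrivial centre.\<close>

lemma p_group_fixed_point:
  assumes P: "p_group_on G p P" and N: "p_group_on G p N" "N \<noteq> {\<one>}" and p: "Factorial_Ring.prime p"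
    and n: "P \<subseteq> normalizer_of G N"
  shows "\<exists>z \<in> N. z \<noteq> \<one> \<and> (\<forall>g \<in> P. g \<otimes> z = z \<otimes> g)"
proof -
  have sub: "subgroup P G" "subgroup N G" using P N by (auto simp: p_group_on_def)
  note c = subgroup_mem[OF sub(1)] subgroup_mem[OF sub(2)]
  obtain k where k: "card P = p ^ k" using P by (auto simp: p_group_on_def)
  obtain j where j: "card N = p ^ j" using N by (auto simp: p_group_on_def)
  let ?F = "{x \<in> N. \<forall>g \<in> P. conj_by G g x = x}"
  have "card N mod p = card ?F mod p"
    by (rule card_fixed_cong[OF sub(1) k p finite_subgroup[OF sub(2)]])
       (use n c in \<open>auto simp: conj_by_conj_by intro: normalizerD\<close>)
  moreover have "j \<noteq> 0"
  proof
    assume "j = 0"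
    then have "card N = 1" using j by simp
    then show False using N(2) subgroup.one_closed[OF sub(2)] by (metis card_1_singletonE singletonD)
  qed
  ultimately have "card ?F mod p = 0" using j by (metis dvd_power mod_0_imp_dvd dvd_imp_mod_0 not_gr_zero)
  then have "card ?F \<noteq> 1" using p by (metis mod_less one_neq_zero prime_gt_1_nat)
  have "\<one> \<in> ?F" using sub c subgroup.one_closed by auto
  have "\<not> ?F \<subseteq> {\<one>}"
  proof
    assume "?F \<subseteq> {\<one>}"
    then have "?F = {\<one>}" using \<open>\<one> \<in> ?F\<close> by blast
    then show False using \<open>card ?F \<noteq> 1\<close> by simp
  qed
  then obtain z where "z \<in> ?F" "z \<noteq> \<one>" by blast
  then show ?thesis using c by (auto simp: conj_by_eq_iff)
qed

text \<open>\<open>Q\<close> acts by left multiplication on the cosets of \<open>P\<close> in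
  \<open>S\<close>, whose number is prime to p. It therefore fixes a coset sP, which means that
  \<open>Q\<close> lies in the conjugate of \<open>P\<close> by s.\<close>

lemma sylow_contains_conj:
  assumes P: "sylow_of G p P S" and Q: "p_group_on G p Q" "Q \<subseteq> S" and S: "subgroup S G"
    and p: "Factorial_Ring.prime p"
  shows "\<exists>s \<in> S. Q \<subseteq> conj_by G s ` P"
proof -
  have sub: "subgroup P G" "subgroup Q G" "P \<subseteq> S"
    using P Q by (auto simp: p_group_on_def sylow_of_def)
  note c = subgroup_mem[OF sub(1)] subgroup_mem[OF sub(2)] subgroup_mem[OF S]
  obtain k where k: "card Q = p ^ k" using Q by (auto simp: p_group_on_def)
  let ?E = "(\<lambda>s. s <# P) ` S"
  let ?F = "{W \<in> ?E. \<forall>g \<in> Q. g <# W = W}"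
  have "card ?E mod p = card ?F mod p"
  proof (rule card_fixed_cong[OF sub(2) k p])
    show "finite ?E" using finite_subgroup[OF S] by simp
    fix g x assume g: "g \<in> Q" and "x \<in> ?E"
    then obtain s where s: "s \<in> S" "x = s <# P" by auto
    have "g <# x = (g \<otimes> s) <# P" using s g c subgroup.subset[OF sub(1)] by (simp add: lcos_m_assoc)
    then show "g <# x \<in> ?E" using s g Q(2) subgroup.m_closed[OF S] by auto
  next
    fix x assume "x \<in> ?E"
    then show "\<one> <# x = x"
      using c subgroup.subset[OF sub(1)] by (auto simp: lcos_mult_one l_coset_subset_G)
  next
    fix g h x assume "g \<in> Q" "h \<in> Q" "x \<in> ?E"
    then show "(g \<otimes> h) <# x = g <# (h <# x)"
      using c subgroup.subset[OF sub(1)] by (auto simp: lcos_m_assoc[of _ g h] l_coset_subset_G)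
  qed
  moreover have "card ?E = card S div card P"
    using card_l_cosets[OF sub(1) S sub(3)] card_sub_pos[OF sub(1)]
      by (metis nonzero_mult_div_cancel_right less_numeral_extra(3))
  ultimately have "card ?F mod p \<noteq> 0" using P unfolding sylow_of_def by (metis dvd_eq_mod_eq_0)
  then have "?F \<noteq> {}" by (metis card.empty mod_0)
  then obtain s where s: "s \<in> S" "\<And>g. g \<in> Q \<Longrightarrow> g <# (s <# P) = s <# P" by auto
  have "Q \<subseteq> conj_by G s ` P"
  proof
    fix g assume g: "g \<in> Q"
    have "(g \<otimes> s) <# P = s <# P"
      using s(2)[OF g] g s(1) c subgroup.subset[OF sub(1)] by (simp add: lcos_m_assoc)
    then have "inv s \<otimes> (g \<otimes> s) \<in> P"
      using l_coset_eq_iff[OF sub(1), of s "g \<otimes> s"] g s(1) c by simp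
    moreover have "g = conj_by G s (inv s \<otimes> (g \<otimes> s))"
      using g s(1) c by (simp add: conj_by_def m_assoc)
    ultimately show "g \<in> conj_by G s ` P" by blast
  qed
  then show ?thesis using s(1) by blast
qed

lemma sylow_conj_by:
  assumes "sylow_of G p P S" "S \<subseteq> carrier G" "g \<in> normalizer_of G S"
  shows "sylow_of G p (conj_by G g ` P) S"
proof -
  have g: "g \<in> carrier G" using assms normalizer_carrier by blast
  have P: "subgroup P G" "P \<subseteq> S" using assms by (auto simp: sylow_of_def p_group_on_def)
  show ?thesis using assms normalizerD[OF assms(3)] P g
    unfolding sylow_of_def p_group_on_def
    by (auto simp: conj_by_img_subgroup card_conj_by_img subgroup.subset)
qed

lemma sylow_conj:
  assumes P: "sylow_of G p P S" and Q: "sylow_of G p Q S" and S: "subgroup S G"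
    and p: "Factorial_Ring.prime p"
  shows "\<exists>s \<in> S. Q = conj_by G s ` P"
proof -
  obtain s where s: "s \<in> S" "Q \<subseteq> conj_by G s ` P"
    using sylow_contains_conj[OF P _ _ S p, of Q] Q unfolding sylow_of_def by blast
  obtain t where t: "t \<in> S" "P \<subseteq> conj_by G t ` Q"
    using sylow_contains_conj[OF Q _ _ S p, of P] P unfolding sylow_of_def by blast
  have sub: "subgroup P G" "subgroup Q G" using P Q by (auto simp: p_group_on_def sylow_of_def)
  have "card P \<le> card Q"
    using t sub card_mono[OF _ t(2)] finite_subgroup card_conj_by_img[of Q t] subgroup_mem[OF S]
      by (simp add: subgroup.subset)
  then have "card (conj_by G s ` P) \<le> card Q"
    using s subgroup_mem[OF S] sub by (simp add: card_conj_by_img subgroup.subset)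
  then have "Q = conj_by G s ` P" using s(2) finite_subgroup[OF sub(1)] by (meson card_seteq finite_imageI)
  then show ?thesis using s by blast
qed

lemma sylow_contains:
  assumes Q: "p_group_on G p Q" "Q \<subseteq> S" and S: "subgroup S G" and p: "Factorial_Ring.prime p"
  shows "\<exists>P. sylow_of G p P S \<and> Q \<subseteq> P"
proof -
  obtain P where P: "sylow_of G p P S" using sylow_exists[OF S p] by blast
  obtain s where s: "s \<in> S" "Q \<subseteq> conj_by G s ` P" using sylow_contains_conj[OF P Q S p] by blast
  have "sylow_of G p (conj_by G s ` P) S"
    using sylow_conj_by[OF P] S s(1) sub_in_normalizer subgroup.subset by blast
  then show ?thesis using s(2) by blast
qed

lemma sylow_nontriv:
  assumes "sylow_of G p P S" "p dvd card S"
  shows "P \<noteq> {\<one>}"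
  using assms by (auto simp: sylow_of_def)

lemma sylow_card_multiplicity:
  assumes P: "sylow_of G p P S" and S: "subgroup S G" and p: "Factorial_Ring.prime p"
  shows "card P = p ^ multiplicity p (card S)"
proof -
  have sub: "subgroup P G" "P \<subseteq> S" using P by (auto simp: p_group_on_def sylow_of_def)
  obtain k where k: "card P = p ^ k" using P by (auto simp: sylow_of_def p_group_on_def)
  have "card S = p ^ k * (card S div card P)" using card_dvd[OF sub(1) S sub(2)] k by simp
  moreover have "\<not> p dvd card S div card P" using P by (simp add: sylow_of_def)
  ultimately have "multiplicity p (card S) = k" using p by (intro multiplicity_decomposeI) auto
  then show ?thesis using k by simp
qed

text \<open>For each prime r the full r-part of the order of \<open>W\<close> divides the order of
  \<open>Y\<close>. Statements about all of \<open>W\<close> can thus be checked on one Sylow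
  subgroup per prime.\<close>

lemma subgroup_eq_if_sylows:
  assumes W: "subgroup W G" and Y: "subgroup Y G" "Y \<subseteq> W"
    and s: "\<And>r. Factorial_Ring.prime r \<Longrightarrow> r dvd card W \<Longrightarrow> \<exists>R. sylow_of G r R W \<and> R \<subseteq> Y"
  shows "Y = W"
proof (rule subgroup_eqI[OF Y(1) W Y(2)])
  show "card W dvd card Y"
  proof (rule multiplicity_le_imp_dvd)
    show "card W \<noteq> 0" using card_sub_pos[OF W] by simp
    fix r :: nat assume r: "Factorial_Ring.prime r"
    show "multiplicity r (card W) \<le> multiplicity r (card Y)"
    proof (cases "r dvd card W")
      case True
      then obtain R where R: "sylow_of G r R W" "R \<subseteq> Y" using s[OF r] by blast
      then have "r ^ multiplicity r (card W) dvd card Y"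
        using sylow_card_multiplicity[OF R(1) W r] card_dvd[of R Y] Y
          by (simp add: sylow_of_def p_group_on_def)
      then show ?thesis using r card_sub_pos[OF Y(1)] by (metis multiplicity_geI neq0_conv not_prime_unit)
    qed (simp add: not_dvd_imp_multiplicity_0)
  qed
qed

text \<open>\<open>P\<close> permutes the conjugates of \<open>Q\<close> in \<open>W\<close>. Their
  number is the index of the normalizer of \<open>Q\<close> in \<open>W\<close>; as p does not
  divide it, some conjugate is fixed. The assumption concerns this index and not the order of
  \<open>W\<close>, so that it also covers a case where p may divide that order.\<close>

lemma invariant_sylow:
  assumes P: "p_group_on G p P" "P \<subseteq> normalizer_of G W" and W: "subgroup W G"
    and p: "Factorial_Ring.prime p" and q: "Factorial_Ring.prime q"
    and Q: "sylow_of G q Q W" and ind: "\<not> p dvd card W div card (W \<inter> normalizer_of G Q)"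
  shows "\<exists>Q'. sylow_of G q Q' W \<and> P \<subseteq> normalizer_of G Q'"
proof -
  let ?E = "(\<lambda>x. conj_by G x ` Q) ` W"
  let ?N = "W \<inter> normalizer_of G Q"
  have Qs: "subgroup Q G" "Q \<subseteq> W" using Q by (auto simp: sylow_of_def p_group_on_def)
  have Ps: "subgroup P G" using P by (auto simp: p_group_on_def)
  obtain k where k: "card P = p ^ k" using P by (auto simp: p_group_on_def)
  note c = subgroup_mem[OF W] subgroup_mem[OF Qs(1)] subgroup_mem[OF Ps]
  have N: "subgroup ?N G" using W normalizer_subgroup Qs(1) subgroup.subset subgroups_Inter_pair by blast
  have sylE: "sylow_of G q Y W" if Y: "Y \<in> ?E" for Y
  proof -
    obtain x where x: "x \<in> W" "Y = conj_by G x ` Q" using Y by blast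
    have "x \<in> normalizer_of G W" using x(1) sub_in_normalizer[OF W] by blast
    then show ?thesis using sylow_conj_by[OF Q subgroup.subset[OF W]] x(2) by blast
  qed
  \<comment> \<open>Conjugates of \<open>Q\<close> by \<open>x\<close> and \<open>y\<close> agree
    exactly when \<open>x\<close> and \<open>y\<close> lie in the same left coset of
    \<open>?N\<close>.\<close>
  have "card ?E = card ((\<lambda>x. x <# ?N) ` W)"
  proof (rule card_image_cong)
    fix x y assume xy: "x \<in> W" "y \<in> W"
    have "conj_by G x ` Q = conj_by G y ` Q \<longleftrightarrow> inv x \<otimes> y \<in> normalizer_of G Q"
    proof
      assume e: "conj_by G x ` Q = conj_by G y ` Q"
      show "inv x \<otimes> y \<in> normalizer_of G Q"
      proof (rule normalizerI)
        fix s assume s: "s \<in> Q"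
        then obtain t where t: "t \<in> Q" "conj_by G y s = conj_by G x t" using e by blast
        have "conj_by G (inv x \<otimes> y) s = t" using s t xy c by (simp add: conj_by_conj_by[symmetric])
        then show "conj_by G (inv x \<otimes> y) s \<in> Q" using t by simp
      qed (use xy c in simp)
    next
      assume e: "inv x \<otimes> y \<in> normalizer_of G Q"
      have "conj_by G y ` Q = conj_by G x ` conj_by G (inv x \<otimes> y) ` Q"
        using xy c by (auto simp: image_image conj_by_conj_by intro!: image_cong)
      then show "conj_by G x ` Q = conj_by G y ` Q"
        using normalizer_img[OF subgroup.subset[OF Qs(1)] e] by simp
    qed
    moreover have "inv x \<otimes> y \<in> W" using xy W subgroup.m_closed subgroup.m_inv_closed by metis
    ultimately show "conj_by G x ` Q = conj_by G y ` Q \<longleftrightarrow> x <# ?N = y <# ?N"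
      using l_coset_eq_iff[OF N, of x y] xy c by auto
  qed
  then have "card ?E * card ?N = card W" using card_l_cosets[OF N W] by simp
  then have ndvd: "\<not> p dvd card ?E" using ind card_sub_pos[OF N]
    by (metis nonzero_mult_div_cancel_right less_numeral_extra(3))
  let ?F = "{Y \<in> ?E. \<forall>g \<in> P. conj_by G g ` Y = Y}"
  have "card ?E mod p = card ?F mod p"
  proof (rule card_fixed_cong[OF Ps k p])
    show "finite ?E" using finite_subgroup[OF W] by simp
    fix g Y assume g: "g \<in> P" and Y: "Y \<in> ?E"
    have "sylow_of G q (conj_by G g ` Y) W"
      using sylow_conj_by[OF sylE[OF Y] subgroup.subset[OF W]] g P(2) by blast
    then show "conj_by G g ` Y \<in> ?E" using sylow_conj[OF Q _ W q] by blast
  next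
    fix Y assume Y: "Y \<in> ?E"
    then have "Y \<subseteq> W" using sylE by (simp add: sylow_of_def)
    then show "conj_by G \<one> ` Y = Y" using c by (force simp: image_iff)
  next
    fix g h Y assume gh: "g \<in> P" "h \<in> P" and Y: "Y \<in> ?E"
    have "Y \<subseteq> W" using sylE Y by (simp add: sylow_of_def)
    then show "conj_by G (g \<otimes> h) ` Y = conj_by G g ` conj_by G h ` Y"
      using c gh by (auto simp: image_image conj_by_conj_by subset_iff intro!: image_cong)
  qed
  then have "?F \<noteq> {}" using ndvd by (metis card.empty dvd_eq_mod_eq_0 mod_0)
  then obtain Y where "Y \<in> ?F" by (meson ex_in_conv)
  then have Y: "Y \<in> ?E" "\<And>g. g \<in> P \<Longrightarrow> conj_by G g ` Y = Y" by simp_all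
  have "P \<subseteq> normalizer_of G Y" using Y(2) c by (auto intro!: normalizerI)
  then show ?thesis using sylE[OF Y(1)] by blast
qed

end

section \<open>Perfect and solvable subgroups\<close>

definition perfect_on :: "('a, 'b) monoid_scheme \<Rightarrow> 'a set \<Rightarrow> bool" where
  "perfect_on G W \<longleftrightarrow> subgroup W G \<and> derived G W = W"

definition solvable_on :: "('a, 'b) monoid_scheme \<Rightarrow> 'a set \<Rightarrow> bool" where
  "solvable_on G S \<longleftrightarrow> (\<exists>n. (derived G ^^ n) S = {\<one>\<^bsub>G\<^esub>})"

definition commutator :: "('a, 'b) monoid_scheme \<Rightarrow> 'a \<Rightarrow> 'a \<Rightarrow> 'a" where
  "commutator G x y = x \<otimes>\<^bsub>G\<^esub> y \<otimes>\<^bsub>G\<^esub> inv\<^bsub>G\<^esub> x \<otimes>\<^bsub>G\<^esub> inv\<^bsub>G\<^esub> y"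

section \<open>Commutator identities and derived subgroups\<close>

context group
begin

lemma commutator_closed [simp]: "x \<in> carrier G \<Longrightarrow> y \<in> carrier G \<Longrightarrow> commutator G x y \<in> carrier G"
  by (simp add: commutator_def)

lemma commutator_sub: "subgroup H G \<Longrightarrow> x \<in> H \<Longrightarrow> y \<in> H \<Longrightarrow> commutator G x y \<in> H"
  by (simp add: commutator_def subgroup.m_closed subgroup.m_inv_closed)

lemma commutator_eq_one_iff: "x \<in> carrier G \<Longrightarrow> y \<in> carrier G \<Longrightarrow> commutator G x y = \<one> \<longleftrightarrow> x \<otimes> y = y \<otimes> x"
proof -
  assume xy: "x \<in> carrier G" "y \<in> carrier G"
  have "commutator G x y = x \<otimes> y \<otimes> inv (y \<otimes> x)"
    using xy by (simp add: commutator_def inv_mult_group m_assoc)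
  then show ?thesis using xy inv_solve_right'[of \<one> "x \<otimes> y" "y \<otimes> x"] by simp
qed

lemma inv_commutator: "x \<in> carrier G \<Longrightarrow> y \<in> carrier G \<Longrightarrow> inv (commutator G x y) = commutator G y x"
  by (simp add: commutator_def inv_mult_group m_assoc)

lemma conj_by_commutator: "g \<in> carrier G \<Longrightarrow> x \<in> carrier G \<Longrightarrow> y \<in> carrier G \<Longrightarrow>
  conj_by G g (commutator G x y) = commutator G (conj_by G g x) (conj_by G g y)"
  by (simp add: commutator_def conj_by_mult conj_by_inv)

lemma commutator_mult_left: "x \<in> carrier G \<Longrightarrow> y \<in> carrier G \<Longrightarrow> z \<in> carrier G \<Longrightarrow>
  commutator G (x \<otimes> y) z = conj_by G x (commutator G y z) \<otimes> commutator G x z"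
  by (simp add: commutator_def conj_by_def m_assoc inv_mult_group)

lemma commutator_mult_right: "x \<in> carrier G \<Longrightarrow> y \<in> carrier G \<Longrightarrow> z \<in> carrier G \<Longrightarrow>
  commutator G x (y \<otimes> z) = commutator G x y \<otimes> conj_by G y (commutator G x z)"
  by (simp add: commutator_def conj_by_def m_assoc inv_mult_group)

lemma commutator_conj_by: "x \<in> carrier G \<Longrightarrow> y \<in> carrier G \<Longrightarrow> commutator G x y = x \<otimes> conj_by G y (inv x)"
  by (simp add: commutator_def conj_by_def m_assoc)

lemma commutator_conj_by': "x \<in> carrier G \<Longrightarrow> y \<in> carrier G \<Longrightarrow> commutator G x y = conj_by G x y \<otimes> inv y"
  by (simp add: commutator_def conj_by_def m_assoc)

lemma commutator_in_derived: "x \<in> W \<Longrightarrow> y \<in> W \<Longrightarrow> commutator G x y \<in> derived G W"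
  unfolding derived_def commutator_def by (rule generate.incl) blast

lemma derived_le:
  assumes "subgroup R G" "\<And>x y. x \<in> W \<Longrightarrow> y \<in> W \<Longrightarrow> commutator G x y \<in> R"
  shows "derived G W \<subseteq> R"
  unfolding derived_def
  by (rule generate_subgroup_incl[OF _ assms(1)]) (use assms(2) in \<open>auto simp: commutator_def\<close>)

end

section \<open>The derived series and perfect subgroups\<close>

context fin_group
begin

lemma perfect_le:
  assumes "perfect_on G W" "subgroup R G" "\<And>x y. x \<in> W \<Longrightarrow> y \<in> W \<Longrightarrow> commutator G x y \<in> R"
  shows "W \<subseteq> R"
proof -
  have "derived G W \<subseteq> R" using assms(2,3) by (rule derived_le)
  then show ?thesis using assms(1) by (simp add: perfect_on_def)
qed

lemma derived_sub: "subgroup S G \<Longrightarrow> derived G S \<subseteq> S"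
  using derived_le commutator_sub by blast

lemma normalizer_derived:
  assumes S: "subgroup S G" and g: "g \<in> normalizer_of G S"
  shows "g \<in> normalizer_of G (derived G S)"
proof -
  note c = subgroup_mem[OF S] normalizer_carrier[OF g]
  have d: "subgroup (derived G S) G" using S derived_is_subgroup subgroup.subset by blast
  note dc = subgroup_mem[OF d]
  have "subgroup {x \<in> carrier G. conj_by G g x \<in> derived G S} G"
    using c(2) by (intro finite_subgroupI) (auto simp: conj_by_mult subgroup.m_closed[OF d] subgroup.one_closed[OF d])
  then have "derived G S \<subseteq> {x \<in> carrier G. conj_by G g x \<in> derived G S}"
    by (rule derived_le) (use c normalizerD[OF g] in \<open>auto simp: conj_by_commutator intro: commutator_in_derived\<close>)
  then show ?thesis using c by (auto intro: normalizerI)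
qed

lemma exp_derived_props:
  assumes S: "subgroup S G"
  shows "subgroup ((derived G ^^ n) S) G \<and> (derived G ^^ n) S \<subseteq> S \<and> normalizer_of G S \<subseteq> normalizer_of G ((derived G ^^ n) S)"
proof (induction n)
  case (Suc n)
  let ?T = "(derived G ^^ n) S"
  have T: "subgroup ?T G" "?T \<subseteq> S" "normalizer_of G S \<subseteq> normalizer_of G ?T"
    using Suc by auto
  have "subgroup (derived G ?T) G" using T(1) derived_is_subgroup subgroup.subset by blast
  then show ?case using T derived_sub[OF T(1)] normalizer_derived[OF T(1)] by auto
qed (use S in auto)

text \<open>The derived series of a finite group becomes stationary, and the stationary term is
  perfect. It is also invariant under the normalizer of \<open>S\<close>, by
  \<open>exp_derived_props\<close>.\<close>

lemma perfect_core:
  assumes S: "subgroup S G"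
  shows "\<exists>n. perfect_on G ((derived G ^^ n) S)"
  using S
proof (induction "card S" arbitrary: S rule: less_induct)
  case (less S)
  show ?case
  proof (cases "derived G S = S")
    case True
    then show ?thesis using less.prems by (intro exI[of _ 0]) (simp add: perfect_on_def)
  next
    case False
    have d: "subgroup (derived G S) G" using less.prems derived_is_subgroup subgroup.subset by blast
    have "card (derived G S) < card S"
      using False derived_sub[OF less.prems] finite_subgroup[OF less.prems]
        by (meson psubsetI psubset_card_mono)
    then obtain n where "perfect_on G ((derived G ^^ n) (derived G S))" using less.hyps d by blast
    then show ?thesis by (intro exI[of _ "Suc n"]) (simp add: funpow_swap1)
  qed
qed

lemma solvable_onI:
  assumes S: "subgroup S G" and "\<And>W. perfect_on G W \<Longrightarrow> W \<subseteq> S \<Longrightarrow> W = {\<one>}"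
  shows "solvable_on G S"
  using perfect_core[OF S] exp_derived_props[OF S] assms(2) unfolding solvable_on_def by blast

text \<open>Arithmetic modulo \<open>E\<close> without forming a quotient: \<open>S\<close>
  normalizes \<open>E\<close>, but \<open>E\<close> may lie outside \<open>S\<close>.\<close>

lemma l_coset_mult_mem:
  assumes "subgroup S G" "subgroup E G" "S \<subseteq> normalizer_of G E" "s \<in> S" "t \<in> S" "x \<in> s <# E" "y \<in> t <# E"
  shows "x \<otimes> y \<in> (s \<otimes> t) <# E"
proof -
  obtain e f where e: "e \<in> E" "x = s \<otimes> e" "f \<in> E" "y = t \<otimes> f"
    using assms by (auto simp: l_coset_def)
  note c = subgroup_mem[OF assms(1)] subgroup_mem[OF assms(2)]
  have "x \<otimes> y = (s \<otimes> t) \<otimes> (conj_by G (inv t) e \<otimes> f)"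
    using e assms c by (simp add: conj_by_def m_assoc)
  moreover have "conj_by G (inv t) e \<in> E" using assms e by (meson normalizerD' subgroup.subset subsetD)
  ultimately show ?thesis using e subgroup.m_closed[OF assms(2)] by (auto simp: l_coset_def)
qed

lemma l_coset_inv_mem:
  assumes "subgroup S G" "subgroup E G" "S \<subseteq> normalizer_of G E" "s \<in> S" "x \<in> s <# E"
  shows "inv x \<in> inv s <# E"
proof -
  obtain e where e: "e \<in> E" "x = s \<otimes> e" using assms by (auto simp: l_coset_def)
  note c = subgroup_mem[OF assms(1)] subgroup_mem[OF assms(2)]
  have "inv x = inv s \<otimes> conj_by G s (inv e)"
    using e assms c by (simp add: conj_by_def m_assoc inv_mult_group)
  moreover have "conj_by G s (inv e) \<in> E"
    using assms e normalizerD subgroup.m_inv_closed by (metis subsetD)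
  ultimately show ?thesis by (auto simp: l_coset_def)
qed

text \<open>SE/E is a quotient of the solvable group \<open>S\<close>, so a perfect subgroup must
  vanish in it. The induction descends the derived series: commutators of elements of SE lie in S'E,
  so a perfect \<open>W\<close> inside SE already lies in S'E.\<close>

lemma perfect_in_solvable_ext:
  assumes W: "perfect_on G W" and S: "subgroup S G" and E: "subgroup E G" "S \<subseteq> normalizer_of G E"
    and WS: "W \<subseteq> S <#> E" and sol: "solvable_on G S"
  shows "W \<subseteq> E"
proof -
  obtain n where "(derived G ^^ n) S = {\<one>}" using sol by (auto simp: solvable_on_def)
  then show ?thesis using S E(2) WS
  proof (induction n arbitrary: S)
    case 0
    then have "S = {\<one>}" by simp
    then show ?case using 0(4) subgroup_mem[OF E(1)] by (auto simp: set_mult_def)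
  next
    case (Suc n)
    let ?T = "derived G S"
    have T: "subgroup ?T G" using Suc.prems(2) derived_is_subgroup subgroup.subset by blast
    have TS: "?T \<subseteq> S" using derived_sub Suc.prems(2) by blast
    have TE: "subgroup (?T <#> E) G" using set_mult_subgroup[OF T E(1)] TS Suc.prems(3) by blast
    have "W \<subseteq> ?T <#> E"
    proof (rule perfect_le[OF W TE])
      fix x y assume xy: "x \<in> W" "y \<in> W"
      have *: "\<exists>s \<in> S. z \<in> s <# E" if "z \<in> W" for z
        using subsetD[OF Suc.prems(4) that] by (auto simp: set_mult_def l_coset_def)
      obtain s t where s: "s \<in> S" "x \<in> s <# E" "t \<in> S" "y \<in> t <# E"
        using *[OF xy(1)] *[OF xy(2)] by blast
      have i: "inv s \<in> S" "inv t \<in> S" using s Suc.prems(2) subgroup.m_inv_closed by metis+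
      note l = l_coset_mult_mem[OF Suc.prems(2) E(1) Suc.prems(3)]
      note li = l_coset_inv_mem[OF Suc.prems(2) E(1) Suc.prems(3)]
      have st: "s \<otimes> t \<in> S" "s \<otimes> t \<otimes> inv s \<in> S"
        using s i Suc.prems(2) subgroup.m_closed by metis+
      have "commutator G x y \<in> commutator G s t <# E" unfolding commutator_def
        using l[OF st(2) i(2) l[OF st(1) i(1) l[OF s(1,3,2,4)] li[OF s(1,2)]] li[OF s(3,4)]] .
      moreover have "commutator G s t \<in> ?T" using s commutator_in_derived by blast
      ultimately show "commutator G x y \<in> ?T <#> E" by (auto simp: l_coset_def set_mult_def)
    qed
    moreover have "(derived G ^^ n) ?T = {\<one>}" using Suc.prems(1) by (simp add: funpow_swap1)
    ultimately show ?case using Suc.IH[OF _ T] TS Suc.prems(3) by blast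
  qed
qed

lemma triv_subgroup: "subgroup {\<one>} G"
  by (rule finite_subgroupI) auto

lemma perfect_in_solvable:
  assumes "perfect_on G W" "subgroup S G" "W \<subseteq> S" "solvable_on G S"
  shows "W = {\<one>}"
proof -
  have "S \<subseteq> normalizer_of G {\<one>}" using subgroup_mem[OF assms(2)] by (auto intro: normalizerI)
  moreover have "W \<subseteq> S <#> {\<one>}"
    using assms(3) subgroup_mem[OF assms(2)] by (force simp: set_mult_def)
  ultimately have "W \<subseteq> {\<one>}"
    using perfect_in_solvable_ext[OF assms(1,2) triv_subgroup] assms(4) by blast
  then show ?thesis using assms(1) subgroup.one_closed by (force simp: perfect_on_def)
qed

lemma abelian_solvable:
  assumes "subgroup S G" "\<not> non_abelian S G"
  shows "solvable_on G S"
proof -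
  have "derived G S \<subseteq> {\<one>}"
    by (rule derived_le[OF triv_subgroup]) (use assms in \<open>auto simp: commutator_eq_one_iff subgroup_mem non_abelian_def\<close>)
  moreover have "\<one> \<in> derived G S" unfolding derived_def by (rule generate.one)
  ultimately show ?thesis unfolding solvable_on_def by (intro exI[of _ 1]) auto
qed

text \<open>Choose \<open>N\<close> maximal among the proper normal subgroups of \<open>W\<close>
  above \<open>R\<close>. The last conclusion says that W/N has trivial centre: the preimage of the
  centre is normal, so it is \<open>N\<close> or \<open>W\<close>, and it is not \<open>W\<close>
  because a perfect group has no nontrivial abelian quotient.\<close>

lemma perfect_maximal_normal:
  assumes W: "perfect_on G W" and R: "subgroup R G" "R \<subset> W" "W \<subseteq> normalizer_of G R"
  obtains N where "subgroup N G" "R \<subseteq> N" "N \<subset> W" "W \<subseteq> normalizer_of G N"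
    "\<And>K. subgroup K G \<Longrightarrow> N \<subseteq> K \<Longrightarrow> K \<subseteq> W \<Longrightarrow> W \<subseteq> normalizer_of G K \<Longrightarrow> K = N \<or> K = W"
    "\<And>x. x \<in> W \<Longrightarrow> (\<And>y. y \<in> W \<Longrightarrow> commutator G x y \<in> N) \<Longrightarrow> x \<in> N"
proof -
  have Ws: "subgroup W G" using W by (simp add: perfect_on_def)
  note c = subgroup_mem[OF Ws]
  let ?C = "{N. subgroup N G \<and> R \<subseteq> N \<and> N \<subset> W \<and> W \<subseteq> normalizer_of G N}"
  have "finite ?C" using finite_subgroup[OF Ws] by (auto intro: finite_subset[of _ "Pow W"])
  moreover have "R \<in> ?C" using R by simp
  ultimately obtain N where N: "N \<in> ?C" "\<And>K. K \<in> ?C \<Longrightarrow> N \<subseteq> K \<Longrightarrow> K = N"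
    by (metis (no_types, lifting) finite_has_maximal2)
  have Ns: "subgroup N G" "N \<subset> W" "W \<subseteq> normalizer_of G N" "R \<subseteq> N"
    using N(1) by auto
  have mx: "K = N \<or> K = W" if "subgroup K G" "N \<subseteq> K" "K \<subseteq> W" "W \<subseteq> normalizer_of G K" for K
    using N(2)[of K] that Ns(4) by auto
  have nc: "conj_by G g n \<in> N" if "g \<in> W" "n \<in> N" for g n using that Ns(3) normalizerD by blast
  let ?Z = "{z \<in> W. \<forall>y \<in> W. commutator G z y \<in> N}"
  have Z: "subgroup ?Z G"
  proof (rule finite_subgroupI)
    show "\<one> \<in> ?Z"
      using c subgroup.one_closed[OF Ws] subgroup.one_closed[OF Ns(1)] by (auto simp: commutator_def)
    fix x y assume "x \<in> ?Z" "y \<in> ?Z"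
    then show "x \<otimes> y \<in> ?Z"
      using c nc by (auto simp: commutator_mult_left subgroup.m_closed[OF Ws] intro!: subgroup.m_closed[OF Ns(1)])
  qed (use c in auto)
  have Zn: "N \<subseteq> ?Z"
  proof
    fix n assume n: "n \<in> N"
    then have "n \<in> W" using Ns by blast
    moreover have "commutator G n y \<in> N" if "y \<in> W" for y
      using n that nc subgroup.m_inv_closed[OF Ns(1)] c \<open>n \<in> W\<close>
        by (auto simp: commutator_conj_by intro!: subgroup.m_closed[OF Ns(1)])
    ultimately show "n \<in> ?Z" by blast
  qed
  have Znm: "W \<subseteq> normalizer_of G ?Z"
  proof
    fix g assume g: "g \<in> W"
    show "g \<in> normalizer_of G ?Z"
    proof (rule normalizerI)
      fix z assume z: "z \<in> ?Z"
      have "commutator G (conj_by G g z) y \<in> N" if y: "y \<in> W" for y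
      proof -
        have i: "conj_by G (inv g) y \<in> W"
          using y g sub_conj_by[OF Ws] subgroup.m_inv_closed[OF Ws] by blast
        have "commutator G (conj_by G g z) y = conj_by G g (commutator G z (conj_by G (inv g) y))"
          using c g y z by (simp add: conj_by_commutator)
        then show ?thesis using nc[OF g] z i by auto
      qed
      then show "conj_by G g z \<in> ?Z" using z g sub_conj_by[OF Ws] by auto
    qed (use g c in simp)
  qed
  have "?Z \<noteq> W"
  proof
    assume "?Z = W"
    then have "W \<subseteq> N" using perfect_le[OF W Ns(1)] by blast
    then show False using Ns by blast
  qed
  then have "?Z = N" using mx[OF Z Zn _ Znm] by blast
  then show thesis using that[OF Ns(1) Ns(4) Ns(2) Ns(3) mx] by blast
qed

text \<open>In a chief factor on top of \<open>W\<close>, an element commuting with all its conjugates would have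
  an abelian normal closure.\<close>
lemma perfect_if_commuting_conjugates:
  assumes W: "perfect_on G W" and J: "subgroup J G" "W \<subseteq> normalizer_of G J"
    and comm: "\<And>x g. x \<in> W \<Longrightarrow> g \<in> W \<Longrightarrow> commutator G x (conj_by G g x) \<in> J"
  shows "W \<subseteq> J"
proof (rule ccontr)
  assume nWJ: "\<not> W \<subseteq> J"
  have Ws: "subgroup W G" using W by (simp add: perfect_on_def)
  note c = subgroup_mem[OF Ws]
  have R: "subgroup (W \<inter> J) G" "W \<inter> J \<subset> W" "W \<subseteq> normalizer_of G (W \<inter> J)"
    using subgroups_Inter_pair[OF Ws J(1)] nWJ J(2) sub_in_normalizer[OF Ws]
      by (auto simp: normalizer_of_def subset_iff)
  obtain N where N: "subgroup N G" "W \<inter> J \<subseteq> N" "N \<subset> W" "W \<subseteq> normalizer_of G N"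
    "\<And>K. subgroup K G \<Longrightarrow> N \<subseteq> K \<Longrightarrow> K \<subseteq> W \<Longrightarrow> W \<subseteq> normalizer_of G K \<Longrightarrow> K = N \<or> K = W"
    "\<And>x. x \<in> W \<Longrightarrow> (\<And>y. y \<in> W \<Longrightarrow> commutator G x y \<in> N) \<Longrightarrow> x \<in> N"
    using perfect_maximal_normal[OF W R] by metis
  obtain x where x: "x \<in> W" "x \<notin> N" using N by blast
  have nc: "conj_by G g n \<in> N" if "g \<in> W" "n \<in> N" for g n using that N(4) normalizerD by blast
  have wc: "conj_by G g n \<in> W" if "g \<in> W" "n \<in> W" for g n using that sub_conj_by[OF Ws] by blast
  \<comment> \<open>Modulo \<open>N\<close>, this is the centralizer of all conjugates of
    \<open>x\<close>. It is normal, contains \<open>N\<close>, and contains \<open>x\<close> by the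
    assumption on commutators. It is therefore all of \<open>W\<close>, and \<open>x\<close> becomes
    central modulo \<open>N\<close>, which is excluded.\<close>
  let ?C = "{y \<in> W. \<forall>g \<in> W. commutator G (conj_by G g x) y \<in> N}"
  have C: "subgroup ?C G"
  proof (rule finite_subgroupI)
    show "\<one> \<in> ?C"
      using c x subgroup.one_closed[OF Ws] subgroup.one_closed[OF N(1)] by (auto simp: commutator_def)
    fix y z assume "y \<in> ?C" "z \<in> ?C"
    then show "y \<otimes> z \<in> ?C"
      using c nc x by (auto simp: commutator_mult_right subgroup.m_closed[OF Ws] intro!: subgroup.m_closed[OF N(1)])
  qed (use c in auto)
  have Cn: "N \<subseteq> ?C"
  proof
    fix n assume n: "n \<in> N"
    then have nW: "n \<in> W" using N by blast
    moreover have "commutator G (conj_by G g x) n \<in> N" if "g \<in> W" for g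
      using n that nc[OF wc[OF that x(1)] n] subgroup.m_inv_closed[OF N(1)] c nW x
      by (auto simp: commutator_conj_by' intro!: subgroup.m_closed[OF N(1)])
    ultimately show "n \<in> ?C" by blast
  qed
  have Cnm: "W \<subseteq> normalizer_of G ?C"
  proof
    fix h assume h: "h \<in> W"
    show "h \<in> normalizer_of G ?C"
    proof (rule normalizerI)
      fix z assume z: "z \<in> ?C"
      have "commutator G (conj_by G g x) (conj_by G h z) \<in> N" if g: "g \<in> W" for g
      proof -
        have i: "inv h \<otimes> g \<in> W"
          using g h subgroup.m_inv_closed[OF Ws] subgroup.m_closed[OF Ws] by blast
        have "commutator G (conj_by G g x) (conj_by G h z) = conj_by G h (commutator G (conj_by G (inv h \<otimes> g) x) z)"
          using c g h z x i by (simp add: conj_by_commutator conj_by_conj_by)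
        then show ?thesis using nc[OF h] z i by auto
      qed
      then show "conj_by G h z \<in> ?C" using z h wc by auto
    qed (use h c in simp)
  qed
  have xC: "x \<in> ?C"
  proof -
    have "commutator G (conj_by G g x) x \<in> N" if g: "g \<in> W" for g
    proof -
      have "inv (commutator G x (conj_by G g x)) \<in> J"
        using comm[OF x(1) g] subgroup.m_inv_closed[OF J(1)] by blast
      then have "commutator G (conj_by G g x) x \<in> J" using c x g by (simp add: inv_commutator)
      moreover have "commutator G (conj_by G g x) x \<in> W" using commutator_sub[OF Ws] wc g x by blast
      ultimately show ?thesis using N(2) by blast
    qed
    then show ?thesis using x by blast
  qed
  have "?C = W" using N(5)[OF C Cn _ Cnm] xC x(2) by blast
  then have "commutator G (conj_by G \<one> x) y \<in> N" if "y \<in> W" for y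
    using that subgroup.one_closed[OF Ws] by blast
  then have "x \<in> N" using N(6)[OF x(1)] c x(1) by simp
  then show False using x by blast
qed

text \<open>A nontrivial p-group has a nontrivial centre. Applied to W/N for a maximal normal
  \<open>N\<close>, this contradicts the trivial centre that perfectness forces; the centre is found
  by letting \<open>W\<close> act on the cosets of \<open>N\<close> by conjugation.\<close>

lemma p_group_no_perfect:
  assumes P: "p_group_on G p W" and p: "Factorial_Ring.prime p" and W: "perfect_on G W"
  shows "W = {\<one>}"
proof (rule ccontr)
  assume nt: "W \<noteq> {\<one>}"
  have Ws: "subgroup W G" using W by (simp add: perfect_on_def)
  note c = subgroup_mem[OF Ws]
  obtain k where k: "card W = p ^ k" using P by (auto simp: p_group_on_def)
  have R: "{\<one>} \<subset> W" "W \<subseteq> normalizer_of G {\<one>}"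
    using nt subgroup.one_closed[OF Ws] c by (auto intro: normalizerI)
  obtain N where N: "subgroup N G" "N \<subset> W" "W \<subseteq> normalizer_of G N"
    "\<And>x. x \<in> W \<Longrightarrow> (\<And>y. y \<in> W \<Longrightarrow> commutator G x y \<in> N) \<Longrightarrow> x \<in> N"
    using perfect_maximal_normal[OF W triv_subgroup R] by metis
  note cN = subgroup_mem[OF N(1)]
  let ?E = "(\<lambda>s. s <# N) ` W"
  let ?F = "{C \<in> ?E. \<forall>g \<in> W. conj_by G g ` C = C}"
  have cjc: "conj_by G g ` (s <# N) = conj_by G g s <# N" if "g \<in> W" "s \<in> W" for g s
  proof -
    have "conj_by G g ` (s <# N) = conj_by G g s <# (conj_by G g ` N)"
      using that c cN by (auto simp: l_coset_def conj_by_mult image_iff)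
    moreover have "conj_by G g ` N = N" using that N(3) normalizer_img subgroup.subset[OF N(1)] by blast
    ultimately show ?thesis by simp
  qed
  have "card ?E mod p = card ?F mod p"
  proof (rule card_fixed_cong[OF Ws k p])
    show "finite ?E" using finite_subgroup[OF Ws] by simp
    fix g C assume "g \<in> W" "C \<in> ?E"
    then show "conj_by G g ` C \<in> ?E" using cjc sub_conj_by[OF Ws] by auto
  next
    fix C assume "C \<in> ?E"
    then obtain s where s: "s \<in> W" "C = s <# N" by blast
    show "conj_by G \<one> ` C = C" using cjc[OF subgroup.one_closed[OF Ws] s(1)] s c by simp
  next
    fix g h C assume gh: "g \<in> W" "h \<in> W" and "C \<in> ?E"
    then obtain s where s: "s \<in> W" "C = s <# N" by blast
    show "conj_by G (g \<otimes> h) ` C = conj_by G g ` conj_by G h ` C"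
      unfolding s(2) using gh s(1) cjc[of "g \<otimes> h" s] cjc[of h s] cjc[of g "conj_by G h s"]
        subgroup.m_closed[OF Ws] sub_conj_by[OF Ws] c by (simp add: conj_by_conj_by)
  qed
  moreover have "p dvd card ?E"
  proof -
    have e: "card ?E * card N = p ^ k" using card_l_cosets[OF N(1) Ws] N(2) k by auto
    then have "card ?E dvd p ^ k" by (metis dvd_triv_left)
    then obtain i where i: "card ?E = p ^ i" using divides_primepow_nat[OF p] by blast
    have "i \<noteq> 0"
    proof
      assume "i = 0"
      then have "card N = card W" using e i k by simp
      then show False using psubset_card_mono[OF finite_subgroup[OF Ws] N(2)] by simp
    qed
    then show ?thesis using i by simp
  qed
  ultimately have "p dvd card ?F" by (simp add: dvd_eq_mod_eq_0)
  then have F1: "card ?F \<noteq> 1" using prime_gt_1_nat[OF p] by auto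
  have "N \<in> ?F"
  proof -
    have "N = \<one> <# N" using subgroup.subset[OF N(1)] by (simp add: lcos_mult_one)
    then have "N \<in> ?E" using subgroup.one_closed[OF Ws] by blast
    moreover have "conj_by G g ` N = N" if "g \<in> W" for g
      using that N(3) normalizer_img subgroup.subset[OF N(1)] by blast
    ultimately show ?thesis by blast
  qed
  have "\<not> ?F \<subseteq> {N}"
  proof
    assume "?F \<subseteq> {N}"
    then have "?F = {N}" using \<open>N \<in> ?F\<close> by blast
    then show False using F1 by simp
  qed
  then obtain C where C: "C \<in> ?F" "C \<noteq> N" by blast
  then obtain s where s: "s \<in> W" "C = s <# N" by blast
  have isW: "inv s \<in> W" using s(1) subgroup.m_inv_closed[OF Ws] by blast
  \<comment> \<open>A coset fixed under conjugation by all of \<open>W\<close> is a central element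
    of W/N.\<close>
  have "inv s \<in> N"
  proof (rule N(4)[OF isW])
    fix g assume g: "g \<in> W"
    have "s <# N = conj_by G g s <# N" using C(1) s g cjc by auto
    then have "inv s \<otimes> conj_by G g s \<in> N" using l_coset_eq_iff[OF N(1)] s g c by auto
    then show "commutator G (inv s) g \<in> N" using s g c by (simp add: commutator_def conj_by_def m_assoc)
  qed
  then have "s \<in> N" using subgroup.m_inv_closed[OF N(1)] c[OF s(1)] by (metis inv_inv)
  then have "C = N" using s(2) coset_join3[OF cN N(1)] by simp
  then show False using C by blast
qed

lemma p_group_solvable:
  assumes P: "p_group_on G p S" and p: "Factorial_Ring.prime p"
  shows "solvable_on G S"
proof (rule solvable_onI)
  show S: "subgroup S G" using P by (simp add: p_group_on_def)
  fix W assume W: "perfect_on G W" "W \<subseteq> S"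
  obtain k where "card S = p ^ k" using P by (auto simp: p_group_on_def)
  moreover have Ws: "subgroup W G" using W by (simp add: perfect_on_def)
  ultimately have "card W dvd p ^ k" using card_dvd[OF _ S W(2)] by simp
  then have "p_group_on G p W" using Ws divides_primepow_nat[OF p] by (auto simp: p_group_on_def)
  then show "W = {\<one>}" using p_group_no_perfect p W by blast
qed

end

section \<open>Transfer\<close>

context fin_group
begin

text \<open>Commutators lying in \<open>R\<close> make \<open>R\<close> normal in \<open>B\<close>,
  since x h x^{-1} = [x,h] h. The quotient is handed over as an abelian group \<open>Q\<close> with
  a map \<open>q\<close>, so that products over cosets can be taken without regard to order.\<close>

lemma abelian_quotient_hom:
  assumes B: "subgroup B G" and R: "subgroup R G" "R \<subseteq> B"
    and ab: "\<And>x y. x \<in> B \<Longrightarrow> y \<in> B \<Longrightarrow> commutator G x y \<in> R"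
  obtains Q :: "'a set monoid" and q where "comm_group Q" "\<And>b. b \<in> B \<Longrightarrow> q b \<in> carrier Q"
    "\<And>a b. a \<in> B \<Longrightarrow> b \<in> B \<Longrightarrow> q (a \<otimes> b) = q a \<otimes>\<^bsub>Q\<^esub> q b"
    "\<And>b. b \<in> B \<Longrightarrow> q b = \<one>\<^bsub>Q\<^esub> \<longleftrightarrow> b \<in> R"
proof -
  let ?B = "G\<lparr>carrier := B\<rparr>"
  interpret B: group ?B using B subgroup_imp_group by blast
  note c = subgroup_mem[OF B]
  have sR: "subgroup R ?B" using subgroup_transfer[OF R(1) B R(2)] .
  have "R \<lhd> ?B"
    unfolding B.normal_inv_iff
  proof (intro conjI ballI sR)
    fix x h assume x: "x \<in> carrier ?B" and h: "h \<in> R"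
    then have xB: "x \<in> B" "h \<in> B" using R(2) by auto
    have "x \<otimes> h \<otimes> inv x = commutator G x h \<otimes> h"
      using xB c by (simp add: commutator_def m_assoc)
    then have "x \<otimes> h \<otimes> inv x \<in> R" using ab[OF xB] h subgroup.m_closed[OF R(1)] by simp
    then show "x \<otimes>\<^bsub>?B\<^esub> h \<otimes>\<^bsub>?B\<^esub> inv\<^bsub>?B\<^esub> x \<in> R"
      using B xB by (simp add: m_inv_consistent)
  qed
  then interpret R: normal R ?B .
  let ?Q = "?B Mod R"
  let ?q = "\<lambda>b. R #>\<^bsub>?B\<^esub> b"
  have hom: "?q \<in> hom ?B ?Q" by (rule R.r_coset_hom_Mod)
  have eq: "?q b = \<one>\<^bsub>?Q\<^esub> \<longleftrightarrow> b \<in> R" if "b \<in> B" for b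
    using that B.coset_join1[OF _ _ sR] B.coset_join2[OF _ sR] R.subset by fastforce
  interpret Q: group ?Q by (rule R.factorgroup_is_group)
  have m: "?q (a \<otimes> b) = ?q a \<otimes>\<^bsub>?Q\<^esub> ?q b" if "a \<in> B" "b \<in> B" for a b
    using hom_mult[OF hom] that by simp
  have "comm_group ?Q"
  proof (rule Q.group_comm_groupI)
    fix x y assume "x \<in> carrier ?Q" "y \<in> carrier ?Q"
    then obtain a b where ab': "a \<in> B" "b \<in> B" "x = ?q a" "y = ?q b" by (auto simp: carrier_FactGroup)
    have ba: "b \<otimes> a \<in> B" "commutator G a b \<in> B"
      using ab' subgroup.m_closed[OF B] commutator_sub[OF B] by auto
    have "a \<otimes> b = commutator G a b \<otimes> (b \<otimes> a)"
      using ab' c by (simp add: commutator_def m_assoc)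
    then have "?q (a \<otimes> b) = ?q (commutator G a b) \<otimes>\<^bsub>?Q\<^esub> ?q (b \<otimes> a)"
      using m[OF ba(2,1)] by simp
    also have "?q (commutator G a b) = \<one>\<^bsub>?Q\<^esub>" using eq[OF ba(2)] ab[OF ab'(1,2)] by simp
    also have "\<one>\<^bsub>?Q\<^esub> \<otimes>\<^bsub>?Q\<^esub> ?q (b \<otimes> a) = ?q (b \<otimes> a)"
      using hom ba by (intro Q.l_one) (auto simp: hom_def)
    finally show "x \<otimes>\<^bsub>?Q\<^esub> y = y \<otimes>\<^bsub>?Q\<^esub> x" using ab' m by simp
  qed
  then show thesis using that[of ?Q ?q] hom m eq by (auto simp: hom_def)
qed

text \<open>The transversal is chosen along the double cosets $BtB$, with representatives $st$, $s \in B$.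
  For $b \in B$ the factor of the transfer at a coset other than $B$ itself then lies in
  $B \cap B^t \subseteq R$, so the transfer of \<open>b\<close> is just the class of \<open>b\<close>.\<close>
theorem transfer_into_abelian_quotient:
  assumes D: "subgroup D G" and B: "subgroup B G" "B \<subseteq> D" and R: "subgroup R G" "R \<subseteq> B"
    and ab: "\<And>x y. x \<in> B \<Longrightarrow> y \<in> B \<Longrightarrow> commutator G x y \<in> R"
    and mal: "\<And>t b. t \<in> D \<Longrightarrow> t \<notin> B \<Longrightarrow> b \<in> B \<Longrightarrow> conj_by G t b \<in> B \<Longrightarrow> b \<in> R"
  shows "derived G D \<inter> B \<subseteq> R"
proof -
  note c = subgroup_mem[OF D]
  have Bc: "B \<subseteq> carrier G" using subgroup.subset[OF B(1)] .
  obtain Q :: "'a set monoid" and q where Q: "comm_group Q" and qc: "\<And>b. b \<in> B \<Longrightarrow> q b \<in> carrier Q"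
    and qm: "\<And>a b. a \<in> B \<Longrightarrow> b \<in> B \<Longrightarrow> q (a \<otimes> b) = q a \<otimes>\<^bsub>Q\<^esub> q b"
    and q1: "\<And>b. b \<in> B \<Longrightarrow> q b = \<one>\<^bsub>Q\<^esub> \<longleftrightarrow> b \<in> R"
    using B(1) R ab by (rule abelian_quotient_hom) (assumption, assumption, rule that, simp_all)
  interpret Q: comm_group Q by (rule Q)
  define C where "C = (\<lambda>s. s <# B) ` D"
  \<comment> \<open>The \<open>B\<close>-orbits of left cosets are the double cosets BtB;
    \<open>tt\<close> chooses t and \<open>ss\<close> the multiplier from \<open>B\<close>.\<close>
  define orb where "orb x = (\<lambda>b. b <# x) ` B" for x
  define tt where "tt O' = (SOME t. t \<in> D \<and> t <# B \<in> O')" for O'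
  define ss where "ss x = (SOME s. s \<in> B \<and> x = s <# (tt (orb x) <# B))" for x
  \<comment> \<open>At the coset \<open>B\<close> itself the representative is \<one>, so that an
    element of \<open>B\<close> contributes exactly itself to the transfer there.\<close>
  define r where "r x = (if x = B then \<one> else ss x \<otimes> tt (orb x))" for x
  have finC: "finite C" using finite_subgroup[OF D] by (simp add: C_def)
  have Csub: "x \<subseteq> carrier G" if "x \<in> C" for x
    using that c l_coset_subset_G[OF Bc] unfolding C_def by blast
  have l_assoc: "g <# (h <# x) = (g \<otimes> h) <# x" if "x \<in> C" "g \<in> D" "h \<in> D" for g h x
    using lcos_m_assoc[OF Csub[OF that(1)]] that c by blast
  have l_one: "\<one> <# x = x" if "x \<in> C" for x using lcos_mult_one Csub that by blast
  have one: "\<one> \<in> D" "\<one> \<in> B" using D B subgroup.one_closed by auto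
  have BC: "B \<in> C" unfolding C_def using one(1) lcos_mult_one[OF Bc] by force
  have act: "g <# x \<in> C" if "g \<in> D" "x \<in> C" for g x
    using that c lcos_m_assoc[OF Bc] subgroup.m_closed[OF D] by (force simp: C_def)
  have inv_act: "inv g <# (g <# x) = x" "g <# (inv g <# x) = x" if "g \<in> D" "x \<in> C" for g x
    using that l_assoc subgroup.m_inv_closed[OF D] l_one c by simp_all
  have iB: "inv b \<in> B" if "b \<in> B" for b using that subgroup.m_inv_closed[OF B(1)] by blast
  have mB: "a \<otimes> b \<in> B" if "a \<in> B" "b \<in> B" for a b
    using that subgroup.m_closed[OF B(1)] by blast
  have orb_eq: "orb (b <# x) = orb x" if b: "b \<in> B" and x: "x \<in> C" for b x
  proof -
    have *: "orb (b <# x) \<subseteq> orb x" if "b \<in> B" "x \<in> C" for b x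
      using that l_assoc B(2) mB by (auto simp: orb_def subset_iff)
    have "b <# x \<in> C" using act b x B(2) by blast
    then have "orb (inv b <# (b <# x)) \<subseteq> orb (b <# x)" using * iB b by blast
    then show ?thesis using *[OF b x] inv_act(1) b x B(2) by auto
  qed
  have tt: "tt (orb x) \<in> D \<and> tt (orb x) <# B \<in> orb x" if x: "x \<in> C" for x
  proof -
    obtain s where s: "s \<in> D" "x = s <# B" using x by (auto simp: C_def)
    have "x \<in> orb x" unfolding orb_def using l_one[OF x, symmetric] one(2) by (rule image_eqI)
    then have "\<exists>t. t \<in> D \<and> t <# B \<in> orb x" using s by auto
    then show ?thesis unfolding tt_def by (rule someI_ex)
  qed
  have ss: "ss x \<in> B \<and> x = ss x <# (tt (orb x) <# B)" if x: "x \<in> C" for x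
  proof -
    obtain b where b: "b \<in> B" "tt (orb x) <# B = b <# x" using tt[OF x] by (auto simp: orb_def)
    then have "x = inv b <# (tt (orb x) <# B)" using inv_act(1) x B(2) by auto
    then have "\<exists>s. s \<in> B \<and> x = s <# (tt (orb x) <# B)" using iB[OF b(1)] by blast
    then show ?thesis unfolding ss_def by (rule someI_ex)
  qed
  have tB: "tt (orb x) \<notin> B" if x: "x \<in> C" "x \<noteq> B" for x
  proof
    assume "tt (orb x) \<in> B"
    then have "tt (orb x) <# B = B" using B(1) coset_join3 Bc by blast
    then have "x = ss x <# B" using ss[OF x(1)] by simp
    then show False using x(2) ss[OF x(1)] B(1) coset_join3 Bc by blast
  qed
  have r: "r x \<in> D" "r x <# B = x" if x: "x \<in> C" for x
  proof -
    have m: "ss x \<in> D" "tt (orb x) \<in> D" using ss[OF x] tt[OF x] B(2) by auto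
    show "r x \<in> D" using m one subgroup.m_closed[OF D] by (auto simp: r_def)
    show "r x <# B = x" using m ss[OF x] lcos_mult_one[OF Bc] lcos_m_assoc[OF Bc] c
      by (auto simp: r_def)
  qed
  \<comment> \<open>The cocycle of the transversal \<open>r\<close>: it measures how far g r(x) is
    from the chosen representative of its coset.\<close>
  define \<beta> where "\<beta> g x = inv (r (g <# x)) \<otimes> (g \<otimes> r x)" for g x
  have \<beta>B: "\<beta> g x \<in> B" if "g \<in> D" "x \<in> C" for g x
  proof -
    have "(g \<otimes> r x) <# B = r (g <# x) <# B"
      using r[OF that(2)] r[OF act[OF that]] that c lcos_m_assoc[OF Bc] by metis
    then show ?thesis unfolding \<beta>_def
      using l_coset_eq_iff[OF B(1), of "r (g <# x)" "g \<otimes> r x"] r(1) act that c by auto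
  qed
  have \<beta>mult: "\<beta> (g \<otimes> h) x = \<beta> g (h <# x) \<otimes> \<beta> h x" if "g \<in> D" "h \<in> D" "x \<in> C" for g h x
  proof -
    have "r x \<in> carrier G" "r (h <# x) \<in> carrier G" "r (g <# (h <# x)) \<in> carrier G"
      using that r(1) act c by auto
    then show ?thesis unfolding \<beta>_def using that c l_assoc by (simp add: m_assoc)
  qed
  have \<beta>R: "\<beta> b x \<in> R" if b: "b \<in> B" and x: "x \<in> C" "x \<noteq> B" for b x
  proof -
    have bD: "b \<in> D" using b B(2) by blast
    have y: "b <# x \<in> C" using act bD x by blast
    have yB: "b <# x \<noteq> B"
    proof
      assume "b <# x = B"
      then have "x = inv b <# B" using inv_act(1)[OF bD x(1)] by simp
      then show False using x(2) iB[OF b] coset_join3 B(1) Bc by blast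
    qed
    let ?t = "tt (orb x)" and ?s = "ss x" and ?s' = "ss (b <# x)"
    have t: "?t \<in> D" "?t \<notin> B" using tt tB x by auto
    have s: "?s \<in> B" "?s' \<in> B" using ss x y by auto
    have cc: "?t \<in> carrier G" "?s \<in> carrier G" "?s' \<in> carrier G" "b \<in> carrier G"
      using t s b Bc c by auto
    \<comment> \<open>The cosets of x and bx lie in one double coset and share the representative
      \<open>?t\<close>. Conjugating by \<open>?t\<close> therefore removes it and leaves a product
      of elements of \<open>B\<close>, so that \<open>mal\<close> applies.\<close>
    have "\<beta> b x = inv (?s' \<otimes> ?t) \<otimes> (b \<otimes> (?s \<otimes> ?t))"
      using x(2) yB orb_eq[OF b x(1)] by (simp add: \<beta>_def r_def)
    then have "conj_by G ?t (\<beta> b x) = inv ?s' \<otimes> b \<otimes> ?s"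
      using cc by (simp add: conj_by_def inv_mult_group m_assoc)
    then have "conj_by G ?t (\<beta> b x) \<in> B" using s b mB iB by simp
    then show ?thesis using mal[OF t \<beta>B[OF bD x(1)]] by blast
  qed
  have \<beta>1: "\<beta> b B = b" if b: "b \<in> B" for b
  proof -
    have "b <# B = B" using coset_join3 b B(1) Bc by blast
    then show ?thesis using b Bc by (auto simp: \<beta>_def r_def)
  qed
  define V where "V g = finprod Q (\<lambda>x. q (\<beta> g x)) C" for g
  have qcl: "(\<lambda>x. q (\<beta> g x)) \<in> C \<rightarrow> carrier Q" if "g \<in> D" for g
    using that \<beta>B qc by blast
  have Vc: "V g \<in> carrier Q" if "g \<in> D" for g
    unfolding V_def using qcl[OF that] by (rule Q.finprod_closed)
  have Vm: "V (g \<otimes> h) = V g \<otimes>\<^bsub>Q\<^esub> V h" if g: "g \<in> D" and h: "h \<in> D" for g h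
  proof -
    \<comment> \<open>\<open>h\<close> permutes the cosets, so reindexing the product turns the
      cocycle identity into multiplicativity of \<open>V\<close>.\<close>
    have inj: "inj_on (\<lambda>x. h <# x) C" using inv_act(1)[OF h] by (metis inj_onI)
    have "(\<lambda>x. h <# x) ` C = C"
    proof
      show "(\<lambda>x. h <# x) ` C \<subseteq> C" using act h by blast
      show "C \<subseteq> (\<lambda>x. h <# x) ` C"
        using inv_act(2)[OF h] act subgroup.m_inv_closed[OF D h] by (metis imageI subsetI)
    qed
    then have e: "V g = finprod Q (\<lambda>x. q (\<beta> g (h <# x))) C"
      unfolding V_def using Q.finprod_reindex[OF _ inj, of "\<lambda>x. q (\<beta> g x)"] qcl[OF g] by simp
    have "V (g \<otimes> h) = finprod Q (\<lambda>x. q (\<beta> g (h <# x)) \<otimes>\<^bsub>Q\<^esub> q (\<beta> h x)) C"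
      unfolding V_def
    proof (rule Q.finprod_cong')
      fix x assume x: "x \<in> C"
      show "q (\<beta> (g \<otimes> h) x) = q (\<beta> g (h <# x)) \<otimes>\<^bsub>Q\<^esub> q (\<beta> h x)"
        using \<beta>mult[OF g h x] qm \<beta>B g h x act by simp
    qed (use g h act \<beta>B qc in auto)
    also have "\<dots> = V g \<otimes>\<^bsub>Q\<^esub> V h"
      unfolding e using g h act \<beta>B qc by (simp add: V_def Q.finprod_multf Pi_def)
    finally show ?thesis .
  qed
  have Vb: "V b = q b" if b: "b \<in> B" for b
  proof -
    have bD: "b \<in> D" using b B(2) by blast
    have CB: "C = insert B (C - {B})" using BC by blast
    have rest: "finprod Q (\<lambda>x. q (\<beta> b x)) (C - {B}) = \<one>\<^bsub>Q\<^esub>"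
      by (rule Q.finprod_one_eqI) (use \<beta>R[OF b] q1 \<beta>B[OF bD] in auto)
    have "V b = q (\<beta> b B) \<otimes>\<^bsub>Q\<^esub> finprod Q (\<lambda>x. q (\<beta> b x)) (C - {B})"
      unfolding V_def by (subst CB, subst Q.finprod_insert) (use finC qcl[OF bD] BC in auto)
    then show ?thesis using rest \<beta>1[OF b] qc[OF b] by simp
  qed
  let ?K = "{g \<in> D. V g = \<one>\<^bsub>Q\<^esub>}"
  have V1: "V \<one> = \<one>\<^bsub>Q\<^esub>"
    using Vb[OF one(2)] q1[OF one(2)] subgroup.one_closed[OF R(1)] by simp
  have K: "subgroup ?K G"
    by (rule finite_subgroupI) (use c one V1 Vm subgroup.m_closed[OF D] in auto)
  have "derived G D \<subseteq> ?K"
  proof (rule derived_le[OF K])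
    fix x y assume xy: "x \<in> D" "y \<in> D"
    have cm: "commutator G x y \<in> D" using commutator_sub[OF D xy] .
    have "commutator G x y \<otimes> (y \<otimes> x) = x \<otimes> y"
      using xy c by (simp add: commutator_def m_assoc)
    then have "V (commutator G x y) \<otimes>\<^bsub>Q\<^esub> (V y \<otimes>\<^bsub>Q\<^esub> V x) = V x \<otimes>\<^bsub>Q\<^esub> V y"
      using Vm[OF cm, of "y \<otimes> x"] Vm xy subgroup.m_closed[OF D] by simp
    then have "V (commutator G x y) \<otimes>\<^bsub>Q\<^esub> (V y \<otimes>\<^bsub>Q\<^esub> V x) = V y \<otimes>\<^bsub>Q\<^esub> V x"
      using Q.m_comm Vc xy by simp
    then have "V (commutator G x y) = \<one>\<^bsub>Q\<^esub>" using Vc xy cm by simp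
    then show "commutator G x y \<in> ?K" using cm by simp
  qed
  then show ?thesis using Vb q1 by auto
qed

end

section \<open>Malnormal subgroups and minimal non-abelian overgroups of a Sylow subgroup\<close>

text \<open>The contrapositive form of the usual condition that \<open>B\<close> meets its
  conjugates by elements of \<open>D\<close> outside \<open>B\<close> trivially.\<close>

definition malnormal_in :: "('a, 'b) monoid_scheme \<Rightarrow> 'a set \<Rightarrow> 'a set \<Rightarrow> bool" where
  "malnormal_in G B D \<longleftrightarrow> (\<forall>t \<in> D. \<forall>b \<in> B. b \<noteq> \<one>\<^bsub>G\<^esub> \<longrightarrow> conj_by G t b \<in> B \<longrightarrow> t \<in> B)"

context fin_group
begin

lemma malnormalD: "malnormal_in G B D \<Longrightarrow> t \<in> D \<Longrightarrow> b \<in> B \<Longrightarrow> b \<noteq> \<one> \<Longrightarrow> conj_by G t b \<in> B \<Longrightarrow> t \<in> B"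
  by (auto simp: malnormal_in_def)

text \<open>Transfer into B/B': malnormality makes the condition on elements conjugate back into
  \<open>B\<close> vacuous except at \<one>, so the perfect group \<open>D\<close> maps onto B/B'
  and this quotient must vanish.\<close>

lemma malnormal_perfect:
  assumes D: "perfect_on G D" and B: "subgroup B G" "B \<subseteq> D" "malnormal_in G B D"
  shows "perfect_on G B"
proof -
  have Ds: "subgroup D G" using D by (simp add: perfect_on_def)
  have d: "subgroup (derived G B) G" using B(1) derived_is_subgroup subgroup.subset by blast
  have "derived G D \<inter> B \<subseteq> derived G B"
  proof (rule transfer_into_abelian_quotient[OF Ds B(1,2) d derived_sub[OF B(1)]])
    fix t b assume "t \<in> D" "t \<notin> B" "b \<in> B" "conj_by G t b \<in> B"
    then have "b = \<one>" using malnormalD[OF B(3)] by blast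
    then show "b \<in> derived G B" using subgroup.one_closed[OF d] by simp
  qed (rule commutator_in_derived)
  then show ?thesis using D B derived_sub[OF B(1)] by (auto simp: perfect_on_def)
qed

lemma abelian_perfect_trivial: "perfect_on G W \<Longrightarrow> \<not> non_abelian W G \<Longrightarrow> W = {\<one>}"
  using abelian_solvable perfect_in_solvable by (auto simp: perfect_on_def)

lemma non_abelian_mono: "non_abelian H G \<Longrightarrow> H \<subseteq> K \<Longrightarrow> non_abelian K G"
  by (auto simp: non_abelian_def)

section \<open>Cyclic subgroups and centralizers\<close>

abbreviation cyc :: "'a \<Rightarrow> 'a set" where "cyc x \<equiv> generate G {x}"

lemma cyc_subgroup: "x \<in> carrier G \<Longrightarrow> subgroup (cyc x) G"
  by (simp add: generate_is_subgroup)

lemma cyc_self: "x \<in> cyc x"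
  by (simp add: generate.incl)

lemma cyc_least: "subgroup H G \<Longrightarrow> x \<in> H \<Longrightarrow> cyc x \<subseteq> H"
  by (simp add: generate_subgroup_incl)

lemma centralizer_commute: "S \<subseteq> carrier G \<Longrightarrow> S \<subseteq> centralizer G T \<Longrightarrow> T \<subseteq> carrier G \<Longrightarrow> T \<subseteq> centralizer G S"
  by (auto simp: centralizer_def subset_iff)

lemma centralizer_carrier: "centralizer G S \<subseteq> carrier G"
  by (auto simp: centralizer_def)

lemma centralizerD: "x \<in> centralizer G S \<Longrightarrow> s \<in> S \<Longrightarrow> x \<otimes> s = s \<otimes> x"
  by (auto simp: centralizer_def)

lemma centralizerI: "x \<in> carrier G \<Longrightarrow> (\<And>s. s \<in> S \<Longrightarrow> x \<otimes> s = s \<otimes> x) \<Longrightarrow> x \<in> centralizer G S"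
  by (auto simp: centralizer_def)

lemma centralizer_antimono: "S \<subseteq> T \<Longrightarrow> centralizer G T \<subseteq> centralizer G S"
  by (auto simp: centralizer_def)

lemma centralizer_normalizer: "S \<subseteq> carrier G \<Longrightarrow> centralizer G S \<subseteq> normalizer_of G S"
proof
  fix x assume S: "S \<subseteq> carrier G" and x: "x \<in> centralizer G S"
  show "x \<in> normalizer_of G S"
  proof (rule normalizerI)
    show "x \<in> carrier G" using x centralizer_carrier by blast
    fix s assume s: "s \<in> S"
    then have "conj_by G x s = s" using x S centralizerD[OF x s] conj_by_eq_iff centralizer_carrier by blast
    then show "conj_by G x s \<in> S" using s by simp
  qed
qed

lemma cyc_centralizer:
  assumes "x \<in> carrier G" "y \<in> carrier G" "x \<otimes> y = y \<otimes> x"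
  shows "cyc x \<subseteq> centralizer G {y}"
  using assms by (intro cyc_least centralizer_subgroup) (auto simp: centralizer_def)

lemma cyc_abelian:
  assumes "x \<in> carrier G"
  shows "\<not> non_abelian (cyc x) G"
proof -
  have "y \<otimes> x = x \<otimes> y" if "y \<in> cyc x" for y
    using that cyc_centralizer[OF assms assms] by (auto simp: centralizer_def)
  then have "cyc x \<subseteq> centralizer G {y}" if "y \<in> cyc x" for y
    using that cyc_centralizer[OF assms, of y] subgroup_mem[OF cyc_subgroup[OF assms]] by auto
  then show ?thesis by (fastforce simp: non_abelian_def centralizer_def)
qed

lemma abelian_centralizer: "subgroup H G \<Longrightarrow> \<not> non_abelian H G \<Longrightarrow> H \<subseteq> centralizer G H"
  by (auto simp: centralizer_def non_abelian_def subgroup_mem)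

lemma p_subgroup_card_le:
  assumes "sylow_of G p P S" "p_group_on G p Q" "Q \<subseteq> S" "subgroup S G" "Factorial_Ring.prime p"
  shows "card Q \<le> card P"
proof -
  obtain s where s: "s \<in> S" "Q \<subseteq> conj_by G s ` P" using sylow_contains_conj[OF assms] by blast
  have P: "subgroup P G" using assms by (simp add: sylow_of_def p_group_on_def)
  have "card Q \<le> card (conj_by G s ` P)" using card_mono[OF _ s(2)] finite_subgroup[OF P] by simp
  then show ?thesis using card_conj_by_img[OF subgroup.subset[OF P]] s(1) subgroup_mem[OF assms(4)] by simp
qed

lemma p_group_sub:
  assumes "p_group_on G p P" "subgroup Q G" "Q \<subseteq> P" "Factorial_Ring.prime p"
  shows "p_group_on G p Q"
proof -
  obtain k where "card P = p ^ k" using assms(1) by (auto simp: p_group_on_def)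
  then have "card Q dvd p ^ k" using card_dvd[OF assms(2) _ assms(3)] assms(1) by (simp add: p_group_on_def)
  then show ?thesis using assms(2) divides_primepow_nat[OF assms(4)] by (auto simp: p_group_on_def)
qed

text \<open>A Sylow subgroup of \<open>W\<close> lies in a conjugate of \<open>P\<close> under
  \<open>L\<close>. Conjugating back keeps it inside the normal subgroup \<open>W\<close>, so
  \<open>W \<inter> P\<close> contains a Sylow subgroup of \<open>W\<close>, and being a p-group it
  is no larger.\<close>

lemma sylow_inter_normal:
  assumes P: "sylow_of G p P L" and L: "subgroup L G" and W: "subgroup W G" "W \<subseteq> L" "L \<subseteq> normalizer_of G W"
    and p: "Factorial_Ring.prime p"
  shows "sylow_of G p (W \<inter> P) W"
proof -
  have Ps: "subgroup P G" using P by (simp add: sylow_of_def p_group_on_def)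
  have WP: "subgroup (W \<inter> P) G" using W(1) Ps subgroups_Inter_pair by blast
  have pg: "p_group_on G p (W \<inter> P)" using P p_group_sub[OF _ WP _ p] by (auto simp: sylow_of_def)
  obtain Q where Q: "sylow_of G p Q W" using sylow_exists[OF W(1) p] by blast
  have Qs: "subgroup Q G" "p_group_on G p Q" "Q \<subseteq> W"
    using Q by (auto simp: sylow_of_def p_group_on_def)
  obtain l where l: "l \<in> L" "Q \<subseteq> conj_by G l ` P"
    using sylow_contains_conj[OF P Qs(2) _ L p] Qs(3) W(2) by blast
  have lc: "l \<in> carrier G" "inv l \<in> L" "inv l \<in> carrier G"
    using l(1) L subgroup.m_inv_closed subgroup_mem by auto
  have "conj_by G (inv l) ` Q \<subseteq> W \<inter> P"
  proof
    fix y assume "y \<in> conj_by G (inv l) ` Q"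
    then obtain z where z: "z \<in> Q" "y = conj_by G (inv l) z" by blast
    then obtain w where w: "w \<in> P" "z = conj_by G l w" using l(2) by blast
    have "y = w" using z w lc subgroup_mem[OF Ps] by simp
    moreover have "y \<in> W" using z Qs(3) lc(2) W(3) normalizerD by blast
    ultimately show "y \<in> W \<inter> P" using w by simp
  qed
  moreover have Q': "sylow_of G p (conj_by G (inv l) ` Q) W"
    using sylow_conj_by[OF Q subgroup.subset[OF W(1)]] lc(2) W(3) by blast
  moreover have "card (W \<inter> P) \<le> card (conj_by G (inv l) ` Q)"
    using p_subgroup_card_le[OF Q' pg _ W(1) p] by blast
  ultimately have "conj_by G (inv l) ` Q = W \<inter> P" using finite_subgroup[OF WP] by (meson card_seteq)
  then show ?thesis using Q' by simp
qed

lemma maximal_over: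
  assumes "subgroup Y G" "Y \<subset> L" "finite L"
  obtains T where "subgroup T G" "Y \<subseteq> T" "T \<subset> L"
    "\<And>K. subgroup K G \<Longrightarrow> T \<subseteq> K \<Longrightarrow> K \<subseteq> L \<Longrightarrow> K = T \<or> K = L"
proof -
  let ?C = "{T. subgroup T G \<and> Y \<subseteq> T \<and> T \<subset> L}"
  have "finite ?C" using assms(3) by (auto intro: finite_subset[of _ "Pow L"])
  moreover have "Y \<in> ?C" using assms by simp
  ultimately obtain T where T: "T \<in> ?C" "\<And>K. K \<in> ?C \<Longrightarrow> T \<subseteq> K \<Longrightarrow> K = T"
    by (metis (no_types, lifting) finite_has_maximal2)
  show thesis
  proof (rule that[of T])
    fix K assume "subgroup K G" "T \<subseteq> K" "K \<subseteq> L"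
    then show "K = T \<or> K = L" using T(2)[of K] T(1) by auto
  qed (use T(1) in auto)
qed

text \<open>If \<open>T\<close> were normal, L/T would be cyclic and \<open>W\<close> would lie in
  the abelian \<open>T\<close>; so \<open>T\<close> is its own normalizer in \<open>L\<close>. An
  element of \<open>T\<close> that another element of \<open>L\<close> outside \<open>T\<close>
  conjugates into \<open>T\<close> is then centralized by more than \<open>T\<close>, hence by
  \<open>L\<close>. Transfer into T modulo its part central in \<open>L\<close> finishes the
  argument.\<close>

lemma abelian_maximal_central:
  assumes L: "subgroup L G" and T: "subgroup T G" "T \<subset> L" "\<not> non_abelian T G"
    and mx: "\<And>K. subgroup K G \<Longrightarrow> T \<subseteq> K \<Longrightarrow> K \<subseteq> L \<Longrightarrow> K = T \<or> K = L"
    and W: "perfect_on G W" "W \<subseteq> L" "W \<noteq> {\<one>}"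
  shows "W \<inter> T \<subseteq> centralizer G L"
proof -
  note c = subgroup_mem[OF L]
  have Tc: "T \<subseteq> carrier G" using T(1) subgroup.subset by blast
  have not_normal: "\<not> L \<subseteq> normalizer_of G T"
  proof
    assume n: "L \<subseteq> normalizer_of G T"
    obtain l where l: "l \<in> L" "l \<notin> T" using T by blast
    have lc: "l \<in> carrier G" using l c by blast
    have cl: "cyc l \<subseteq> L" using cyc_least[OF L l(1)] .
    have K: "subgroup (cyc l <#> T) G" using set_mult_subgroup[OF cyc_subgroup[OF lc] T(1)] cl n by blast
    have "cyc l <#> T \<subseteq> L" using set_mult_least[OF L cl] T by blast
    moreover have "T \<subseteq> cyc l <#> T" "l \<in> cyc l <#> T"
      using set_mult_upper1[OF cyc_subgroup[OF lc] T(1)] set_mult_upper2[OF cyc_subgroup[OF lc] T(1)] cyc_self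
        by auto
    ultimately have "cyc l <#> T = L" using mx[OF K] l by blast
    then have "W \<subseteq> T"
      using perfect_in_solvable_ext[OF W(1) cyc_subgroup[OF lc] T(1)] cl n W(2)
        abelian_solvable[OF cyc_subgroup[OF lc] cyc_abelian[OF lc]] by auto
    then show False using abelian_perfect_trivial[OF W(1)] T(3) W(3) non_abelian_mono by blast
  qed
  have nT: "normalizer_of G T \<inter> L = T"
  proof -
    have "subgroup (normalizer_of G T \<inter> L) G"
      using normalizer_subgroup[OF Tc] L subgroups_Inter_pair by blast
    moreover have "T \<subseteq> normalizer_of G T \<inter> L" using sub_in_normalizer[OF T(1)] T(2) by blast
    ultimately show ?thesis using mx[of "normalizer_of G T \<inter> L"] not_normal by blast
  qed
  let ?R = "T \<inter> centralizer G L"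
  have Rs: "subgroup ?R G" using T(1) centralizer_subgroup subgroup.subset[OF L] subgroups_Inter_pair by blast
  have "derived G L \<inter> T \<subseteq> ?R"
  proof (rule transfer_into_abelian_quotient[OF L T(1) _ Rs])
    fix x y assume xy: "x \<in> T" "y \<in> T"
    then have "x \<otimes> y = y \<otimes> x" using T(3) by (auto simp: non_abelian_def)
    then have "commutator G x y = \<one>" using xy Tc commutator_eq_one_iff by blast
    then show "commutator G x y \<in> ?R" using subgroup.one_closed[OF Rs] by simp
  next
    fix t b assume t: "t \<in> L" "t \<notin> T" and b: "b \<in> T" "conj_by G t b \<in> T"
    let ?C = "L \<inter> centralizer G {b}"
    have tc: "t \<in> carrier G" "inv t \<in> L" "inv t \<in> carrier G" "b \<in> carrier G"
      using t b c Tc subgroup.m_inv_closed[OF L] by auto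
    have C: "subgroup ?C G"
      using L centralizer_subgroup tc subgroups_Inter_pair by (metis empty_subsetI insert_subset)
    have TC: "T \<subseteq> ?C" using T(2,3) b Tc by (auto simp: centralizer_def non_abelian_def)
    have "?C \<noteq> T"
    proof
      assume e: "?C = T"
      \<comment> \<open>Both \<open>b\<close> and its conjugate by \<open>t\<close> lie in the
        abelian \<open>T\<close>, so the conjugate of \<open>T\<close> by the inverse of
        \<open>t\<close> also centralizes \<open>b\<close>. If that centralizer in \<open>L\<close>
        is only \<open>T\<close>, the inverse of \<open>t\<close> normalizes
        \<open>T\<close>.\<close>
      have "inv t \<in> normalizer_of G T"
      proof (rule normalizerI)
        fix s assume s: "s \<in> T"
        then have sc: "s \<in> carrier G" "s \<in> L" using Tc T(2) by auto
        have com: "s \<otimes> conj_by G t b = conj_by G t b \<otimes> s"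
          using s b T(3) by (auto simp: non_abelian_def)
        have "conj_by G (inv t) s \<otimes> b = conj_by G (inv t) (s \<otimes> conj_by G t b)"
          using sc tc by (simp add: conj_by_mult)
        also have "\<dots> = b \<otimes> conj_by G (inv t) s"
          unfolding com using sc tc by (simp add: conj_by_mult)
        finally have "conj_by G (inv t) s \<in> ?C"
          using sc tc sub_conj_by[OF L tc(2) sc(2)] by (auto simp: centralizer_def)
        then show "conj_by G (inv t) s \<in> T" using e by simp
      qed (use tc in simp)
      then have "inv t \<in> T" using nT tc by blast
      then show False using t(2) subgroup.m_inv_closed[OF T(1)] tc by (metis inv_inv)
    qed
    then have "?C = L" using mx[OF C TC] by blast
    then have "h \<otimes> b = b \<otimes> h" if "h \<in> L" for h using that by (blast intro: centralizerD)
    then have "b \<in> centralizer G L" using tc by (auto simp: centralizer_def)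
    then show "b \<in> ?R" using b by blast
  qed (use T in auto)
  moreover have "W \<subseteq> derived G L"
    using mono_derived[OF W(2)] W(1) by (simp add: perfect_on_def)
  ultimately show ?thesis by blast
qed

text \<open>Let \<open>W\<close> be the perfect residual of \<open>L\<close>. An abelian maximal subgroup $T \supseteq P$ meets its
  conjugates in the centre of \<open>L\<close>, so transfer gives $W \cap T \leq Z(L)$. Hence \<open>P\<close> normalizes a Sylow
  subgroup of \<open>W\<close> for each prime, minimality makes \<open>P\<close> centralize all of them, and then every
  element of \<open>W\<close> lies in some such \<open>T\<close>, so that \<open>W\<close> is central.\<close>
theorem minimal_non_abelian_over_sylow_solvable:
  assumes L: "subgroup L G" "non_abelian L G" and P: "sylow_of G p P L" and p: "Factorial_Ring.prime p"
    and mn: "\<And>Y. subgroup Y G \<Longrightarrow> P \<subseteq> Y \<Longrightarrow> Y \<subset> L \<Longrightarrow> \<not> non_abelian Y G"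
  shows "solvable_on G L"
proof (rule ccontr)
  assume ns: "\<not> solvable_on G L"
  obtain n where n: "perfect_on G ((derived G ^^ n) L)" using perfect_core[OF L(1)] by blast
  define W where "W = (derived G ^^ n) L"
  have W: "perfect_on G W" "W \<subseteq> L" "L \<subseteq> normalizer_of G W" "subgroup W G"
    using n exp_derived_props[OF L(1), of n] sub_in_normalizer[OF L(1)] by (auto simp: W_def)
  have W1: "W \<noteq> {\<one>}" using ns by (auto simp: solvable_on_def W_def)
  have Wna: "non_abelian W G" using W1 W(1) abelian_perfect_trivial by blast
  have Ps: "subgroup P G" "P \<subseteq> L" "p_group_on G p P"
    using P by (auto simp: sylow_of_def p_group_on_def)
  have PL: "P \<subset> L" using Ps p_group_solvable[OF Ps(3) p] ns by auto
  have Pab: "\<not> non_abelian P G" using mn[OF Ps(1) _ PL] by blast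
  have finL: "finite L" using finite_subgroup[OF L(1)] .
  note c = subgroup_mem[OF L(1)]
  have central: "y \<in> centralizer G L" if y: "y \<in> W" "y \<in> Y" and Y: "subgroup Y G" "P \<subseteq> Y" "Y \<subset> L" for y Y
  proof -
    obtain T where T: "subgroup T G" "Y \<subseteq> T" "T \<subset> L"
      "\<And>K. subgroup K G \<Longrightarrow> T \<subseteq> K \<Longrightarrow> K \<subseteq> L \<Longrightarrow> K = T \<or> K = L"
      using maximal_over[OF Y(1,3) finL] by metis
    have "\<not> non_abelian T G" using mn T Y by blast
    then show ?thesis using abelian_maximal_central[OF L(1) T(1,3) _ T(4) W(1,2) W1] y T by blast
  qed
  have WP: "sylow_of G p (W \<inter> P) W" using sylow_inter_normal[OF P L(1) W(4,2,3) p] .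
  have WPc: "W \<inter> P \<subseteq> centralizer G L" using central[OF _ _ Ps(1) _ PL] by blast
  let ?Y = "W \<inter> centralizer G P"
  have Ys: "subgroup ?Y G"
    using W(4) centralizer_subgroup[OF subgroup.subset[OF Ps(1)]] subgroups_Inter_pair by blast
  have "?Y = W"
  proof (rule subgroup_eq_if_sylows[OF W(4) Ys])
    fix r assume r: "Factorial_Ring.prime r" "r dvd card W"
    show "\<exists>R. sylow_of G r R W \<and> R \<subseteq> ?Y"
    proof (cases "r = p")
      case True
      have "W \<inter> P \<subseteq> ?Y" using abelian_centralizer[OF Ps(1) Pab] by blast
      then show ?thesis using WP True by blast
    next
      case False
      obtain Q where Q: "sylow_of G r Q W" using sylow_exists[OF W(4) r(1)] by blast
      have Qs: "subgroup Q G" "Q \<subseteq> W" using Q by (auto simp: sylow_of_def p_group_on_def)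
      let ?N = "W \<inter> normalizer_of G Q"
      have N: "subgroup ?N G"
        using W(4) normalizer_subgroup[OF subgroup.subset[OF Qs(1)]] subgroups_Inter_pair by blast
      have WPs: "subgroup (W \<inter> P) G" using W(4) Ps(1) subgroups_Inter_pair by blast
      have "centralizer G L \<subseteq> normalizer_of G Q"
        using centralizer_antimono[of Q L] centralizer_normalizer[OF subgroup.subset[OF Qs(1)]] Qs(2) W(2)
          by blast
      then have "W \<inter> P \<subseteq> ?N" using WPc by blast
      \<comment> \<open>Because \<open>W \<inter> P\<close> is central it lies in \<open>?N\<close>.
        The index of \<open>?N\<close> in \<open>W\<close> thus divides the index of a Sylow
        p-subgroup, which is prime to p.\<close>
      then obtain a where a: "card ?N = card (W \<inter> P) * a" using card_dvd[OF WPs N] by blast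
      obtain b where b: "card W = card ?N * b" using card_dvd[OF N W(4)] by blast
      have pos: "card ?N > 0" "card (W \<inter> P) > 0" using card_sub_pos N WPs by auto
      have "card W div card ?N = b" using b pos by simp
      moreover have "card W div card (W \<inter> P) = a * b" using a b pos by simp
      moreover have "\<not> p dvd card W div card (W \<inter> P)" using WP by (simp add: sylow_of_def)
      ultimately have "\<not> p dvd card W div card ?N" by (metis dvd_mult)
      then obtain Q' where Q': "sylow_of G r Q' W" "P \<subseteq> normalizer_of G Q'"
        using invariant_sylow[OF Ps(3) _ W(4) p r(1) Q] Ps(2) W(3) by blast
      have Q's: "subgroup Q' G" "Q' \<subseteq> W" "p_group_on G r Q'"
        using Q' by (auto simp: sylow_of_def p_group_on_def)
      have PQ: "subgroup (P <#> Q') G" using set_mult_subgroup[OF Ps(1) Q's(1) Q'(2)] .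
      have sub: "P \<subseteq> P <#> Q'" "Q' \<subseteq> P <#> Q'" "P <#> Q' \<subseteq> L"
        using set_mult_upper1[OF Ps(1) Q's(1)] set_mult_upper2[OF Ps(1) Q's(1)] set_mult_least[OF L(1) Ps(2)] Q's(2) W(2)
          by blast+
      have "P <#> Q' \<noteq> L"
      proof
        assume "P <#> Q' = L"
        then have "W \<subseteq> Q'"
          using perfect_in_solvable_ext[OF W(1) Ps(1) Q's(1) Q'(2)] W(2) p_group_solvable[OF Ps(3) p] by blast
        then show False using perfect_in_solvable[OF W(1) Q's(1)] p_group_solvable[OF Q's(3) r(1)] W1 by blast
      qed
      then have "\<not> non_abelian (P <#> Q') G" using mn[OF PQ sub(1)] sub(3) by blast
      then have "Q' \<subseteq> centralizer G P"
        using sub subgroup_mem[OF Q's(1)] unfolding non_abelian_def centralizer_def by blast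
      then show ?thesis using Q' Q's by blast
    qed
  qed auto
  then have WcP: "W \<subseteq> centralizer G P" by blast
  have "W \<subseteq> centralizer G L"
  proof
    fix x assume x: "x \<in> W"
    then have xc: "x \<in> carrier G" "x \<in> L" using W(2) c by auto
    have cx: "cyc x \<subseteq> W" using cyc_least[OF W(4) x] .
    have Pn: "P \<subseteq> normalizer_of G (cyc x)"
    proof -
      have "cyc x \<subseteq> centralizer G P" using cx WcP by blast
      then have "P \<subseteq> centralizer G (cyc x)"
        using centralizer_commute subgroup.subset[OF cyc_subgroup[OF xc(1)]] subgroup.subset[OF Ps(1)]
          by blast
      then show ?thesis using centralizer_normalizer[OF subgroup.subset[OF cyc_subgroup[OF xc(1)]]] by blast
    qed
    have PQ: "subgroup (P <#> cyc x) G" using set_mult_subgroup[OF Ps(1) cyc_subgroup[OF xc(1)] Pn] .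
    have sub: "P \<subseteq> P <#> cyc x" "cyc x \<subseteq> P <#> cyc x" "P <#> cyc x \<subseteq> L"
      using set_mult_upper1[OF Ps(1) cyc_subgroup[OF xc(1)]] set_mult_upper2[OF Ps(1) cyc_subgroup[OF xc(1)]]
        set_mult_least[OF L(1) Ps(2)] cx W(2) by blast+
    \<comment> \<open>Each element of \<open>W\<close> lies in a proper subgroup over
      \<open>P\<close>: otherwise \<open>W\<close> would sit in the cyclic group of
      \<open>x\<close>, since \<open>P\<close> is solvable. Hence \<open>central\<close> applies to
      every \<open>x\<close>.\<close>
    have "P <#> cyc x \<noteq> L"
    proof
      assume "P <#> cyc x = L"
      then have "W \<subseteq> cyc x"
        using perfect_in_solvable_ext[OF W(1) Ps(1) cyc_subgroup[OF xc(1)] Pn] W(2) p_group_solvable[OF Ps(3) p]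
          by blast
      then show False using cyc_abelian[OF xc(1)] Wna non_abelian_mono by blast
    qed
    then show "x \<in> centralizer G L" using central[OF x _ PQ sub(1)] sub cyc_self by blast
  qed
  then have "\<not> non_abelian W G" using W(2) unfolding non_abelian_def centralizer_def by blast
  then show False using Wna by blast
qed

end

section \<open>TI-subgroups and subnormality\<close>

context fin_group
begin

lemma conj_by_image_conj_sub: "g \<in> carrier G \<Longrightarrow> conj_sub G H (inv g) = conj_by G g ` H"
  by (auto simp: conj_sub_def conj_by_def)

lemma TI_subgroupD:
  assumes TI: "TI_subgroup H G" and g: "g \<in> carrier G" and h: "h \<in> H" "h \<noteq> \<one>" "conj_by G g h \<in> H"
  shows "g \<in> normalizer_of G H"
proof -
  have H: "subgroup H G" using TI by (simp add: TI_subgroup_def)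
  note c = subgroup_mem[OF H]
  have "conj_sub G H (inv g) \<inter> H = {\<one>} \<or> conj_sub G H (inv g) \<inter> H = H"
    using TI g by (simp add: TI_subgroup_def)
  moreover have "conj_by G g h \<in> conj_sub G H (inv g) \<inter> H" "conj_by G g h \<noteq> \<one>"
    using h g c by (auto simp: conj_by_image_conj_sub)
  ultimately have "H \<subseteq> conj_by G g ` H" using conj_by_image_conj_sub[OF g, of H] by auto
  then have "H = conj_by G g ` H"
    using card_conj_by_img[OF subgroup.subset[OF H] g] finite_subgroup[OF H] by (intro card_subset_eq) auto
  then show ?thesis using g by (auto intro!: normalizerI)
qed

lemma normal_in_subgroupD:
  assumes K: "subgroup K G" and H: "H \<lhd> (G\<lparr>carrier := K\<rparr>)"
  shows "subgroup H G" "H \<subseteq> K" "K \<subseteq> normalizer_of G H"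
proof -
  interpret K: group "G\<lparr>carrier := K\<rparr>" using K subgroup_imp_group by blast
  have sH: "subgroup H (G\<lparr>carrier := K\<rparr>)" using H normal_imp_subgroup by blast
  show "subgroup H G" using incl_subgroup[OF K sH] .
  show "H \<subseteq> K" using subgroup.subset[OF sH] by simp
  show "K \<subseteq> normalizer_of G H"
  proof
    fix k assume k: "k \<in> K"
    show "k \<in> normalizer_of G H"
    proof (rule normalizerI)
      fix h assume "h \<in> H"
      then have "k \<otimes>\<^bsub>G\<lparr>carrier := K\<rparr>\<^esub> h \<otimes>\<^bsub>G\<lparr>carrier := K\<rparr>\<^esub> inv\<^bsub>G\<lparr>carrier := K\<rparr>\<^esub> k \<in> H"
        using H k unfolding K.normal_inv_iff by simp
      then show "conj_by G k h \<in> H" using k K by (simp add: conj_by_def m_inv_consistent)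
    qed (use k subgroup_mem[OF K] in simp)
  qed
qed

lemma normal_in_subgroupI:
  assumes K: "subgroup K G" and H: "subgroup H G" "H \<subseteq> K" "K \<subseteq> normalizer_of G H"
  shows "H \<lhd> (G\<lparr>carrier := K\<rparr>)"
proof -
  interpret K: group "G\<lparr>carrier := K\<rparr>" using K subgroup_imp_group by blast
  have "k \<otimes> h \<otimes> inv k \<in> H" if "k \<in> K" "h \<in> H" for k h
    using that H(3) normalizerD unfolding conj_by_def by blast
  then show ?thesis unfolding K.normal_inv_iff
    using subgroup_transfer[OF H(1) K H(2)] K by (auto simp: m_inv_consistent)
qed

text \<open>Climb the subnormal chain. If \<open>H\<close> is normal in \<open>K\<close> and inside
  \<open>M\<close>, every element of \<open>K\<close> conjugates a nontrivial element of
  \<open>M\<close> into \<open>M\<close>, so \<open>K\<close> is inside \<open>M\<close> too. At the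
  top this would give \<open>M = carrier G\<close>.\<close>

lemma malnormal_not_subnormal:
  assumes S: "subnormal G S" and M: "malnormal_in G M (carrier G)" "M \<noteq> carrier G" "M \<subseteq> carrier G"
  shows "S \<subseteq> M \<Longrightarrow> S \<noteq> {\<one>} \<Longrightarrow> \<one> \<in> S \<Longrightarrow> False"
  using S
proof (induction rule: subnormal.induct)
  case top
  then show ?case using M by blast
next
  case (step K H)
  note n = normal_in_subgroupD[OF step.hyps(2,3)]
  obtain h where h: "h \<in> H" "h \<noteq> \<one>" using step.prems by blast
  have "K \<subseteq> M"
  proof
    fix k assume k: "k \<in> K"
    then have "conj_by G k h \<in> H" using n(3) h normalizerD by blast
    then show "k \<in> M"
      using malnormalD[OF M(1), of k h] h k step.prems(1) subgroup_mem[OF step.hyps(2)] by blast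
  qed
  moreover have "K \<noteq> {\<one>}" using h n(2) by blast
  moreover have "\<one> \<in> K" using step.hyps(2) subgroup.one_closed by blast
  ultimately show ?case using step.IH by blast
qed

lemma sylow_sub:
  assumes P: "sylow_of G p P S" and S: "subgroup S G" and L: "subgroup L G" "P \<subseteq> L" "L \<subseteq> S"
  shows "sylow_of G p P L"
proof -
  have Ps: "subgroup P G" using P by (simp add: sylow_of_def p_group_on_def)
  obtain a where a: "card L = card P * a" using card_dvd[OF Ps L(1,2)] by blast
  obtain b where b: "card S = card L * b" using card_dvd[OF L(1) S L(3)] by blast
  have "card P > 0" using card_sub_pos[OF Ps] .
  then have "card S div card P = a * b" "card L div card P = a" using a b by auto
  then have "\<not> p dvd card L div card P" using P by (auto simp: sylow_of_def)
  then show ?thesis using P L(2) by (simp add: sylow_of_def)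
qed

text \<open>The Frattini argument: \<open>g\<close> moves \<open>P\<close> to another Sylow subgroup
  of \<open>K\<close>, and an element of \<open>K\<close> moves it back.\<close>

lemma frattini:
  assumes K: "subgroup K G" and P: "sylow_of G p P K" "Factorial_Ring.prime p" and g: "g \<in> normalizer_of G K"
  obtains k n where "k \<in> K" "n \<in> normalizer_of G P" "g = k \<otimes> n"
proof -
  have Ps: "subgroup P G" "P \<subseteq> K" using P by (auto simp: sylow_of_def p_group_on_def)
  have gc: "g \<in> carrier G" using g normalizer_carrier by blast
  have "sylow_of G p (conj_by G g ` P) K" using sylow_conj_by[OF P(1) subgroup.subset[OF K] g] .
  then obtain k where k: "k \<in> K" "conj_by G g ` P = conj_by G k ` P"
    using sylow_conj[OF P(1) _ K P(2)] by blast
  have kc: "k \<in> carrier G" using k(1) K subgroup_mem by blast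
  have "inv k \<otimes> g \<in> normalizer_of G P"
  proof (rule normalizerI)
    fix s assume s: "s \<in> P"
    then obtain t where t: "t \<in> P" "conj_by G g s = conj_by G k t" using k(2) by blast
    have "conj_by G (inv k \<otimes> g) s = t"
      using s t kc gc subgroup_mem[OF Ps(1)] by (simp add: conj_by_conj_by[symmetric])
    then show "conj_by G (inv k \<otimes> g) s \<in> P" using t by simp
  qed (use kc gc in simp)
  moreover have "g = k \<otimes> (inv k \<otimes> g)" using kc gc by simp
  ultimately show thesis using that k(1) by blast
qed

text \<open>Climb the subnormal chain. If \<open>H\<close> normalizes \<open>Q\<close>, then
  \<open>Q\<close> is the only Sylow q-subgroup of \<open>H \<inter> D\<close>. A group
  \<open>K\<close> in which \<open>H\<close> is normal preserves this intersection, so it normalizes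
  \<open>Q\<close> as well.\<close>

lemma sylow_subnormal_normal:
  assumes S: "subnormal G S" and D: "subgroup D G" "carrier G \<subseteq> normalizer_of G D" and Q: "sylow_of G q Q D"
    and q: "Factorial_Ring.prime q"
  shows "Q \<subseteq> S \<Longrightarrow> S \<subseteq> normalizer_of G Q \<Longrightarrow> carrier G \<subseteq> normalizer_of G Q"
  using S
proof (induction rule: subnormal.induct)
  case (step K H)
  note n = normal_in_subgroupD[OF step.hyps(2,3)]
  have Qs: "subgroup Q G" "Q \<subseteq> D" using Q by (auto simp: sylow_of_def p_group_on_def)
  have HD: "subgroup (H \<inter> D) G" using n(1) D(1) subgroups_Inter_pair by blast
  have "K \<subseteq> normalizer_of G Q"
  proof
    fix k assume k: "k \<in> K"
    then have kc: "k \<in> carrier G" using subgroup_mem[OF step.hyps(2)] by blast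
    have "conj_by G k ` Q \<subseteq> H \<inter> D"
      using step.prems(1) Qs(2) k n(3) kc D(2) normalizerD by blast
    moreover have "sylow_of G q (conj_by G k ` Q) D"
      using sylow_conj_by[OF Q subgroup.subset[OF D(1)]] kc D(2) by blast
    ultimately have "sylow_of G q (conj_by G k ` Q) (H \<inter> D)" using sylow_sub[OF _ D(1) HD] by blast
    moreover have "sylow_of G q Q (H \<inter> D)" using sylow_sub[OF Q D(1) HD] step.prems(1) Qs(2) by blast
    ultimately obtain s where s: "s \<in> H \<inter> D" "conj_by G k ` Q = conj_by G s ` Q"
      using sylow_conj[OF _ _ HD q] by blast
    have "conj_by G s ` Q = Q" using s(1) step.prems(2) normalizer_img[OF subgroup.subset[OF Qs(1)]] by blast
    then show "k \<in> normalizer_of G Q" using s(2) kc by (auto intro!: normalizerI)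
  qed
  then show ?case using step.IH step.prems(1) n(2) by blast
qed simp

lemma normalizer_centre:
  assumes Q: "subgroup Q G"
  shows "normalizer_of G Q \<subseteq> normalizer_of G (Q \<inter> centralizer G Q)"
proof
  fix g assume g: "g \<in> normalizer_of G Q"
  note c = subgroup_mem[OF Q] normalizer_carrier[OF g]
  show "g \<in> normalizer_of G (Q \<inter> centralizer G Q)"
  proof (rule normalizerI)
    fix z assume z: "z \<in> Q \<inter> centralizer G Q"
    have "conj_by G g z \<otimes> s = s \<otimes> conj_by G g z" if s: "s \<in> Q" for s
    proof -
      let ?s = "conj_by G (inv g) s"
      have s': "?s \<in> Q" using normalizerD'[OF subgroup.subset[OF Q] g s] .
      have "z \<otimes> ?s = ?s \<otimes> z" using z s' centralizerD by blast
      then have "conj_by G g (z \<otimes> ?s) = conj_by G g (?s \<otimes> z)" by simp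
      then show ?thesis using z s c by (simp add: conj_by_mult)
    qed
    then show "conj_by G g z \<in> Q \<inter> centralizer G Q"
      using z normalizerD[OF g] c by (auto intro: centralizerI)
  qed (use c in simp)
qed

lemma solvable_last_term:
  assumes S: "subgroup S G" "solvable_on G S" "S \<noteq> {\<one>}"
  obtains A where "subgroup A G" "A \<subseteq> S" "A \<noteq> {\<one>}" "normalizer_of G S \<subseteq> normalizer_of G A" "\<not> non_abelian A G"
proof -
  let ?d = "\<lambda>n. (derived G ^^ n) S"
  define n where "n = (LEAST n. ?d n = {\<one>})"
  have n: "?d n = {\<one>}" using S(2) unfolding n_def solvable_on_def by (metis (mono_tags) LeastI_ex)
  have "n \<noteq> 0" using n S(3) by (metis funpow_0)
  then obtain m where m: "n = Suc m" using not0_implies_Suc by blast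
  have m1: "?d m \<noteq> {\<one>}"
    using m not_less_Least[of m "\<lambda>n. ?d n = {\<one>}"] by (simp add: n_def)
  have A: "subgroup (?d m) G" "?d m \<subseteq> S" "normalizer_of G S \<subseteq> normalizer_of G (?d m)"
    using exp_derived_props[OF S(1)] by auto
  have "derived G (?d m) = {\<one>}" using n m by simp
  then have "x \<otimes> y = y \<otimes> x" if "x \<in> ?d m" "y \<in> ?d m" for x y
    using commutator_in_derived[OF that] that subgroup_mem[OF A(1)] by (simp add: commutator_eq_one_iff)
  then have "\<not> non_abelian (?d m) G" by (auto simp: non_abelian_def)
  then show thesis using that[OF A(1,2) m1 A(3)] by blast
qed

text \<open>The passage to a self-centralizing overgroup: whatever centralizes this product
  centralizes \<open>L\<close>, so it is one of the two factors' elements.\<close>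

definition times_centralizer :: "'a set \<Rightarrow> 'a set" where
  "times_centralizer L = L <#> centralizer G L"

lemma sub_normalizer_centralizer: "subgroup L G \<Longrightarrow> L \<subseteq> normalizer_of G (centralizer G L)"
proof
  fix x assume L: "subgroup L G" and x: "x \<in> L"
  have xc: "x \<in> carrier G" using L x subgroup_mem by blast
  show "x \<in> normalizer_of G (centralizer G L)"
  proof (rule normalizerI[OF xc])
    fix y assume y: "y \<in> centralizer G L"
    then have "conj_by G x y = y"
      using x xc centralizerD[OF y x] centralizer_carrier conj_by_eq_iff by (metis subsetD)
    then show "conj_by G x y \<in> centralizer G L" using y by simp
  qed
qed

lemma times_centralizer_props:
  assumes L: "subgroup L G"
  shows "subgroup (times_centralizer L) G" "L \<subseteq> times_centralizer L" "centralizer G L \<subseteq> times_centralizer L"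
    "centralizer G (times_centralizer L) \<subseteq> times_centralizer L"
proof -
  have C: "subgroup (centralizer G L) G" using centralizer_subgroup subgroup.subset[OF L] by blast
  show "subgroup (times_centralizer L) G"
    unfolding times_centralizer_def using set_mult_subgroup[OF L C sub_normalizer_centralizer[OF L]] .
  show 1: "L \<subseteq> times_centralizer L" unfolding times_centralizer_def using set_mult_upper1[OF L C] .
  show 2: "centralizer G L \<subseteq> times_centralizer L"
    unfolding times_centralizer_def using set_mult_upper2[OF L C] .
  show "centralizer G (times_centralizer L) \<subseteq> times_centralizer L"
    using centralizer_antimono[OF 1] 2 by blast
qed

end

section \<open>Existence of an abelian normal subgroup\<close>

text \<open>The original hypothesis is kept only for overgroups of the nontrivial p-group
  \<open>P\<close>; their orders are divisible by p, so the third alternative never occurs for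
  them.\<close>

locale malnormal_sylow = fin_group +
  fixes p M P
  assumes p: "Factorial_Ring.prime p"
    and M: "subgroup M G" "M \<noteq> carrier G" "malnormal_in G M (carrier G)" "non_abelian M G"
    and P: "sylow_of G p P (carrier G)" "P \<subseteq> M" "P \<noteq> {\<one>}"
    and hyp: "\<And>L. subgroup L G \<Longrightarrow> non_abelian L G \<Longrightarrow> centralizer G L \<subseteq> L \<Longrightarrow> P \<subseteq> L \<Longrightarrow>
      TI_subgroup L G \<or> subnormal G L"
begin

lemma Ps: "subgroup P G" "p_group_on G p P" "P \<subseteq> carrier G"
  using P(1) by (auto simp: sylow_of_def p_group_on_def)

lemma P_elem: obtains z where "z \<in> P" "z \<noteq> \<one>" "z \<in> carrier G"
  using P(3) subgroup.one_closed[OF Ps(1)] Ps(3) by blast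

lemma normalizer_P_sub: "normalizer_of G P \<subseteq> M"
proof
  fix g assume g: "g \<in> normalizer_of G P"
  obtain z where z: "z \<in> P" "z \<noteq> \<one>" using P_elem by blast
  then show "g \<in> M"
    using malnormalD[OF M(3) normalizer_carrier[OF g], of z] normalizerD[OF g z(1)] P(2) by blast
qed

lemma centralizer_sub_M: "P \<subseteq> L \<Longrightarrow> centralizer G L \<subseteq> M"
  using centralizer_antimono[of P L] centralizer_normalizer[OF Ps(3)] normalizer_P_sub by blast

text \<open>Nontrivial subgroups of the proper malnormal \<open>M\<close> are never subnormal, so
  \<open>hyp\<close> leaves only the TI alternative.\<close>

lemma self_centralizing_TI:
  assumes "subgroup L G" "non_abelian L G" "centralizer G L \<subseteq> L" "P \<subseteq> L" "L \<subseteq> M"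
  shows "TI_subgroup L G"
proof -
  obtain z where z: "z \<in> P" "z \<noteq> \<one>" using P_elem by blast
  then have "L \<noteq> {\<one>}" using assms(4) by blast
  then have "\<not> subnormal G L"
    using malnormal_not_subnormal[OF _ M(3,2) subgroup.subset[OF M(1)] assms(5)] subgroup.one_closed[OF assms(1)]
      by blast
  then show ?thesis using hyp[OF assms(1-4)] by blast
qed

lemma normalizer_P_TI:
  assumes "TI_subgroup L G" "P \<subseteq> L"
  shows "normalizer_of G P \<subseteq> normalizer_of G L"
proof
  fix g assume g: "g \<in> normalizer_of G P"
  obtain z where z: "z \<in> P" "z \<noteq> \<one>" using P_elem by blast
  then show "g \<in> normalizer_of G L"
    using TI_subgroupD[OF assms(1) normalizer_carrier[OF g], of z] normalizerD[OF g z(1)] assms(2) by blast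
qed

lemma sylow_over_P: "subgroup K G \<Longrightarrow> P \<subseteq> K \<Longrightarrow> sylow_of G p P K"
  using sylow_sub[OF P(1) subgroup_self] subgroup.subset by blast

text \<open>\<open>B\<close> is the normalizer of \<open>J\<close>, the product of a solvable
  minimal non-abelian overgroup \<open>L0\<close> of \<open>P\<close> with its centralizer. Its
  intersection \<open>Z\<close> with \<open>D\<close> is malnormal in \<open>D\<close>, hence
  perfect. Two applications of the commuting-conjugates criterion push \<open>Z\<close> first into
  \<open>J\<close> and then into the trivial group.\<close>

lemma malnormal_avoiding_perfect:
  assumes D: "perfect_on G D" "carrier G \<subseteq> normalizer_of G D"
  obtains B where "subgroup B G" "P \<subseteq> B" "malnormal_in G B (carrier G)" "D \<inter> B = {\<one>}"
proof -
  let ?C = "{L. subgroup L G \<and> P \<subseteq> L \<and> L \<subseteq> M \<and> non_abelian L G}"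
  have "finite ?C" using finite_subgroup[OF M(1)] by (auto intro: finite_subset[of _ "Pow M"])
  moreover have "M \<in> ?C" using M P by simp
  ultimately obtain L0 where L0: "L0 \<in> ?C" "\<And>K. K \<in> ?C \<Longrightarrow> K \<subseteq> L0 \<Longrightarrow> K = L0"
    by (metis (no_types, lifting) finite_has_minimal2)
  have L: "subgroup L0 G" "P \<subseteq> L0" "L0 \<subseteq> M" "non_abelian L0 G" using L0(1) by auto
  have Lsol: "solvable_on G L0"
  proof (rule minimal_non_abelian_over_sylow_solvable[OF L(1,4) sylow_over_P[OF L(1,2)] p])
    fix Y assume "subgroup Y G" "P \<subseteq> Y" "Y \<subset> L0"
    then show "\<not> non_abelian Y G" using L0(2)[of Y] L(3) by blast
  qed
  define J where "J = times_centralizer L0"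
  note J = times_centralizer_props[OF L(1), folded J_def]
  have JM: "J \<subseteq> M"
    unfolding J_def times_centralizer_def using set_mult_least[OF M(1) L(3) centralizer_sub_M[OF L(2)]] .
  have PJ: "P \<subseteq> J" using L(2) J(2) by blast
  have Jna: "non_abelian J G" using non_abelian_mono[OF L(4) J(2)] .
  have JTI: "TI_subgroup J G" using self_centralizing_TI[OF J(1) Jna J(4) PJ JM] .
  define B where "B = normalizer_of G J"
  have Bs: "subgroup B G" unfolding B_def using normalizer_subgroup subgroup.subset[OF J(1)] by blast
  have JB: "J \<subseteq> B" unfolding B_def using sub_in_normalizer[OF J(1)] .
  have NB: "normalizer_of G P \<subseteq> B" unfolding B_def using normalizer_P_TI[OF JTI PJ] .
  have PB: "P \<subseteq> B" using PJ JB by blast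
  have BM: "B \<subseteq> M"
  proof
    fix b assume "b \<in> B"
    then obtain k n where "k \<in> J" "n \<in> normalizer_of G P" "b = k \<otimes> n"
      unfolding B_def using frattini[OF J(1) sylow_over_P[OF J(1) PJ] p] by metis
    then show "b \<in> M" using JM normalizer_P_sub subgroup.m_closed[OF M(1)] by blast
  qed
  have Bna: "non_abelian B G" using non_abelian_mono[OF Jna JB] .
  have Bsc: "centralizer G B \<subseteq> B" using centralizer_antimono[OF JB] J(4) JB by blast
  have BTI: "TI_subgroup B G" using self_centralizing_TI[OF Bs Bna Bsc PB BM] .
  \<comment> \<open>The TI property of \<open>B\<close> reduces malnormality to self-normalization.
    That follows from Frattini, because N_G(P) is already contained in \<open>B\<close>.\<close>
  have Bmal: "malnormal_in G B (carrier G)"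
    unfolding malnormal_in_def
  proof (intro ballI impI)
    fix t b assume t: "t \<in> carrier G" "b \<in> B" "b \<noteq> \<one>" "conj_by G t b \<in> B"
    have "t \<in> normalizer_of G B" using TI_subgroupD[OF BTI t] .
    then obtain k n where "k \<in> B" "n \<in> normalizer_of G P" "t = k \<otimes> n"
      using frattini[OF Bs sylow_over_P[OF Bs PB] p] by metis
    then show "t \<in> B" using NB subgroup.m_closed[OF Bs] by blast
  qed
  define Z where "Z = D \<inter> B"
  have Ds: "subgroup D G" using D(1) by (simp add: perfect_on_def)
  have Zs: "subgroup Z G" unfolding Z_def using Ds Bs subgroups_Inter_pair by blast
  note Zc = subgroup_mem[OF Zs]
  have Zmal: "malnormal_in G Z D"
    unfolding malnormal_in_def
  proof (intro ballI impI)
    fix t b assume t: "t \<in> D" "b \<in> Z" "b \<noteq> \<one>" "conj_by G t b \<in> Z"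
    then have "t \<in> B" using malnormalD[OF Bmal, of t b] subgroup_mem[OF Ds] by (auto simp: Z_def)
    then show "t \<in> Z" using t by (simp add: Z_def)
  qed
  have Zp: "perfect_on G Z" using malnormal_perfect[OF D(1) Zs _ Zmal] by (simp add: Z_def)
  have ZB: "Z \<subseteq> B" by (simp add: Z_def)
  have "Z \<subseteq> J"
  proof (rule perfect_if_commuting_conjugates[OF Zp J(1)])
    show "Z \<subseteq> normalizer_of G J" using ZB by (simp add: B_def)
    fix x g assume x: "x \<in> Z" and g: "g \<in> Z"
    have xc: "x \<in> carrier G" "x \<in> B" "g \<in> carrier G" "g \<in> B" using x g Zc ZB by auto
    have cx: "cyc x \<subseteq> B" using cyc_least[OF Bs xc(2)] .
    \<comment> \<open>\<open>K\<close> is again a self-centralizing overgroup of \<open>P\<close> in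
      \<open>M\<close>, hence TI and normalized by N_G(P). Writing \<open>g\<close> as an element of
      \<open>J\<close> times one of N_G(P) shows that \<open>g\<close> normalizes \<open>K\<close>.
      So the conjugate of \<open>x\<close> by \<open>g\<close> is a power of \<open>x\<close> modulo
      \<open>J\<close> and commutes with \<open>x\<close> modulo \<open>J\<close>.\<close>
    define K where "K = cyc x <#> J"
    have Ks: "subgroup K G" unfolding K_def
      using set_mult_subgroup[OF cyc_subgroup[OF xc(1)] J(1)] cx by (simp add: B_def)
    have JK: "J \<subseteq> K" unfolding K_def using set_mult_upper2[OF cyc_subgroup[OF xc(1)] J(1)] .
    have xK: "x \<in> K"
      unfolding K_def using set_mult_upper1[OF cyc_subgroup[OF xc(1)] J(1)] cyc_self by blast
    have KM: "K \<subseteq> M" unfolding K_def using set_mult_least[OF M(1)] cx BM JM by blast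
    have "centralizer G K \<subseteq> K" using centralizer_antimono[OF JK] J(4) JK by blast
    then have KTI: "TI_subgroup K G"
      using self_centralizing_TI[OF Ks non_abelian_mono[OF Jna JK] _ _ KM] PJ JK by blast
    obtain k n where kn: "k \<in> J" "n \<in> normalizer_of G P" "g = k \<otimes> n"
      using frattini[OF J(1) sylow_over_P[OF J(1) PJ] p] xc(4) unfolding B_def by metis
    have "k \<in> normalizer_of G K" using kn(1) JK sub_in_normalizer[OF Ks] by blast
    moreover have "n \<in> normalizer_of G K" using kn(2) normalizer_P_TI[OF KTI] PJ JK by blast
    ultimately have "g \<in> normalizer_of G K"
      using kn(3) subgroup.m_closed[OF normalizer_subgroup[OF subgroup.subset[OF Ks]]] by blast
    then have "conj_by G g x \<in> K" using xK normalizerD by blast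
    then obtain y j where yj: "y \<in> cyc x" "j \<in> J" "conj_by G g x = y \<otimes> j"
      unfolding K_def by (rule set_multE)
    have yc: "y \<in> carrier G" "j \<in> carrier G" "y \<in> B"
      using yj cx subgroup_mem[OF Bs] subgroup_mem[OF J(1)] by blast+
    have "x \<otimes> y = y \<otimes> x"
      using cyc_abelian[OF xc(1)] yj(1) cyc_self unfolding non_abelian_def by blast
    then have "commutator G x y = \<one>" using xc yc by (simp add: commutator_eq_one_iff)
    then have e: "commutator G x (conj_by G g x) = conj_by G y (commutator G x j)"
      using xc yc by (simp add: yj(3) commutator_mult_right)
    have "conj_by G x j \<in> J" using xc(2) yj(2) normalizerD unfolding B_def by blast
    then have "commutator G x j \<in> J"
      using xc yc yj(2)
      by (simp add: commutator_conj_by' subgroup.m_closed[OF J(1)] subgroup.m_inv_closed[OF J(1)])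
    then show "commutator G x (conj_by G g x) \<in> J" using e yc(3) normalizerD unfolding B_def by simp
  qed
  \<comment> \<open>\<open>J\<close> is \<open>L0\<close> times its centralizer and
    \<open>L0\<close> is solvable, so the perfect \<open>Z\<close> lies in the centralizer.\<close>
  then have ZL: "Z \<subseteq> centralizer G L0"
    using perfect_in_solvable_ext[OF Zp L(1) centralizer_subgroup[OF subgroup.subset[OF L(1)]] sub_normalizer_centralizer[OF L(1)] _ Lsol]
    by (simp add: J_def times_centralizer_def)
  have "Z \<subseteq> {\<one>}"
  proof (rule perfect_if_commuting_conjugates[OF Zp triv_subgroup])
    show "Z \<subseteq> normalizer_of G {\<one>}" using Zc by (auto intro: normalizerI)
    fix y g assume y: "y \<in> Z" and g: "g \<in> Z"
    have yc: "y \<in> carrier G" "g \<in> carrier G" using y g Zc by auto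
    have cy: "cyc y \<subseteq> Z" using cyc_least[OF Zs y] .
    note cys = cyc_subgroup[OF yc(1)]
    have "L0 \<subseteq> centralizer G (cyc y)"
      using centralizer_commute[OF subgroup.subset[OF cys] _ subgroup.subset[OF L(1)]] cy ZL by blast
    then have Ln: "L0 \<subseteq> normalizer_of G (cyc y)"
      using centralizer_normalizer[OF subgroup.subset[OF cys]] by blast
    \<comment> \<open>\<open>y\<close> centralizes \<open>L0\<close>, so it is central in
      \<open>L'\<close> and also in the self-centralizing \<open>K\<close> built from
      \<open>L'\<close>. As \<open>g\<close> centralizes \<open>P\<close>, it normalizes the
      TI-subgroup \<open>K\<close>; the conjugate of \<open>y\<close> stays in \<open>K\<close> and
      commutes with \<open>y\<close>.\<close>
    define L' where "L' = L0 <#> cyc y"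
    have L's: "subgroup L' G" unfolding L'_def using set_mult_subgroup[OF L(1) cys Ln] .
    have LL': "L0 \<subseteq> L'" unfolding L'_def using set_mult_upper1[OF L(1) cys] .
    have yL': "y \<in> L'" unfolding L'_def using set_mult_upper2[OF L(1) cys] cyc_self by blast
    have L'M: "L' \<subseteq> M" unfolding L'_def using set_mult_least[OF M(1) L(3)] cy ZB BM by blast
    define K where "K = times_centralizer L'"
    note K = times_centralizer_props[OF L's, folded K_def]
    have PK: "P \<subseteq> K" "P \<subseteq> L'" using L(2) LL' K(2) by auto
    have KM: "K \<subseteq> M"
      unfolding K_def times_centralizer_def using set_mult_least[OF M(1) L'M centralizer_sub_M[OF PK(2)]] .
    have Kna: "non_abelian K G" using non_abelian_mono[OF L(4)] LL' K(2) by blast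
    have KTI: "TI_subgroup K G" using self_centralizing_TI[OF K(1) Kna K(4) PK(1) KM] .
    have "g \<in> normalizer_of G P"
      using g ZL centralizer_antimono[OF L(2)] centralizer_normalizer[OF Ps(3)] by blast
    then have "g \<in> normalizer_of G K" using normalizer_P_TI[OF KTI PK(1)] by blast
    then have gy: "conj_by G g y \<in> K" using yL' K(2) normalizerD by blast
    have Cy: "subgroup (centralizer G {y}) G" using centralizer_subgroup yc by simp
    have "L0 \<subseteq> centralizer G {y}"
      using y ZL subgroup_mem[OF L(1)] by (auto simp: centralizer_def subset_iff)
    moreover have "cyc y \<subseteq> centralizer G {y}" using cyc_centralizer[OF yc(1) yc(1)] by simp
    ultimately have "L' \<subseteq> centralizer G {y}" unfolding L'_def using set_mult_least[OF Cy] by blast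
    moreover have "centralizer G L' \<subseteq> centralizer G {y}"
      using centralizer_antimono[of "{y}" L'] yL' by blast
    ultimately have "K \<subseteq> centralizer G {y}"
      unfolding K_def times_centralizer_def using set_mult_least[OF Cy] by blast
    then have "conj_by G g y \<otimes> y = y \<otimes> conj_by G g y" using gy centralizerD by blast
    then show "commutator G y (conj_by G g y) \<in> {\<one>}" using yc by (simp add: commutator_eq_one_iff)
  qed
  then have "D \<inter> B = {\<one>}" using subgroup.one_closed[OF Zs] by (auto simp: Z_def)
  then show thesis using that[OF Bs PB Bmal] by blast
qed

theorem abelian_normal_exists:
  "\<exists>A. subgroup A G \<and> A \<noteq> {\<one>} \<and> carrier G \<subseteq> normalizer_of G A \<and> \<not> non_abelian A G"
proof (rule ccontr)
  assume "\<not> ?thesis"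
  then have noA: "A = {\<one>}" if "subgroup A G" "carrier G \<subseteq> normalizer_of G A" "\<not> non_abelian A G" for A
    using that by blast
  obtain n where n: "perfect_on G ((derived G ^^ n) (carrier G))"
    using perfect_core[OF subgroup_self] by blast
  define D where "D = (derived G ^^ n) (carrier G)"
  have self: "carrier G \<subseteq> normalizer_of G (carrier G)" using sub_in_normalizer[OF subgroup_self] .
  have D: "perfect_on G D" "subgroup D G" "carrier G \<subseteq> normalizer_of G D"
    using n exp_derived_props[OF subgroup_self, of n] self by (auto simp: D_def)
  note Dc = subgroup_mem[OF D(2)]
  obtain z where z: "z \<in> P" "z \<noteq> \<one>" "z \<in> carrier G" by (rule P_elem)
  have D1: "D \<noteq> {\<one>}"
  proof
    assume "D = {\<one>}"
    then have "solvable_on G (carrier G)" by (auto simp: solvable_on_def D_def)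
    moreover have "carrier G \<noteq> {\<one>}" using z by blast
    ultimately obtain A where "subgroup A G" "A \<noteq> {\<one>}" "normalizer_of G (carrier G) \<subseteq> normalizer_of G A" "\<not> non_abelian A G"
      by (rule solvable_last_term[OF subgroup_self])
    then show False using noA self by blast
  qed
  obtain B where B: "subgroup B G" "P \<subseteq> B" "malnormal_in G B (carrier G)" "D \<inter> B = {\<one>}"
    using malnormal_avoiding_perfect[OF D(1,3)] by metis
  have DP: "D \<inter> P = {\<one>}"
    using B(2,4) subgroup.one_closed[OF Ps(1)] subgroup.one_closed[OF D(2)] by blast
  \<comment> \<open>\<open>D \<inter> P\<close> is a Sylow p-subgroup of the normal subgroup
    \<open>D\<close>, and it is trivial.\<close>
  have pD: "\<not> p dvd card D"
    using sylow_inter_normal[OF P(1) subgroup_self D(2) subgroup.subset[OF D(2)] D(3) p] DP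
      by (simp add: sylow_of_def)
  have fpf: "d = \<one>" if d: "d \<in> D" and u: "u \<in> P" "u \<noteq> \<one>" "d \<otimes> u = u \<otimes> d" for d u
  proof -
    have "conj_by G d u = u" using d u Dc Ps(3) conj_by_eq_iff by blast
    then have "d \<in> B" using malnormalD[OF B(3), of d u] d u(1,2) B(2) Dc by auto
    then show ?thesis using d B(4) by blast
  qed
  have "card D \<noteq> 1" using D1 subgroup.one_closed[OF D(2)] by (metis card_1_singletonE singletonD)
  then obtain q where q: "Factorial_Ring.prime q" "q dvd card D" using prime_factor_nat by blast
  obtain Q0 where Q0: "sylow_of G q Q0 D" using sylow_exists[OF D(2) q(1)] by blast
  have "\<not> p dvd card D div card (D \<inter> normalizer_of G Q0)"
  proof
    have Q0s: "subgroup Q0 G" using Q0 by (simp add: sylow_of_def p_group_on_def)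
    have N: "subgroup (D \<inter> normalizer_of G Q0) G"
      using D(2) normalizer_subgroup[OF subgroup.subset[OF Q0s]] subgroups_Inter_pair by blast
    assume "p dvd card D div card (D \<inter> normalizer_of G Q0)"
    then have "p dvd card D" using card_dvd[OF N D(2)] by (metis dvd_div_mult_self dvd_mult2 inf_le1)
    then show False using pD by blast
  qed
  then obtain Q where Q: "sylow_of G q Q D" "P \<subseteq> normalizer_of G Q"
    using invariant_sylow[OF Ps(2) _ D(2) p q(1) Q0] D(3) Ps(3) by blast
  have Qs: "subgroup Q G" "Q \<subseteq> D" "p_group_on G q Q"
    using Q(1) by (auto simp: sylow_of_def p_group_on_def)
  have Q1: "Q \<noteq> {\<one>}" using sylow_nontriv[OF Q(1) q(2)] .
  obtain x where x: "x \<in> Q" "x \<noteq> \<one>" using Q1 subgroup.one_closed[OF Qs(1)] by blast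
  have xc: "x \<in> carrier G" "x \<in> D" using x Qs(2) Dc by auto
  define K where "K = P <#> Q"
  have Ks: "subgroup K G" unfolding K_def using set_mult_subgroup[OF Ps(1) Qs(1) Q(2)] .
  have PK: "P \<subseteq> K" unfolding K_def using set_mult_upper1[OF Ps(1) Qs(1)] .
  have QK: "Q \<subseteq> K" unfolding K_def using set_mult_upper2[OF Ps(1) Qs(1)] .
  have Kna: "non_abelian K G"
  proof -
    have "x \<otimes> z \<noteq> z \<otimes> x" using fpf[OF xc(2) z(1,2)] x(2) by blast
    then show ?thesis unfolding non_abelian_def using x(1) z(1) PK QK by blast
  qed
  \<comment> \<open>The centralizer of \<open>K\<close> is trivial: an element \<open>c\<close> of
    it commutes with \<open>z \<in> P\<close>, so it lies in \<open>B\<close>. If \<open>c\<close>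
    were nontrivial, commuting with \<open>x\<close> would put \<open>x\<close> into
    \<open>B\<close>, although \<open>D \<inter> B\<close> is trivial.\<close>
  have Ksc: "centralizer G K \<subseteq> K"
  proof
    fix c assume c: "c \<in> centralizer G K"
    have cc: "c \<in> carrier G" using c centralizer_carrier by blast
    have "c \<otimes> z = z \<otimes> c" using c z PK centralizerD by blast
    then have "conj_by G c z = z" using cc z conj_by_eq_iff by blast
    then have cB: "c \<in> B" using malnormalD[OF B(3) cc, of z] z B(2) by auto
    have "x \<otimes> c = c \<otimes> x" using centralizerD[OF c] x QK by (metis subsetD)
    then have cx: "conj_by G x c = c" using cc xc conj_by_eq_iff by blast
    have "c = \<one>"
    proof (rule ccontr)
      assume "c \<noteq> \<one>"
      then have "x \<in> B" using malnormalD[OF B(3) xc(1) cB] cx cB by simp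
      then show False using xc(2) x(2) B(4) by blast
    qed
    then show "c \<in> K" using subgroup.one_closed[OF Ks] by simp
  qed
  have Kn: "K \<subseteq> normalizer_of G Q"
    unfolding K_def by (rule set_mult_least[OF normalizer_subgroup[OF subgroup.subset[OF Qs(1)]] Q(2) sub_in_normalizer[OF Qs(1)]])
  show False
    using hyp[OF Ks Kna Ksc PK]
  proof
    assume KTI: "TI_subgroup K G"
    have "malnormal_in G Q D"
      unfolding malnormal_in_def
    proof (intro ballI impI)
      fix d y assume d: "d \<in> D" "y \<in> Q" "y \<noteq> \<one>" "conj_by G d y \<in> Q"
      have dc: "d \<in> carrier G" using d Dc by blast
      have "d \<in> normalizer_of G K" using TI_subgroupD[OF KTI dc _ d(3)] d(2,4) QK by blast
      then obtain k n where kn: "k \<in> K" "n \<in> normalizer_of G P" "d = k \<otimes> n"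
        using frattini[OF Ks sylow_over_P[OF Ks PK] p] by metis
      obtain u v where uv: "u \<in> P" "v \<in> Q" "k = u \<otimes> v"
        using kn(1) unfolding K_def by (rule set_multE)
      have cs: "u \<in> carrier G" "v \<in> carrier G" "n \<in> carrier G"
        using uv Ps(3) subgroup_mem[OF Qs(1)] normalizer_carrier[OF kn(2)] by auto
      define w where "w = conj_by G u v"
      have w: "w \<in> Q" "w \<in> D" "w \<in> carrier G"
        unfolding w_def using uv Q(2) normalizerD Qs(2) cs by blast+
      \<comment> \<open>Moving \<open>u\<close> past \<open>v\<close> splits \<open>d\<close> into
        an element \<open>w\<close> of \<open>Q\<close> and an element \<open>m\<close> of
        \<open>D\<close> normalizing \<open>P\<close>. The commutator of \<open>m\<close> with
        \<open>z\<close> lies in \<open>D \<inter> P\<close>, so \<open>m\<close> commutes with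
        \<open>z\<close>, and the fixed-point-free action gives \<open>m = \<one>\<close>.\<close>
      define m where "m = u \<otimes> n"
      have dm: "d = w \<otimes> m" using kn(3) uv(3) cs by (simp add: w_def m_def conj_by_def m_assoc)
      have mP: "m \<in> normalizer_of G P" unfolding m_def
        using uv(1) kn(2) sub_in_normalizer[OF Ps(1)] subgroup.m_closed[OF normalizer_subgroup[OF Ps(3)]]
          by blast
      have mc: "m \<in> carrier G" using mP normalizer_carrier by blast
      have "m = inv w \<otimes> d" using dm w mc by simp
      then have mD: "m \<in> D" using w d D(2) subgroup.m_closed subgroup.m_inv_closed by metis
      have "commutator G m z \<in> D"
        using mD mc z(3) D(3) subgroup.m_inv_closed[OF D(2) mD]
        by (auto simp: commutator_conj_by intro!: subgroup.m_closed[OF D(2)] normalizerD[of z D])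
      moreover have "commutator G m z \<in> P"
        using normalizerD[OF mP z(1)] mc z(3) subgroup.m_inv_closed[OF Ps(1) z(1)]
        by (auto simp: commutator_conj_by' intro!: subgroup.m_closed[OF Ps(1)])
      ultimately have "commutator G m z = \<one>" using DP by blast
      then have "m \<otimes> z = z \<otimes> m" using mc z(3) by (simp add: commutator_eq_one_iff)
      then have "m = \<one>" using fpf[OF mD z(1,2)] by blast
      then show "d \<in> Q" using dm w by simp
    qed
    then have "perfect_on G Q" using malnormal_perfect[OF D(1) Qs(1,2)] by blast
    then show False using p_group_no_perfect[OF Qs(3) q(1)] Q1 by blast
  next
    assume "subnormal G K"
    then have Qn: "carrier G \<subseteq> normalizer_of G Q"
      using sylow_subnormal_normal[OF _ D(2,3) Q(1) q(1) QK Kn] by blast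
    define A where "A = Q \<inter> centralizer G Q"
    have "subgroup A G" unfolding A_def
      using Qs(1) centralizer_subgroup[OF subgroup.subset[OF Qs(1)]] subgroups_Inter_pair by blast
    moreover have "carrier G \<subseteq> normalizer_of G A"
      unfolding A_def using normalizer_centre[OF Qs(1)] Qn by blast
    moreover have "\<not> non_abelian A G" unfolding A_def non_abelian_def using centralizerD by blast
    moreover have "A \<noteq> {\<one>}"
    proof -
      obtain v where v: "v \<in> Q" "v \<noteq> \<one>" "\<And>g. g \<in> Q \<Longrightarrow> g \<otimes> v = v \<otimes> g"
        using p_group_fixed_point[OF Qs(3,3) Q1 q(1) sub_in_normalizer[OF Qs(1)]] by blast
      then have "v \<in> A" unfolding A_def using subgroup_mem[OF Qs(1)] by (auto simp: centralizer_def)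
      then show ?thesis using v(2) by blast
    qed
    ultimately show False using noA by blast
  qed
qed

end

section \<open>Fixed-point-free action on an abelian normal subgroup\<close>

text \<open>An ordered product with factors of index below \<open>n\<close>. The order is fixed
  because the ambient group need not be commutative; for factors in an abelian subgroup it is
  irrelevant.\<close>

primrec seq_prod :: "('a, 'b) monoid_scheme \<Rightarrow> (nat \<Rightarrow> 'a) \<Rightarrow> nat \<Rightarrow> 'a" where
  "seq_prod G f 0 = \<one>\<^bsub>G\<^esub>"
| "seq_prod G f (Suc n) = seq_prod G f n \<otimes>\<^bsub>G\<^esub> f n"

context fin_group
begin

section \<open>Ordered products and norms\<close>

lemma seq_prod_mem: "subgroup A G \<Longrightarrow> (\<And>i. i < n \<Longrightarrow> f i \<in> A) \<Longrightarrow> seq_prod G f n \<in> A"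
  by (induction n) (auto simp: subgroup.one_closed subgroup.m_closed)

lemma seq_prod_one: "(\<And>i. i < n \<Longrightarrow> f i = \<one>) \<Longrightarrow> seq_prod G f n = \<one>"
  by (induction n) auto

lemma seq_prod_const: "a \<in> carrier G \<Longrightarrow> seq_prod G (\<lambda>_. a) n = a [^] n"
  by (induction n) auto

lemma seq_prod_conj_by:
  assumes "g \<in> carrier G" "\<And>i. f i \<in> carrier G"
  shows "conj_by G g (seq_prod G f n) = seq_prod G (\<lambda>i. conj_by G g (f i)) n"
proof (induction n)
  case (Suc n)
  have "seq_prod G f n \<in> carrier G" using seq_prod_mem[OF subgroup_self] assms(2) by blast
  then show ?case using Suc assms by (simp add: conj_by_mult)
qed (use assms in simp)

lemma seq_prod_first:
  assumes "\<And>i. f i \<in> carrier G" "\<And>i. 0 < i \<Longrightarrow> i \<le> n \<Longrightarrow> f i = \<one>"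
  shows "seq_prod G f (Suc n) = f 0"
  using assms(2)
proof (induction n)
  case (Suc n)
  then have "seq_prod G f (Suc n) = f 0" by simp
  then show ?case using Suc.prems assms(1) by simp
qed (use assms in simp)

lemma seq_prod_mult:
  assumes A: "subgroup A G" "\<not> non_abelian A G" and f: "\<And>i. f i \<in> A" "\<And>i. g i \<in> A"
  shows "seq_prod G (\<lambda>i. f i \<otimes> g i) n = seq_prod G f n \<otimes> seq_prod G g n"
proof (induction n)
  case (Suc n)
  let ?F = "seq_prod G f n" and ?H = "seq_prod G g n"
  have m: "?F \<in> A" "?H \<in> A" using seq_prod_mem[OF A(1)] f by auto
  have com: "?H \<otimes> f n = f n \<otimes> ?H" using A(2) m f unfolding non_abelian_def by blast
  have c: "?F \<in> carrier G" "?H \<in> carrier G" "f n \<in> carrier G" "g n \<in> carrier G"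
    using m f subgroup_mem[OF A(1)] by auto
  have "?F \<otimes> ?H \<otimes> (f n \<otimes> g n) = ?F \<otimes> (?H \<otimes> f n) \<otimes> g n"
    using c by (simp add: m_assoc)
  also have "\<dots> = ?F \<otimes> f n \<otimes> (?H \<otimes> g n)"
    unfolding com using c by (simp add: m_assoc)
  finally show ?case using Suc by simp
qed simp

lemma seq_prod_swap:
  assumes A: "subgroup A G" "\<not> non_abelian A G" and f: "\<And>i j. f i j \<in> A"
  shows "seq_prod G (\<lambda>j. seq_prod G (\<lambda>i. f i j) m) n = seq_prod G (\<lambda>i. seq_prod G (f i) n) m"
proof (induction n)
  case 0
  then show ?case using seq_prod_one[of m "\<lambda>_. \<one>"] by simp
next
  case (Suc n)
  then show ?case using seq_prod_mult[OF A, of "\<lambda>i. seq_prod G (f i) n" "\<lambda>i. f i n" m] f seq_prod_mem[OF A(1)]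
    by simp
qed

text \<open>Conjugation by \<open>w\<close> shifts the factors of the norm by one place, and the
  shift is cyclic because the r-th power of \<open>w\<close> is \<one>. Since \<open>A\<close> is
  abelian, the norm is fixed by \<open>w\<close>, and \<open>fpf\<close> makes it trivial.\<close>

lemma norm_trivial:
  assumes A: "subgroup A G" "\<not> non_abelian A G" "w \<in> normalizer_of G A" and w: "w [^] (r::nat) = \<one>"
    and fpf: "\<And>a. a \<in> A \<Longrightarrow> w \<otimes> a = a \<otimes> w \<Longrightarrow> a = \<one>" and a: "a \<in> A"
  shows "seq_prod G (\<lambda>i. conj_by G (w [^] i) a) r = \<one>"
proof -
  have wc: "w \<in> carrier G" using A(3) normalizer_carrier by blast
  have ac: "a \<in> carrier G" using a A(1) subgroup_mem by blast
  let ?N = "seq_prod G (\<lambda>i. conj_by G (w [^] i) a)"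
  have pw: "w [^] i \<in> normalizer_of G A" for i :: nat
    by (induction i) (use A(3) normalizer_subgroup[OF subgroup.subset[OF A(1)]] in \<open>auto simp: subgroup.one_closed subgroup.m_closed\<close>)
  have mem: "?N n \<in> A" for n by (rule seq_prod_mem[OF A(1)], rule normalizerD[OF pw a])
  have Nc: "?N n \<in> carrier G" for n using mem subgroup_mem[OF A(1)] by blast
  have shift: "a \<otimes> conj_by G w (?N n) = ?N (Suc n)" for n
  proof (induction n)
    case (Suc n)
    have e: "conj_by G w (conj_by G (w [^] n) a) = conj_by G (w [^] Suc n) a"
      using wc ac by (simp add: conj_by_conj_by nat_pow_Suc2[symmetric] del: nat_pow_Suc)
    have "a \<otimes> conj_by G w (?N (Suc n)) = a \<otimes> conj_by G w (?N n) \<otimes> conj_by G (w [^] Suc n) a"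
      using wc ac Nc e by (simp add: conj_by_mult m_assoc del: nat_pow_Suc)
    then show ?case using Suc by simp
  qed (use wc ac in simp)
  have "a \<otimes> conj_by G w (?N r) = ?N r \<otimes> a" using shift[of r] w ac by simp
  also have "\<dots> = a \<otimes> ?N r" using A(2) mem a unfolding non_abelian_def by blast
  finally have "conj_by G w (?N r) = ?N r" using wc ac Nc by simp
  then have "w \<otimes> ?N r = ?N r \<otimes> w" using wc Nc conj_by_eq_iff by blast
  then show ?thesis using fpf[OF mem] by blast
qed

section \<open>Cyclic subgroups and elements of prime order\<close>

lemma card_cyc: "x \<in> carrier G \<Longrightarrow> card (cyc x) = ord x"
  by (simp add: generate_pow_card)

lemma cyc_pow: "x \<in> carrier G \<Longrightarrow> y \<in> cyc x \<Longrightarrow> \<exists>k::nat. y = x [^] k"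
  using generate_pow_on_finite_carrier[OF fin] by blast

lemma pow_mem: "subgroup H G \<Longrightarrow> x \<in> H \<Longrightarrow> x [^] (n::nat) \<in> H"
  by (induction n) (auto simp: subgroup.one_closed subgroup.m_closed)

lemma ord_prime:
  assumes "x \<in> carrier G" "x [^] (r::nat) = \<one>" "x \<noteq> \<one>" "Factorial_Ring.prime r"
  shows "ord x = r"
proof -
  have "ord x dvd r" using assms pow_eq_id by blast
  then have "ord x = 1 \<or> ord x = r" using assms(4) by (metis prime_nat_iff)
  then show ?thesis using assms(1,3) ord_eq_1 by blast
qed

text \<open>The norm of $a \in A$ over any nontrivial cyclic subgroup of \<open>K\<close> is fixed by that subgroup, hence
  trivial. Multiplying the norms over the \<open>r\<close> subgroups generated by $u v^j$ and cancelling the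
  norms over the subgroups generated by powers of \<open>v\<close> leaves $a^r = 1$, which contradicts $|A| \equiv 1$ modulo \<open>r\<close>.\<close>
theorem fixed_point_free_rank_one:
  fixes r :: nat
  assumes A: "subgroup A G" "\<not> non_abelian A G" "A \<noteq> {\<one>}" "carrier G \<subseteq> normalizer_of G A"
    and K: "subgroup K G"
    and fpf: "\<And>k a. k \<in> K \<Longrightarrow> k \<noteq> \<one> \<Longrightarrow> a \<in> A \<Longrightarrow> k \<otimes> a = a \<otimes> k \<Longrightarrow> a = \<one>"
    and r: "Factorial_Ring.prime r"
    and u: "u \<in> K" "u [^] r = \<one>" "u \<noteq> \<one>" and v: "v \<in> K" "v [^] r = \<one>" "v \<noteq> \<one>"
    and uv: "u \<otimes> v = v \<otimes> u"
  shows "u \<in> cyc v"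
proof (rule ccontr)
  assume nuv: "u \<notin> cyc v"
  note c = subgroup_mem[OF K] subgroup_mem[OF A(1)]
  have uc: "u \<in> carrier G" "v \<in> carrier G" using u v c by auto
  have nm: "w \<in> normalizer_of G A" if "w \<in> K" for w using that A(4) c by blast
  obtain a where a: "a \<in> A" "a \<noteq> \<one>" using A(3) subgroup.one_closed[OF A(1)] by blast
  have ac: "a \<in> carrier G" using a c by blast
  have vi: "v [^] i \<noteq> \<one>" if "0 < i" "i < r" for i :: nat
  proof
    assume "v [^] i = \<one>"
    then have "r dvd i" using ord_prime[OF uc(2) v(2,3) r] pow_eq_id uc by metis
    then show False using that by (simp add: nat_dvd_not_less)
  qed
  have norm1: "seq_prod G (\<lambda>i. conj_by G (w [^] i) a) r = \<one>" if "w \<in> K" "w [^] r = \<one>" "w \<noteq> \<one>" for w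
    using norm_trivial[OF A(1,2) nm[OF that(1)] that(2) fpf[OF that(1,3)] a(1)] by blast
  \<comment> \<open>For fixed \<open>j\<close>, the product over \<open>i\<close> is the norm of
    \<open>a\<close> for u v^j and is trivial. For fixed \<open>i > 0\<close>, the product over
    \<open>j\<close> is the conjugate by u^i of the norm of \<open>a\<close> for v^i, again trivial.
    Exchanging the two products leaves only the terms with \<open>i = 0\<close>, all equal to
    \<open>a\<close>.\<close>
  define f where "f i j = conj_by G ((u \<otimes> v [^] j) [^] i) a" for i j :: nat
  have comj: "u \<otimes> v [^] j = v [^] j \<otimes> u" for j :: nat
    using group_commutes_pow[OF uv[symmetric] uc(2,1), of j] by simp
  have fA: "f i j \<in> A" for i j
    unfolding f_def by (rule normalizerD[OF subsetD[OF A(4)] a(1)]) (use uc in simp)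
  have fc: "f i j \<in> carrier G" for i j using fA c by blast
  have "seq_prod G (\<lambda>i. f i j) r = \<one>" for j
    unfolding f_def
  proof (rule norm1)
    show "u \<otimes> v [^] j \<in> K" using u v pow_mem[OF K] subgroup.m_closed[OF K] by blast
    have "(v [^] j) [^] r = \<one>" using uc v(2) by (metis mult.commute nat_pow_one nat_pow_pow)
    then show "(u \<otimes> v [^] j) [^] r = \<one>" using pow_mult_distrib[OF comj] uc u(2) by simp
    show "u \<otimes> v [^] j \<noteq> \<one>"
    proof
      assume "u \<otimes> v [^] j = \<one>"
      then have "u = inv (v [^] j)" using uc inv_equality by (metis nat_pow_closed)
      then have "u \<in> cyc v"
        using pow_mem[OF cyc_subgroup[OF uc(2)] cyc_self] subgroup.m_inv_closed[OF cyc_subgroup[OF uc(2)]]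
          by simp
      then show False using nuv by blast
    qed
  qed
  then have "\<one> = seq_prod G (\<lambda>j. seq_prod G (\<lambda>i. f i j) r) r" by (simp add: seq_prod_one)
  also have "\<dots> = seq_prod G (\<lambda>i. seq_prod G (f i) r) r"
    using seq_prod_swap[OF A(1,2), of f] fA by blast
  also have "\<dots> = seq_prod G (f 0) r"
  proof -
    obtain n where n: "r = Suc n" using r by (metis not0_implies_Suc not_prime_0)
    have "seq_prod G (f i) r = \<one>" if i: "0 < i" "i \<le> n" for i
    proof -
      have "f i j = conj_by G (u [^] i) (conj_by G ((v [^] i) [^] j) a)" for j
        unfolding f_def using pow_mult_distrib[OF comj] uc ac
          by (simp add: conj_by_conj_by nat_pow_pow mult.commute)
      then have "f i = (\<lambda>j. conj_by G (u [^] i) (conj_by G ((v [^] i) [^] j) a))" by blast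
      then have "seq_prod G (f i) r = conj_by G (u [^] i) (seq_prod G (\<lambda>j. conj_by G ((v [^] i) [^] j) a) r)"
        using uc ac by (simp add: seq_prod_conj_by)
      moreover have "seq_prod G (\<lambda>j. conj_by G ((v [^] i) [^] j) a) r = \<one>"
      proof (rule norm1)
        show "v [^] i \<in> K" using v(1) pow_mem[OF K] by blast
        show "(v [^] i) [^] r = \<one>" using uc v(2) by (metis mult.commute nat_pow_one nat_pow_pow)
        show "v [^] i \<noteq> \<one>" using vi i n by simp
      qed
      ultimately show ?thesis using uc by simp
    qed
    moreover have "seq_prod G (f i) r \<in> carrier G" for i using seq_prod_mem[OF subgroup_self] fc by blast
    ultimately have "seq_prod G (\<lambda>i. seq_prod G (f i) r) (Suc n) = seq_prod G (f 0) r"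
      by (intro seq_prod_first) auto
    then show ?thesis by (simp only: n)
  qed
  also have "f 0 = (\<lambda>_. a)" using uc ac by (auto simp: f_def)
  also have "seq_prod G (\<lambda>_. a) r = a [^] r" by (rule seq_prod_const[OF ac])
  finally have ar: "a [^] r = \<one>" by simp
  \<comment> \<open>The group generated by \<open>u\<close> has order r and fixes only \<one> in
    \<open>A\<close>, so the order of \<open>A\<close> is 1 modulo r. But \<open>a\<close> has order
    r.\<close>
  have "card (cyc u) = r ^ 1" using card_cyc uc ord_prime[OF uc(1) u(2,3) r] by simp
  then have "card A mod r = card {x \<in> A. \<forall>g \<in> cyc u. conj_by G g x = x} mod r"
  proof (rule card_fixed_cong[OF cyc_subgroup[OF uc(1)] _ r finite_subgroup[OF A(1)]])
    fix g x assume "g \<in> cyc u" "x \<in> A"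
    then show "conj_by G g x \<in> A" using A(4) normalizerD subgroup_mem[OF cyc_subgroup[OF uc(1)]] by blast
  qed (use c subgroup_mem[OF cyc_subgroup[OF uc(1)]] in \<open>auto simp: conj_by_conj_by\<close>)
  also have "{x \<in> A. \<forall>g \<in> cyc u. conj_by G g x = x} = {\<one>}"
  proof -
    have "x = \<one>" if x: "x \<in> A" "\<forall>g \<in> cyc u. conj_by G g x = x" for x
    proof -
      have "conj_by G u x = x" using x cyc_self by blast
      then have "u \<otimes> x = x \<otimes> u" using conj_by_eq_iff uc x c by blast
      then show ?thesis using fpf[OF u(1,3) x(1)] by blast
    qed
    moreover have "\<forall>g \<in> cyc u. conj_by G g \<one> = \<one>"
      using subgroup_mem[OF cyc_subgroup[OF uc(1)]] by simp
    ultimately show ?thesis using subgroup.one_closed[OF A(1)] by blast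
  qed
  finally have m1: "card A mod r = 1" using prime_gt_1_nat[OF r] by simp
  have "r dvd card A"
    using card_dvd[OF cyc_subgroup[OF ac] A(1) cyc_least[OF A(1) a(1)]] card_cyc[OF ac] ord_prime[OF ac ar a(2) r]
      by simp
  then show False using m1 by simp
qed

text \<open>By Bezout, some multiples of \<open>m\<close> and \<open>n\<close> differ by
  one.\<close>

lemma coprime_pow_mem:
  assumes H: "subgroup H G" and y: "y \<in> carrier G" "y [^] (m::nat) \<in> H" "y [^] (n::nat) \<in> H" and "coprime m n" "m \<noteq> 0"
  shows "y \<in> H"
proof -
  obtain s t where st: "m * s = n * t + 1"
    using bezout_nat[OF assms(6), of n] assms(5) by (auto simp: coprime_iff_gcd_eq_1)
  have "y [^] (m * s) = y [^] (n * t) \<otimes> y" using st y(1) by (simp add: nat_pow_mult[symmetric])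
  then have "y = inv (y [^] (n * t)) \<otimes> y [^] (m * s)" using y(1) by simp
  moreover have "y [^] (n * t) \<in> H" "y [^] (m * s) \<in> H"
    using pow_mem[OF H y(3), of t] pow_mem[OF H y(2), of s] y(1) by (simp_all add: nat_pow_pow)
  ultimately show ?thesis using subgroup.m_closed[OF H] subgroup.m_inv_closed[OF H] by metis
qed

text \<open>Without C_r x C_r, two commuting r-elements generate a cyclic r-group, whose subgroups
  form a chain.\<close>

lemma prime_power_comparable:
  fixes r a b :: nat
  assumes K: "subgroup K G" and r: "Factorial_Ring.prime r"
    and rank: "\<And>u v. u \<in> K \<Longrightarrow> v \<in> K \<Longrightarrow> u [^] r = \<one> \<Longrightarrow> v [^] r = \<one> \<Longrightarrow> u \<noteq> \<one> \<Longrightarrow> v \<noteq> \<one> \<Longrightarrow>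
      u \<otimes> v = v \<otimes> u \<Longrightarrow> u \<in> cyc v"
    and x: "x \<in> K" "x [^] (r ^ a) = \<one>" and y: "y \<in> K" "y [^] (r ^ b) = \<one>" and xy: "x \<otimes> y = y \<otimes> x"
  shows "x \<in> cyc y \<or> y \<in> cyc x"
proof (rule ccontr)
  assume n: "\<not> (x \<in> cyc y \<or> y \<in> cyc x)"
  have c: "x \<in> carrier G" "y \<in> carrier G" using x y subgroup_mem[OF K] by auto
  note cy = cyc_subgroup[OF c(2)] and cx = cyc_subgroup[OF c(1)]
  define i where "i = (LEAST i. x [^] (r ^ i) \<in> cyc y)"
  have "x [^] (r ^ a) \<in> cyc y" using x(2) subgroup.one_closed[OF cy] by simp
  then have i: "x [^] (r ^ i) \<in> cyc y" unfolding i_def by (rule LeastI)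
  have "i \<noteq> 0"
  proof
    assume "i = 0"
    then show False using i n c by simp
  qed
  then obtain j where j: "i = Suc j" using not0_implies_Suc by blast
  \<comment> \<open>The last r-power step of \<open>x\<close> still outside the group of
    \<open>y\<close>: \<open>w\<close> is not in it, but the r-th power of \<open>w\<close> is, say
    y^k.\<close>
  define w where "w = x [^] (r ^ j)"
  have wn: "w \<notin> cyc y"
    using not_less_Least[of j "\<lambda>i. x [^] (r ^ i) \<in> cyc y"] j by (simp add: i_def w_def)
  have wc: "w \<in> carrier G" "w \<in> K" "w \<in> cyc x"
    unfolding w_def using c pow_mem[OF K x(1)] pow_mem[OF cx cyc_self] by auto
  have wr: "w [^] r \<in> cyc y" using i j c by (simp add: w_def nat_pow_pow mult.commute)
  then obtain k :: nat where k: "w [^] r = y [^] k" using cyc_pow[OF c(2)] by blast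
  have wy: "w \<otimes> y = y \<otimes> w" unfolding w_def using group_commutes_pow[OF xy c] by simp
  show False
  proof (cases "r dvd k")
    case True
    then obtain l where l: "k = r * l" by blast
    \<comment> \<open>Correcting \<open>w\<close> by y^l gives an element of order r outside the
      group of \<open>y\<close>. That group contains \<open>v\<close> of order r, so
      \<open>rank\<close> forces \<open>u\<close> into it after all.\<close>
    define u where "u = w \<otimes> inv (y [^] l)"
    have yl: "y [^] l \<in> carrier G" "y [^] l \<in> K" "y [^] l \<in> cyc y"
      using c pow_mem[OF K y(1)] pow_mem[OF cy cyc_self] by auto
    have wyl: "w \<otimes> y [^] l = y [^] l \<otimes> w"
      using group_commutes_pow[OF wy[symmetric] c(2) wc(1)] by simp
    have wyl': "w \<otimes> inv (y [^] l) = inv (y [^] l) \<otimes> w"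
      using wyl wc yl by (metis inv_solve_left inv_solve_right inv_closed m_closed m_assoc)
    have uK: "u \<in> K"
      unfolding u_def using wc yl subgroup.m_closed[OF K] subgroup.m_inv_closed[OF K] by blast
    have w_eq: "w = u \<otimes> y [^] l" using wc yl by (simp add: u_def m_assoc)
    have un: "u \<notin> cyc y" using w_eq wn yl subgroup.m_closed[OF cy] by metis
    have u1: "u \<noteq> \<one>" using un subgroup.one_closed[OF cy] by blast
    have "(y [^] l) [^] r = y [^] k" using c l by (simp add: nat_pow_pow mult.commute)
    then have ur: "u [^] r = \<one>"
      unfolding u_def using pow_mult_distrib[OF wyl'] wc yl k c by (simp add: nat_pow_inv)
    define e where "e = (LEAST e. y [^] (r ^ e) = \<one>)"
    have e: "y [^] (r ^ e) = \<one>" unfolding e_def using y(2) by (rule LeastI)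
    have "y \<noteq> \<one>" using n subgroup.one_closed[OF cx] by blast
    have "e \<noteq> 0"
    proof
      assume "e = 0"
      then show False using e c \<open>y \<noteq> \<one>\<close> by simp
    qed
    then obtain d where d: "e = Suc d" using not0_implies_Suc by blast
    define v where "v = y [^] (r ^ d)"
    have v1: "v \<noteq> \<one>"
      using not_less_Least[of d "\<lambda>e. y [^] (r ^ e) = \<one>"] d by (simp add: e_def v_def)
    have vr: "v [^] r = \<one>" using e d c by (simp add: v_def nat_pow_pow mult.commute)
    have vK: "v \<in> K" "v \<in> cyc y" "v \<in> carrier G"
      unfolding v_def using pow_mem[OF K y(1)] pow_mem[OF cy cyc_self] c by auto
    have uc: "u \<in> carrier G" using uK subgroup_mem[OF K] by blast
    have uy: "u \<in> centralizer G {y}"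
    proof -
      have C: "subgroup (centralizer G {y}) G" using centralizer_subgroup c by simp
      have "w \<in> centralizer G {y}" "y \<in> centralizer G {y}"
        using wc wy c by (auto simp: centralizer_def)
      then show ?thesis
        unfolding u_def using pow_mem[OF C] subgroup.m_closed[OF C] subgroup.m_inv_closed[OF C] by blast
    qed
    have "u \<otimes> v = v \<otimes> u"
      unfolding v_def using group_commutes_pow[of y u] centralizerD[OF uy] c uc by simp
    then have "u \<in> cyc v" using rank[OF uK vK(1) ur vr u1 v1] by blast
    then show False using un cyc_least[OF cy vK(2)] by blast
  next
    case False
    \<comment> \<open>Here y^k generates the same group as \<open>y\<close>, and it is a power of
      \<open>x\<close>.\<close>
    then have "coprime k (r ^ b)" using r by (metis coprime_commute coprime_power_left_iff prime_imp_coprime)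
    moreover have "k \<noteq> 0" using False by (metis dvd_0_right)
    moreover have "y [^] k \<in> cyc x" using k pow_mem[OF cx wc(3)] by metis
    moreover have "y [^] (r ^ b) \<in> cyc x" using y(2) subgroup.one_closed[OF cx] by simp
    ultimately have "y \<in> cyc x" using coprime_pow_mem[OF cx c(2)] by blast
    then show False using n by blast
  qed
qed

end

section \<open>Reduction to self-centralizing subgroups\<close>

context fin_group
begin

lemma times_centralizer_normalizer: "subgroup H G \<Longrightarrow> times_centralizer H \<subseteq> normalizer_of G H"
  unfolding times_centralizer_def
  using set_mult_least[OF normalizer_subgroup sub_in_normalizer centralizer_normalizer] subgroup.subset
    by blast

text \<open>Distinct conjugates of \<open>K\<close> under the normalizer of its normalizer are normal there and
  intersect trivially, so they would centralize each other.\<close>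
lemma TI_normalizer_self_normalizing:
  assumes K: "subgroup K G" "K \<noteq> {\<one>}" "centralizer G K \<subseteq> K" "TI_subgroup K G"
    and x: "x \<in> normalizer_of G (normalizer_of G K)"
  shows "x \<in> normalizer_of G K"
proof (rule ccontr)
  assume nx: "x \<notin> normalizer_of G K"
  have xc: "x \<in> carrier G" using x normalizer_carrier by blast
  note c = subgroup_mem[OF K(1)]
  have Ms: "subgroup (normalizer_of G K) G" using normalizer_subgroup subgroup.subset[OF K(1)] by blast
  have KM: "K \<subseteq> normalizer_of G K" using sub_in_normalizer[OF K(1)] .
  obtain k where k: "k \<in> K" "k \<noteq> \<one>" using K(2) subgroup.one_closed[OF K(1)] by blast
  have ni: "y = \<one>" if yK: "y \<in> K" "y \<in> conj_by G x ` K" for y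
  proof (rule ccontr)
    assume y: "y \<noteq> \<one>"
    obtain l where l: "l \<in> K" "y = conj_by G x l" using yK(2) by blast
    have "l \<noteq> \<one>" using l y xc by auto
    then show False using TI_subgroupD[OF K(4) xc l(1)] l yK(1) nx by blast
  qed
  let ?y = "conj_by G x k"
  have yM: "?y \<in> normalizer_of G K" using normalizerD[OF x] k KM by blast
  have yc: "?y \<in> carrier G" using k c xc by blast
  have xK: "subgroup (conj_by G x ` K) G" using conj_by_img_subgroup[OF K(1) xc] .
  have yxK: "?y \<in> conj_by G x ` K" using k by blast
  have "?y \<otimes> l = l \<otimes> ?y" if l: "l \<in> K" for l
  proof -
    have lc: "l \<in> carrier G" using l c by blast
    have "commutator G ?y l \<in> K"
      using normalizerD[OF yM l] subgroup.m_inv_closed[OF K(1) l] yc lc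
      by (auto simp: commutator_conj_by' intro: subgroup.m_closed[OF K(1)])
    moreover have "commutator G ?y l \<in> conj_by G x ` K"
    proof -
      let ?m = "conj_by G (inv x) l"
      have mM: "?m \<in> normalizer_of G K" using normalizerD'[OF subgroup.subset[OF Ms] x] l KM by blast
      have mc: "?m \<in> carrier G" using xc lc by simp
      have ki: "inv k \<in> K" using subgroup.m_inv_closed[OF K(1) k(1)] .
      have "conj_by G l (inv ?y) = conj_by G x (conj_by G ?m (inv k))"
      proof -
        have "conj_by G x (conj_by G ?m (inv k)) = conj_by G (conj_by G x ?m) (conj_by G x (inv k))"
          using xc mc c[OF ki] by (simp add: conj_by_def m_assoc inv_mult_group)
        then show ?thesis using xc lc k c by (simp add: conj_by_inv)
      qed
      then have "conj_by G l (inv ?y) \<in> conj_by G x ` K" using normalizerD[OF mM ki] by blast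
      then show ?thesis using yxK yc lc by (auto simp: commutator_conj_by intro: subgroup.m_closed[OF xK])
    qed
    ultimately have "commutator G ?y l = \<one>" using ni by blast
    then show ?thesis using yc lc by (simp add: commutator_eq_one_iff)
  qed
  \<comment> \<open>Self-centralization puts the nontrivial conjugate of \<open>k\<close> back into
    \<open>K\<close>, which the TI property allows only if \<open>x\<close> normalizes
    \<open>K\<close>.\<close>
  then have "?y \<in> K" using K(3) yc by (auto simp: centralizer_def)
  then show False using TI_subgroupD[OF K(4) xc k] nx by blast
qed

text \<open>A nontrivial element of a malnormal subgroup has its centralizer inside it. So a central
  element \<open>z\<close> of \<open>P\<close>, commuting with \<open>y \<in> M\<close>, lies in
  \<open>M\<close>, and then all of \<open>P\<close>, commuting with \<open>z\<close>, does.\<close>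

lemma sylow_in_malnormal:
  assumes M: "subgroup M G" "malnormal_in G M (carrier G)" and p: "Factorial_Ring.prime p" "p dvd card M"
  obtains P where "sylow_of G p P (carrier G)" "P \<subseteq> M" "P \<noteq> {\<one>}"
proof -
  obtain P0 where P0: "sylow_of G p P0 M" using sylow_exists[OF M(1) p(1)] by blast
  have P0s: "p_group_on G p P0" "subgroup P0 G" "P0 \<subseteq> M"
    using P0 by (auto simp: sylow_of_def p_group_on_def)
  obtain y where y: "y \<in> P0" "y \<noteq> \<one>"
    using sylow_nontriv[OF P0 p(2)] subgroup.one_closed[OF P0s(2)] by blast
  obtain P where P: "sylow_of G p P (carrier G)" "P0 \<subseteq> P"
    using sylow_contains[OF P0s(1) subgroup.subset[OF P0s(2)] subgroup_self p(1)] by blast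
  have Ps: "p_group_on G p P" "subgroup P G" using P by (auto simp: sylow_of_def p_group_on_def)
  note c = subgroup_mem[OF Ps(2)]
  have P1: "P \<noteq> {\<one>}" using y P(2) by blast
  obtain z where z: "z \<in> P" "z \<noteq> \<one>" "\<And>g. g \<in> P \<Longrightarrow> g \<otimes> z = z \<otimes> g"
    using p_group_fixed_point[OF Ps(1,1) P1 p(1) sub_in_normalizer[OF Ps(2)]] by blast
  have yP: "y \<in> P" "y \<in> M" using y P(2) P0s(3) by auto
  have "conj_by G z y = y" using z(3)[OF yP(1)] c[OF z(1)] c[OF yP(1)] conj_by_eq_iff by metis
  then have zM: "z \<in> M" using malnormalD[OF M(2) c[OF z(1)] yP(2) y(2)] yP by simp
  have "P \<subseteq> M"
  proof
    fix g assume g: "g \<in> P"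
    have "conj_by G g z = z" using z(3)[OF g] c[OF z(1)] c[OF g] conj_by_eq_iff by metis
    then show "g \<in> M" using malnormalD[OF M(2) c[OF g] zM z(2)] zM by simp
  qed
  then show thesis using that P(1) P1 by blast
qed

text \<open>Let \<open>y\<close> be the image of the r-element \<open>x\<close>. If the centralizer
  of \<open>H\<close> has an r-element outside \<open>H\<close>, comparability makes
  \<open>x\<close> a power of it, hence central in the whole product, and \<open>x\<close> and
  \<open>y\<close> generate the same group. Otherwise the r-elements of the centralizer lie in
  \<open>H\<close>, and so does the centralizer factor of \<open>y\<close>.\<close>

lemma central_factor_invariant:
  fixes r a :: nat
  assumes H: "subgroup H G" and g: "g \<in> normalizer_of G (times_centralizer H)" and r: "Factorial_Ring.prime r"
    and rank: "\<And>u v. u \<in> times_centralizer H \<Longrightarrow> v \<in> times_centralizer H \<Longrightarrow> u [^] r = \<one> \<Longrightarrow> v [^] r = \<one> \<Longrightarrow>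
      u \<noteq> \<one> \<Longrightarrow> v \<noteq> \<one> \<Longrightarrow> u \<otimes> v = v \<otimes> u \<Longrightarrow> u \<in> cyc v"
    and x: "x \<in> H" "x [^] (r ^ a) = \<one>"
  shows "conj_by G g x \<in> H"
proof -
  let ?C = "centralizer G H" and ?K = "times_centralizer H"
  note K = times_centralizer_props[OF H]
  have C: "subgroup ?C G" using centralizer_subgroup subgroup.subset[OF H] by blast
  have gc: "g \<in> carrier G" using g normalizer_carrier by blast
  have xc: "x \<in> carrier G" "x \<in> ?K" using x H K(2) subgroup_mem by auto
  define y where "y = conj_by G g x"
  have yK: "y \<in> ?K" unfolding y_def using normalizerD[OF g xc(2)] .
  have yc: "y \<in> carrier G" using yK K(1) subgroup_mem by blast
  have yp: "y [^] n = conj_by G g (x [^] n)" for n :: nat unfolding y_def using conj_by_pow gc xc by simp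
  have ya: "y [^] (r ^ a) = \<one>" using yp x gc by simp
  have comparable: "z \<in> cyc w \<or> w \<in> cyc z"
    if "z \<in> ?K" "z [^] (r ^ i) = \<one>" "w \<in> ?K" "w [^] (r ^ j) = \<one>" "z \<otimes> w = w \<otimes> z" for z w and i j :: nat
    using K(1) r rank that by (rule prime_power_comparable)
  have "y \<in> H"
  proof (cases "\<exists>c \<in> ?C. c \<notin> H \<and> (\<exists>b. c [^] (r ^ b) = \<one>)")
    case True
    then obtain c b where c: "c \<in> ?C" "c \<notin> H" "c [^] (r ^ b) = \<one>" by blast
    have "c \<otimes> x = x \<otimes> c" using centralizerD[OF c(1) x(1)] .
    then have "x \<in> cyc c \<or> c \<in> cyc x"
      using comparable[OF xc(2) x(2) subsetD[OF K(3) c(1)] c(3)] by simp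
    then have "x \<in> cyc c" using cyc_least[OF H x(1)] c(2) by blast
    then have xC: "x \<in> ?C" using cyc_least[OF C c(1)] by blast
    have "?K \<subseteq> centralizer G {x}"
      unfolding times_centralizer_def
    proof (rule set_mult_least)
      show "subgroup (centralizer G {x}) G" using centralizer_subgroup xc by simp
      show "H \<subseteq> centralizer G {x}"
        using xC subgroup_mem[OF H] by (auto simp: centralizer_def)
      show "centralizer G H \<subseteq> centralizer G {x}" using centralizer_antimono[of "{x}" H] x by blast
    qed
    then have "y \<otimes> x = x \<otimes> y" using yK centralizerD by blast
    then have "x \<in> cyc y \<or> y \<in> cyc x" using comparable[OF xc(2) x(2) yK ya] by simp
    then have "y \<in> cyc x"
    proof
      assume "x \<in> cyc y"
      then have sub: "cyc x \<subseteq> cyc y" using cyc_least[OF cyc_subgroup[OF yc]] by blast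
      have "ord y = ord x"
      proof (rule dvd_antisym)
        have "y [^] ord x = \<one>" using yp[of "ord x"] gc xc by simp
        then show "ord y dvd ord x" using pow_eq_id yc by blast
        have "conj_by G g (x [^] ord y) = \<one>" using yp[of "ord y"] yc by simp
        then have "x [^] ord y = \<one>" using gc xc by simp
        then show "ord x dvd ord y" using pow_eq_id xc by blast
      qed
      then have "cyc x = cyc y"
        using sub card_cyc[OF yc] card_cyc[OF xc(1)] finite_subgroup[OF cyc_subgroup[OF yc]]
          by (intro card_subset_eq) auto
      then show ?thesis using cyc_self by blast
    qed
    then show ?thesis using cyc_least[OF H x(1)] by blast
  next
    case False
    then have all: "c \<in> H" if "c \<in> ?C" "c [^] (r ^ b) = \<one>" for c b using that by blast
    obtain h c where hc: "h \<in> H" "c \<in> ?C" "y = h \<otimes> c"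
      using yK unfolding times_centralizer_def by (rule set_multE)
    have cs: "h \<in> carrier G" "c \<in> carrier G" using hc subgroup_mem[OF H] subgroup_mem[OF C] by auto
    have "h \<otimes> c = c \<otimes> h" using centralizerD[OF hc(2,1)] by simp
    \<comment> \<open>This puts the power of \<open>c\<close> with exponent r^a into
      \<open>H\<close>. With \<open>m\<close> the part of the order of \<open>c\<close> prime to r,
      c^m is an r-element of the centralizer and lies in \<open>H\<close> too; the exponents are
      coprime, so \<open>c \<in> H\<close>.\<close>
    then have "h [^] (r ^ a) \<otimes> c [^] (r ^ a) = \<one>" using ya hc(3) cs pow_mult_distrib by metis
    then have "c [^] (r ^ a) = inv (h [^] (r ^ a))"
      using cs by (metis inv_equality inv_inv inv_comm nat_pow_closed)
    then have ca: "c [^] (r ^ a) \<in> H" using pow_mem[OF H hc(1)] subgroup.m_inv_closed[OF H] by simp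
    have "ord c \<noteq> 0" using ord_ge_1[OF fin cs(2)] by simp
    then obtain m where m: "ord c = r ^ multiplicity r (ord c) * m" "\<not> r dvd m"
      using multiplicity_decompose'[of "ord c" r] r by (metis not_prime_unit)
    have "(c [^] m) [^] (r ^ multiplicity r (ord c)) = \<one>"
      using cs m(1) by (metis mult.commute nat_pow_pow pow_ord_eq_1)
    then have cm: "c [^] m \<in> H" using all[of "c [^] m"] pow_mem[OF C hc(2)] by blast
    have "m \<noteq> 0" using m(2) by (metis dvd_0_right)
    moreover have "coprime m (r ^ a)"
      using r m(2) by (metis coprime_commute coprime_power_left_iff prime_imp_coprime)
    ultimately have "c \<in> H" using coprime_pow_mem[OF H cs(2) cm ca] by blast
    then show ?thesis using hc subgroup.m_closed[OF H] by simp
  qed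
  then show ?thesis by (simp add: y_def)
qed

theorem self_centralizing_suffices:
  assumes p: "Factorial_Ring.prime p"
    and hyp: "\<And>L. subgroup L G \<Longrightarrow> non_abelian L G \<Longrightarrow> centralizer G L \<subseteq> L \<Longrightarrow> p dvd card L \<Longrightarrow>
      TI_subgroup L G \<or> subnormal G L"
    and H: "subgroup H G" "non_abelian H G" "p dvd card H"
  shows "TI_subgroup H G \<or> subnormal G H"
proof (rule disjCI)
  assume nsH: "\<not> subnormal G H"
  define K where "K = times_centralizer H"
  note K = times_centralizer_props[OF H(1), folded K_def]
  have Kna: "non_abelian K G" using non_abelian_mono[OF H(2) K(2)] .
  have pK: "p dvd card K" using card_dvd[OF H(1) K(1,2)] H(3) dvd_trans by blast
  have "\<not> subnormal G K"
  proof
    assume "subnormal G K"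
    then have "subnormal G H"
      using subnormal.step[OF _ K(1) normal_in_subgroupI[OF K(1) H(1) K(2)]] times_centralizer_normalizer[OF H(1)]
        by (simp add: K_def)
    then show False using nsH by blast
  qed
  then have KTI: "TI_subgroup K G" using hyp[OF K(1) Kna K(4) pK] by blast
  have K1: "K \<noteq> {\<one>}" using Kna by (auto simp: non_abelian_def)
  define M where "M = normalizer_of G K"
  have M: "subgroup M G" unfolding M_def using normalizer_subgroup subgroup.subset[OF K(1)] by blast
  have KM: "K \<subseteq> M" unfolding M_def using sub_in_normalizer[OF K(1)] .
  have KnM: "K \<lhd> (G\<lparr>carrier := M\<rparr>)"
    using normal_in_subgroupI[OF M K(1) KM] by (simp add: M_def)
  \<comment> \<open>\<open>K\<close> is normal in \<open>M\<close>, so subnormality of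
    \<open>M\<close> would pass down to \<open>K\<close>.\<close>
  have nsM: "\<not> subnormal G M"
    using subnormal.step[OF _ M KnM] \<open>\<not> subnormal G K\<close> by blast
  have Mna: "non_abelian M G" using non_abelian_mono[OF Kna KM] .
  have "centralizer G M \<subseteq> M" using centralizer_antimono[OF KM] K(4) KM by blast
  moreover have pM: "p dvd card M" using card_dvd[OF K(1) M KM] pK dvd_trans by blast
  ultimately have MTI: "TI_subgroup M G" using hyp[OF M Mna] nsM by blast
  have Mmal: "malnormal_in G M (carrier G)"
    unfolding malnormal_in_def
  proof (intro ballI impI)
    fix t b assume "t \<in> carrier G" "b \<in> M" "b \<noteq> \<one>" "conj_by G t b \<in> M"
    then have "t \<in> normalizer_of G M" using TI_subgroupD[OF MTI] by blast
    then show "t \<in> M" unfolding M_def using TI_normalizer_self_normalizing[OF K(1) K1 K(4) KTI] by blast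
  qed
  have MG: "M \<noteq> carrier G" using nsM subnormal.top by metis
  obtain P where P: "sylow_of G p P (carrier G)" "P \<subseteq> M" "P \<noteq> {\<one>}"
    by (rule sylow_in_malnormal[OF M Mmal p pM])
  have Ps: "subgroup P G" "\<exists>k. card P = p ^ k" using P(1) by (auto simp: sylow_of_def p_group_on_def)
  have pP: "p dvd card P"
  proof -
    obtain k where k: "card P = p ^ k" using Ps(2) by blast
    have "k \<noteq> 0"
    proof
      assume "k = 0"
      then have "card P = 1" using k by simp
      then show False using P(3) subgroup.one_closed[OF Ps(1)] by (metis card_1_singletonE singletonD)
    qed
    then show ?thesis using k by simp
  qed
  have "malnormal_sylow G p M P"
  proof (intro malnormal_sylow.intro malnormal_sylow_axioms.intro fin_group_axioms p M MG Mmal Mna P)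
    fix L assume L: "subgroup L G" "non_abelian L G" "centralizer G L \<subseteq> L" "P \<subseteq> L"
    then have "p dvd card L" using card_dvd[OF Ps(1) L(1,4)] pP dvd_trans by blast
    then show "TI_subgroup L G \<or> subnormal G L" using hyp[OF L(1-3)] by blast
  qed
  then obtain A where A: "subgroup A G" "A \<noteq> {\<one>}" "carrier G \<subseteq> normalizer_of G A" "\<not> non_abelian A G"
    using malnormal_sylow.abelian_normal_exists by blast
  note Ac = subgroup_mem[OF A(1)]
  \<comment> \<open>A nontrivial common element would pull the abelian \<open>A\<close> into the
    malnormal \<open>M\<close>, and then all of \<open>G\<close>, since \<open>A\<close> is
    normal.\<close>
  have AM: "a = \<one>" if a: "a \<in> A" "a \<in> M" for a
  proof (rule ccontr)
    assume a1: "a \<noteq> \<one>"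
    have "A \<subseteq> M"
    proof
      fix b assume b: "b \<in> A"
      then have "b \<otimes> a = a \<otimes> b" using A(4) a unfolding non_abelian_def by blast
      then have "conj_by G b a = a" using b a Ac conj_by_eq_iff by blast
      then show "b \<in> M" using malnormalD[OF Mmal Ac[OF b] a(2) a1] a by simp
    qed
    have "carrier G \<subseteq> M"
    proof
      fix g assume g: "g \<in> carrier G"
      then have "conj_by G g a \<in> M" using A(3) a normalizerD \<open>A \<subseteq> M\<close> by blast
      then show "g \<in> M" using malnormalD[OF Mmal g a(2) a1] by blast
    qed
    then show False using MG subgroup.subset[OF M] by blast
  qed
  have fpf: "a = \<one>" if k: "k \<in> K" "k \<noteq> \<one>" and a: "a \<in> A" "k \<otimes> a = a \<otimes> k" for k a
  proof -
    have kc: "k \<in> carrier G" using k K(1) subgroup_mem by blast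
    have "conj_by G a k = k" using kc a Ac conj_by_eq_iff by metis
    then have "a \<in> M" using malnormalD[OF Mmal Ac[OF a(1)], of k] k KM by auto
    then show ?thesis using AM a by blast
  qed
  have rank: "u \<in> cyc v" if "Factorial_Ring.prime r" "u \<in> K" "v \<in> K" "u [^] r = \<one>" "v [^] r = \<one>" "u \<noteq> \<one>" "v \<noteq> \<one>" "u \<otimes> v = v \<otimes> u" for r :: nat and u v
    using A(1,4,2,3) K(1) fpf that(1,2,4,6,3,5,7,8) by (rule fixed_point_free_rank_one)
  have invariant: "g \<in> normalizer_of G H" if g: "g \<in> normalizer_of G K" for g
  proof -
    have gc: "g \<in> carrier G" using g normalizer_carrier by blast
    let ?Y = "{x \<in> H. conj_by G g x \<in> H}"
    have Y: "subgroup ?Y G"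
      using subgroup_mem[OF H(1)] gc subgroup.one_closed[OF H(1)] subgroup.m_closed[OF H(1)]
      by (intro finite_subgroupI) (auto simp: conj_by_mult)
    \<comment> \<open>\<open>central_factor_invariant\<close> handles elements of prime power order
      only, so the invariance of \<open>H\<close> is checked on one Sylow subgroup for each
      prime.\<close>
    have "?Y = H"
    proof (rule subgroup_eq_if_sylows[OF H(1) Y])
      fix r assume r: "Factorial_Ring.prime r" "r dvd card H"
      obtain R where R: "sylow_of G r R H" using sylow_exists[OF H(1) r(1)] by blast
      have Rs: "subgroup R G" "R \<subseteq> H" using R by (auto simp: sylow_of_def p_group_on_def)
      obtain k where k: "card R = r ^ k" using R by (auto simp: sylow_of_def p_group_on_def)
      have "R \<subseteq> ?Y"
      proof
        fix x assume x: "x \<in> R"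
        have xc: "x \<in> carrier G" "x \<in> H" using x Rs subgroup_mem by auto
        have "ord x dvd r ^ k"
          using card_dvd[OF cyc_subgroup[OF xc(1)] Rs(1) cyc_least[OF Rs(1) x]] card_cyc[OF xc(1)] k by simp
        then have "x [^] (r ^ k) = \<one>" using pow_eq_id[OF xc(1)] by blast
        then have "conj_by G g x \<in> H"
          using central_factor_invariant[OF H(1) _ r(1), of g x k] g rank[OF r(1)] xc(2)
            unfolding K_def by blast
        then show "x \<in> ?Y" using xc by simp
      qed
      then show "\<exists>R. sylow_of G r R H \<and> R \<subseteq> ?Y" using R by blast
    qed auto
    then show ?thesis using gc by (auto intro!: normalizerI)
  qed
  show "TI_subgroup H G"
    unfolding TI_subgroup_def
  proof (intro conjI ballI H(1))
    fix g assume g: "g \<in> carrier G"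
    have e: "conj_sub G H g = conj_by G (inv g) ` H" using conj_by_image_conj_sub[of "inv g" H] g by simp
    have o: "\<one> \<in> conj_sub G H g \<inter> H"
      unfolding e using subgroup.one_closed[OF H(1)] g by (auto simp: image_iff intro!: bexI[of _ \<one>])
    show "conj_sub G H g \<inter> H = {\<one>} \<or> conj_sub G H g \<inter> H = H"
    proof (cases "conj_sub G H g \<inter> H = {\<one>}")
      case False
      then obtain h where h: "h \<in> H" "conj_by G (inv g) h \<in> H" "conj_by G (inv g) h \<noteq> \<one>"
        using o unfolding e by blast
      have "h \<noteq> \<one>" using h(3) g by auto
      \<comment> \<open>A nontrivial intersection of \<open>H\<close> with its conjugate is one of
        \<open>K\<close> with its conjugate, so the TI property of \<open>K\<close> makes the
        conjugating element normalize \<open>K\<close> and hence \<open>H\<close>.\<close>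
      then have "inv g \<in> normalizer_of G K" using TI_subgroupD[OF KTI, of "inv g" h] h K(2) g by blast
      then have "conj_by G (inv g) ` H = H"
        using invariant normalizer_img[OF subgroup.subset[OF H(1)]] by blast
      then show ?thesis using e by simp
    qed simp
  qed
qed

end

theorem theorem1p7:
  fixes G :: "('a, 'b) monoid_scheme" and p :: nat
  assumes "group G" and "finite (carrier G)" and "Factorial_Ring.prime p" and "p dvd order G"
  shows "(\<forall>H. subgroup H G \<and> self_centralizing H G \<and> non_abelian H G \<longrightarrow>
             TI_subgroup H G \<or> subnormal G H \<or> p'_order p H)
     \<longleftrightarrow> (\<forall>H. subgroup H G \<and> non_abelian H G \<longrightarrow>
             TI_subgroup H G \<or> subnormal G H \<or> p'_order p H)"
proof
  interpret fin_group G using assms by (simp add: fin_group_def fin_group_axioms_def)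
  assume *: "\<forall>H. subgroup H G \<and> self_centralizing H G \<and> non_abelian H G \<longrightarrow>
             TI_subgroup H G \<or> subnormal G H \<or> p'_order p H"
  then have "TI_subgroup L G \<or> subnormal G L"
    if "subgroup L G" "non_abelian L G" "centralizer G L \<subseteq> L" "p dvd card L" for L
    using that unfolding self_centralizing_def p'_order_def by blast
  then show "\<forall>H. subgroup H G \<and> non_abelian H G \<longrightarrow> TI_subgroup H G \<or> subnormal G H \<or> p'_order p H"
    using self_centralizing_suffices[OF assms(3)] unfolding p'_order_def by blast
qed blast

end
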